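(* Let $\mathbb{G}$ be a homogeneous group of homogeneous dimension $Q$, let $|\cdot|$ be a homogeneous quasi-norm on $\mathbb{G}$, let $\mathcal{R}$ be the associated radial derivative operator, and let $1<p<Q$. (i) For every complex-valued function $f\in C_0^\infty(\mathbb{G}\setminus\{0\})$, $$\left\|\frac{f}{|x|}\right\|_{L^p(\mathbb{G})}\le \frac{p}{Q-p}\,\|\mathcal{R}f\|_{L^p(\mathbb{G})}.$$ The constant $\frac{p}{Q-p}$ is sharp (it is the smallest constant for which the inequality holds for all such $f$). Moreover, equality holds if and only if $f=0$. (ii) Let $f\in C_0^\infty(\mathbb{G}\setminus\{0\})$ be real-valued and set $$u(x)=-\frac{p}{Q-p}\,\mathcal{R}f(x),\qquad v(x)=\frac{f(x)}{|x|}.$$ Then $$\|u\|_{L^p(\mathbb{G})}^p-\|v\|_{L^p(\mathbb{G})}^p=p\int_{\mathbb{G}}I_p(v,u)\,|v-u|^2\,dx,$$ where $$I_p(h,g)=(p-1)\int_0^1|\xi h+(1-\xi)g|^{p-2}\,\xi\,d\xi .$$ (iii) In the case $p=2$ the identity of (ii) holds for complex-valued functions as well. Namely, if $Q\ge 3$, then for every complex-valued function $f\in C_0^\infty(\mathbb{G}\setminus\{0\})$, $$\|\mathcal{R}f\|_{L^2(\mathbb{G})}^2=\left(\frac{Q-2}{2}\right)^2\left\|\frac{f}{|x|}\right\|_{L^2(\mathbb{G})}^2+\left\|\mathcal{R}f+\frac{Q-2}{2}\frac{f}{|x|}\right\|_{L^2(\mathbb{G})}^2 .$$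
   Context: A homogeneous group $\mathbb{G}$ is a connected, simply connected Lie group whose Lie algebra $\mathfrak{g}$ is equipped with a family of dilations $D_\lambda=\mathrm{Exp}(A\ln\lambda)=\sum_{k\ge0}\frac{1}{k!}(\ln(\lambda)A)^k$, $\lambda>0$, where $A$ is a diagonalisable linear operator on $\mathfrak{g}$ with positive eigenvalues and each $D_\lambda$ is a Lie algebra morphism. Such a group is nilpotent and the exponential map $\exp_{\mathbb{G}}:\mathfrak{g}\to\mathbb{G}$ is a global diffeomorphism; it transports the dilations to $\mathbb{G}$, where they are written $D_\lambda x$ or $\lambda x$, i.e. $D_\lambda(\exp_{\mathbb{G}}X)=\exp_{\mathbb{G}}(D_\lambda X)$. The homogeneous dimension is $Q=\mathrm{Tr}\,A$. The identity element of $\mathbb{G}$ is denoted $0$, $dx$ denotes Haar measure on $\mathbb{G}$, and $L^p(\mathbb{G})$ is taken with respect to $dx$. A homogeneous quasi-norm is a continuous function $|\cdot|:\mathbb{G}\to[0,\infty)$ with $|x^{-1}|=|x|$ for all $x\in\mathbb{G}$, $|\lambda x|=\lambda|x|$ for all $x\in\mathbb{G}$, $\lambda>0$, and $|x|=0$ if and only if $x=0$. The operator $\mathcal{R}=\frac{d}{d|x|}$ is the radial derivative: for $x\neq 0$, writing $x=D_{\rho}y$ with $\rho=|x|$ and $|y|=1$, $\mathcal{R}f(x)=\frac{d}{dr}f(D_r y)\big|_{r=\rho}$. $C_0^\infty(\mathbb{G}\setminus\{0\})$ is the space of smooth functions with compact support in $\mathbb{G}\setminus\{0\}$. The integrand $I_p(v,u)|v-u|^2$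 is understood to be $0$ at points where $u=v=0$. *)

theory Defs
  imports "HOL-Analysis.Analysis"
begin

section \<open>Smooth functions and charts\<close>

text \<open>For finite-dimensional domains (the only use below) and open \<open>S\<close>, a map is \<open>C\<^sup>k\<^sup>+\<^sup>1\<close> iff it is
  differentiable and all its directional derivatives are \<open>C\<^sup>k\<close>.\<close>

primrec Ck_on :: "nat \<Rightarrow> 'a::real_normed_vector set \<Rightarrow> ('a \<Rightarrow> 'b::real_normed_vector) \<Rightarrow> bool" where
  "Ck_on 0 S f \<longleftrightarrow> continuous_on S f"
| "Ck_on (Suc k) S f \<longleftrightarrow> (\<forall>x\<in>S. f differentiable (at x)) \<and>
     (\<forall>v. Ck_on k S (\<lambda>x. frechet_derivative f (at x) v))"

definition smooth_on :: "'a::real_normed_vector set \<Rightarrow> ('a \<Rightarrow> 'b::real_normed_vector) \<Rightarrow> bool" where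
  "smooth_on S f \<longleftrightarrow> (\<forall>k. Ck_on k S f)"

text \<open>A chart is a domain together with a coordinate map, which is arbitrary off the domain.\<close>

type_synonym ('g, 'e) chart = "'g set \<times> ('g \<Rightarrow> 'e)"

abbreviation chart_inv :: "('g, 'e) chart \<Rightarrow> 'e \<Rightarrow> 'g" where
  "chart_inv c \<equiv> inv_into (fst c) (snd c)"

abbreviation chart_image :: "('g, 'e) chart \<Rightarrow> 'e set" where
  "chart_image c \<equiv> snd c ` fst c"

definition smooth_fun ::
  "('g, 'e::euclidean_space) chart set \<Rightarrow> ('g \<Rightarrow> 'b::real_normed_vector) \<Rightarrow> bool" where
  "smooth_fun atlas f \<longleftrightarrow> (\<forall>c\<in>atlas. smooth_on (chart_image c) (f \<circ> chart_inv c))"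

section \<open>Lie groups\<close>

text \<open>The group is written additively although it need not be commutative (the class
  \<open>group_add\<close> does not assume commutativity): \<open>x + y\<close> is the group product, \<open>- x\<close> the group
  inverse and \<open>0\<close> the identity. Its dimension is \<open>DIM('e)\<close>.\<close>

locale lie_group =
  fixes atlas :: "('g::{topological_group_add, t2_space, second_countable_topology},
                   'e::euclidean_space) chart set"
  assumes covers: "(\<Union>c\<in>atlas. fst c) = UNIV"
    and open_domain: "c \<in> atlas \<Longrightarrow> open (fst c)"
    and open_image: "c \<in> atlas \<Longrightarrow> open (chart_image c)"
    and chart_homeomorphism:
      "c \<in> atlas \<Longrightarrow> homeomorphism (fst c) (chart_image c) (snd c) (chart_inv c)"
    and smooth_transition:
      "c \<in> atlas \<Longrightarrow> d \<in> atlas \<Longrightarrow>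
        smooth_on (snd c ` (fst c \<inter> fst d)) (snd d \<circ> chart_inv c)"
    and smooth_product:
      "c \<in> atlas \<Longrightarrow> d \<in> atlas \<Longrightarrow> e \<in> atlas \<Longrightarrow>
        smooth_on {(snd c x, snd d y) |x y. x \<in> fst c \<and> y \<in> fst d \<and> x + y \<in> fst e}
          (\<lambda>(a, b). snd e (chart_inv c a + chart_inv d b))"
    and smooth_inverse:
      "c \<in> atlas \<Longrightarrow> d \<in> atlas \<Longrightarrow>
        smooth_on (snd c ` {x \<in> fst c. - x \<in> fst d}) (\<lambda>a. snd d (- chart_inv c a))"

text \<open>The Lie algebra is the tangent space at the identity, identified with the model space \<open>'e\<close>
  by the differential of a chart \<open>\<kappa>\<close> around \<open>0\<close>. The vector \<open>X\<close> is extended to a left-invariant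
  vector field, acting on functions as a derivation; the bracket is the one whose
  left-invariant field is the commutator.\<close>

definition left_field ::
  "('g::group_add, 'e::euclidean_space) chart \<Rightarrow> 'e \<Rightarrow> ('g \<Rightarrow> real) \<Rightarrow> 'g \<Rightarrow> real" where
  "left_field \<kappa> X f x = frechet_derivative (\<lambda>z. f (x + chart_inv \<kappa> z)) (at (snd \<kappa> 0)) X"

definition lie_bracket ::
  "('g::group_add, 'e::euclidean_space) chart set \<Rightarrow> ('g, 'e) chart \<Rightarrow> 'e \<Rightarrow> 'e \<Rightarrow> 'e" where
  "lie_bracket atlas \<kappa> X Y = (THE Z. \<forall>f. smooth_fun atlas f \<longrightarrow> (\<forall>x.
     left_field \<kappa> Z f x =
       left_field \<kappa> X (left_field \<kappa> Y f) x - left_field \<kappa> Y (left_field \<kappa> X f) x))"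

text \<open>\<open>E\<close> is the exponential map iff \<open>t \<mapsto> E (t X)\<close> is, for every \<open>X\<close>, the one-parameter
  subgroup with initial velocity \<open>X\<close>.\<close>

definition exponential_map ::
  "('g::{group_add, topological_space}, 'e::euclidean_space) chart \<Rightarrow> ('e \<Rightarrow> 'g) \<Rightarrow> bool" where
  "exponential_map \<kappa> E \<longleftrightarrow> (\<forall>X.
     continuous_on UNIV (\<lambda>t. E (t *\<^sub>R X)) \<and>
     (\<forall>s t. E ((s + t) *\<^sub>R X) = E (s *\<^sub>R X) + E (t *\<^sub>R X)) \<and>
     ((\<lambda>t. snd \<kappa> (E (t *\<^sub>R X))) has_vector_derivative X) (at 0))"

definition global_diffeomorphism ::
  "('g::topological_space, 'e::euclidean_space) chart set \<Rightarrow> ('e \<Rightarrow> 'g) \<Rightarrow> bool" where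
  "global_diffeomorphism atlas E \<longleftrightarrow>
     homeomorphism UNIV UNIV E (inv E) \<and>
     (\<forall>c\<in>atlas. smooth_on (E -` fst c) (snd c \<circ> E)) \<and>
     smooth_fun atlas (inv E)"

section \<open>Homogeneous groups\<close>

definition diagonalisable :: "('e::euclidean_space \<Rightarrow> 'e) \<Rightarrow> bool" where
  "diagonalisable A \<longleftrightarrow> (\<exists>B. independent B \<and> span B = UNIV \<and> (\<forall>b\<in>B. \<exists>\<nu>. A b = \<nu> *\<^sub>R b))"

definition algebra_dilation :: "('e::euclidean_space \<Rightarrow> 'e) \<Rightarrow> real \<Rightarrow> 'e \<Rightarrow> 'e" where
  "algebra_dilation A r X = (\<Sum>k. (1 / fact k) *\<^sub>R (((\<lambda>Y. ln r *\<^sub>R A Y) ^^ k) X))"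

definition homogeneous_dimension :: "('e::euclidean_space \<Rightarrow> 'e) \<Rightarrow> real" where
  "homogeneous_dimension A = (\<Sum>b\<in>Basis. A b \<bullet> b)"

locale homogeneous_group = lie_group atlas
  for atlas :: "('g::{topological_group_add, t2_space, second_countable_topology},
                 'e::euclidean_space) chart set" +
  fixes \<kappa> :: "('g, 'e) chart" and A :: "'e \<Rightarrow> 'e"
  assumes connected_group: "connected (UNIV :: 'g set)"
    and simply_connected_group: "simply_connected (UNIV :: 'g set)"
    and identity_chart: "\<kappa> \<in> atlas" "0 \<in> fst \<kappa>"
    and linear_A: "linear A"
    and diagonalisable_A: "diagonalisable A"
    and positive_eigenvalues: "X \<noteq> 0 \<Longrightarrow> A X = \<nu> *\<^sub>R X \<Longrightarrow> \<nu> > 0"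
    and dilation_morphism:
      "r > 0 \<Longrightarrow> algebra_dilation A r (lie_bracket atlas \<kappa> X Y) =
        lie_bracket atlas \<kappa> (algebra_dilation A r X) (algebra_dilation A r Y)"

text \<open>The exponential map \<open>E\<close> of a homogeneous group is a global diffeomorphism (such a group is
  nilpotent and simply connected); this classical fact is not part of the locale and has to be
  supplied wherever \<open>inv E\<close> is to be the inverse of \<open>E\<close>, as in the dilations of the group.\<close>

definition group_dilation ::
  "('e::euclidean_space \<Rightarrow> 'e) \<Rightarrow> ('e \<Rightarrow> 'g) \<Rightarrow> real \<Rightarrow> 'g \<Rightarrow> 'g" where
  "group_dilation A E r x = E (algebra_dilation A r (inv E x))"

definition homogeneous_quasi_norm ::
  "('e::euclidean_space \<Rightarrow> 'e) \<Rightarrow> ('e \<Rightarrow> 'g::{group_add, topological_space}) \<Rightarrow> ('g \<Rightarrow> real) \<Rightarrow> bool" where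
  "homogeneous_quasi_norm A E N \<longleftrightarrow>
     continuous_on UNIV N \<and> (\<forall>x. N x \<ge> 0) \<and>
     (\<forall>x. N (- x) = N x) \<and>
     (\<forall>x. \<forall>r>0. N (group_dilation A E r x) = r * N x) \<and>
     (\<forall>x. N x = 0 \<longleftrightarrow> x = 0)"

text \<open>For \<open>x \<noteq> 0\<close>, the point \<open>y = D\<^bsub>1/|x|\<^esub> x\<close> is the unique one with \<open>|y| = 1\<close> and \<open>x = D\<^bsub>|x|\<^esub> y\<close>.
  The value at \<open>0\<close>, which is Haar-null, is irrelevant.\<close>

definition radial_derivative ::
  "('e::euclidean_space \<Rightarrow> 'e) \<Rightarrow> ('e \<Rightarrow> 'g) \<Rightarrow> ('g \<Rightarrow> real) \<Rightarrow>
   ('g \<Rightarrow> 'b::real_normed_vector) \<Rightarrow> 'g \<Rightarrow> 'b" where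
  "radial_derivative A E N f x =
     vector_derivative (\<lambda>r. f (group_dilation A E r (group_dilation A E (1 / N x) x))) (at (N x))"

text \<open>Test functions on \<open>G \<setminus> {0}\<close>, extended by zero to the whole group.\<close>

definition test_function ::
  "('g::{zero, topological_space}, 'e::euclidean_space) chart set \<Rightarrow>
   ('g \<Rightarrow> 'b::real_normed_vector) \<Rightarrow> bool" where
  "test_function atlas f \<longleftrightarrow>
     smooth_fun atlas f \<and> compact (closure {x. f x \<noteq> 0}) \<and> 0 \<notin> closure {x. f x \<noteq> 0}"

section \<open>Integration\<close>

text \<open>No regularity clause is needed: on a second countable locally compact Hausdorff space a
  Borel measure that is finite on compact sets is a Radon measure.\<close>

definition haar_measure :: "'g::{group_add, topological_space} measure \<Rightarrow> bool" where
  "haar_measure M \<longleftrightarrow>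
     sets M = sets borel \<and>
     emeasure M UNIV \<noteq> 0 \<and>
     (\<forall>K. compact K \<longrightarrow> emeasure M K < \<infinity>) \<and>
     (\<forall>a. \<forall>B\<in>sets M. emeasure M ((+) a ` B) = emeasure M B)"

definition in_Lp :: "real \<Rightarrow> 'g measure \<Rightarrow> ('g \<Rightarrow> 'b::real_normed_vector) \<Rightarrow> bool" where
  "in_Lp p M f \<longleftrightarrow> f \<in> borel_measurable M \<and> integrable M (\<lambda>x. norm (f x) powr p)"

text \<open>Only meaningful for functions in \<open>L\<^sup>p\<close>, since the Bochner integral of a non-integrable
  function is \<open>0\<close>.\<close>

definition Lp_norm :: "real \<Rightarrow> 'g measure \<Rightarrow> ('g \<Rightarrow> 'b::real_normed_vector) \<Rightarrow> real" where
  "Lp_norm p M f = (LINT x|M. norm (f x) powr p) powr (1 / p)"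

text \<open>Where the base of the power vanishes, \<open>powr\<close> gives \<open>0\<close>. Unless \<open>h = g = 0\<close> this affects at
  most one \<open>\<xi>\<close>; and for \<open>h = g\<close> the factor \<open>|h - g|\<^sup>2\<close> in the remainder term vanishes.\<close>

definition remainder_weight :: "real \<Rightarrow> 'b::real_normed_vector \<Rightarrow> 'b \<Rightarrow> real" where
  "remainder_weight p h g =
     (p - 1) * (LINT \<xi>:{0..1}|lborel. norm (\<xi> *\<^sub>R h + (1 - \<xi>) *\<^sub>R g) powr (p - 2) * \<xi>)"

end

theory Submission
  imports Defs "HOL-Computational_Algebra.Polynomial"
begin

text \<open>In exponential coordinates the differential of left translation at the identity, \<open>L x\<close>, is determined
  by the equation \<open>V' = y - [x, V]\<close> for \<open>V = t (L (t x))\<^sup>-\<^sup>1 y\<close>. Dilations are automorphisms of the bracket, so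
  \<open>L (D\<^sub>\<lambda> x) = D\<^sub>\<lambda> L x D\<^sub>\<lambda>\<^sup>-\<^sup>1\<close> and \<open>det (L x) = det (L (D\<^sub>\<lambda> x))\<close> tends to \<open>det (L 0) = 1\<close> as
  \<open>\<lambda> \<rightarrow> 0\<close>. Hence Lebesgue measure is left invariant and, by uniqueness, Haar measure is a multiple
  of it; it scales by \<open>\<lambda>\<^sup>Q\<close>.

  Differentiating this scaling law in \<open>\<lambda>\<close> gives
  \<open>\<integral> |v|\<^sup>p = \<integral> |v|\<^bsup>p-2\<^esup> \<langle>v, u\<rangle>\<close>. The integral of \<open>|u|\<^sup>p\<close> minus its tangent at \<open>v\<close>,
  a nonnegative function that vanishes only where \<open>u = v\<close>, is therefore \<open>\<parallel>u\<parallel>\<^sup>p - \<parallel>v\<parallel>\<^sup>p\<close>; all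
  the claims but sharpness follow. For sharpness, averages of a bump function along the dilations, weighted by
  \<open>\<lambda>\<^bsup>(Q-p)/p\<^esup>\<close>, solve \<open>u = v\<close> up to boundary terms of bounded norm, while their own norm is
  unbounded.\<close>

section \<open>Smooth functions\<close>

text \<open>A quasi-norm is merely continuous. Polar coordinates are therefore not a smooth change
  of variables, and a cut-off power of |x| need not be a test function. Everything is instead
  expressed through the generator \<open>T\<close> of the dilations: along an orbit |x| is an
  explicit exponential, and integration by parts is the derivative of a change of variables. The
  near-extremals are averages over orbits for the same reason, since such an average inherits the
  smoothness of the bump. The dilations are only given to respect the bracket, which is defined
  through derivations. The differential equation for \<open>L x\<close> carries this symmetry over
  to left translations. On the constant: u = v means that f is homogeneous of degree - (Q - p) / p,
  and then the p-th power of f / |x| has degree - Q, the borderline where integrability fails both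
  at 0 and at infinity. Hence equality is not attained by f \<noteq> 0, and truncations at larger
  and larger scales come arbitrarily close.\<close>

lemmas real_vector_derivative = has_real_derivative_iff_has_vector_derivative

lemmas linear_imp_bounded = linear_conv_bounded_linear[THEN iffD1]

lemma linear_expand:
  assumes "linear f"
  shows "f w = (\<Sum>b\<in>Basis. (w \<bullet> b) *\<^sub>R f b)"
  by (subst euclidean_representation[of w, symmetric]) (simp only: linear_sum[OF assms] linear_cmul[OF assms])

abbreviation fderiv where "fderiv f x \<equiv> frechet_derivative f (at x)"

lemma Ck_on_continuous: "Ck_on k S f \<Longrightarrow> continuous_on S f"
  by (cases k) (auto intro!: continuous_at_imp_continuous_on differentiable_imp_continuous_within)

lemma Ck_on_subset: "Ck_on k S f \<Longrightarrow> T \<subseteq> S \<Longrightarrow> Ck_on k T f"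
  by (induction k arbitrary: f) (auto intro: continuous_on_subset)

lemma Ck_on_Suc_imp: "Ck_on (Suc k) S f \<Longrightarrow> Ck_on k S f"
proof (induction k arbitrary: f)
  case 0 then show ?case using Ck_on_continuous[of "Suc 0"] by simp
qed auto

lemma Ck_on_le: "Ck_on n S f \<Longrightarrow> k \<le> n \<Longrightarrow> Ck_on k S f"
  by (induction n) (auto simp: le_Suc_eq dest: Ck_on_Suc_imp simp del: Ck_on.simps(2))

lemma frechet_derivative_cong:
  assumes "open S" "x \<in> S" "\<And>y. y \<in> S \<Longrightarrow> f y = g y"
  shows "fderiv f x = fderiv g x"
proof -
  have "(f has_derivative D) (at x) \<longleftrightarrow> (g has_derivative D) (at x)" for D
    using assms has_derivative_transform_within_open[of _ D x UNIV S] by metis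
  then show ?thesis by (simp add: frechet_derivative_def)
qed

lemma Ck_on_cong:
  assumes "open S" "\<And>y. y \<in> S \<Longrightarrow> f y = g y"
  shows "Ck_on k S f \<longleftrightarrow> Ck_on k S g"
  using assms(2)
proof (induction k arbitrary: f g)
  case 0 then show ?case by (simp cong: continuous_on_cong)
next
  case (Suc k)
  have "f differentiable (at x) \<longleftrightarrow> g differentiable (at x)" if "x \<in> S" for x
    using assms(1) that Suc.prems has_derivative_transform_within_open[of _ _ x UNIV S]
    unfolding differentiable_def by metis
  moreover have "Ck_on k S (\<lambda>x. fderiv f x v) \<longleftrightarrow> Ck_on k S (\<lambda>x. fderiv g x v)" for v
    by (intro Suc.IH) (use assms(1) Suc.prems frechet_derivative_cong in metis)
  ultimately show ?case by auto
qed

text \<open>Openness of \<open>S\<close> lets any derivative known on \<open>S\<close> replace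
  \<open>frechet_derivative\<close> in the recursive clause, although the two need not agree
  elsewhere.\<close>

lemma Ck_on_SucI:
  assumes "open S" "\<And>x. x \<in> S \<Longrightarrow> (f has_derivative f' x) (at x)" "\<And>v. Ck_on k S (\<lambda>x. f' x v)"
  shows "Ck_on (Suc k) S f"
proof -
  have "fderiv f x = f' x" if "x \<in> S" for x
    using assms(2)[OF that] by (metis frechet_derivative_at)
  then have "Ck_on k S (\<lambda>x. fderiv f x v)" for v
    using assms(3)[of v] Ck_on_cong[OF assms(1), of "\<lambda>x. fderiv f x v" "\<lambda>x. f' x v"] by simp
  then show ?thesis using assms(2) by (auto simp: differentiable_def)
qed

lemma Ck_on_has_derivative:
  "Ck_on (Suc k) S f \<Longrightarrow> x \<in> S \<Longrightarrow> (f has_derivative fderiv f x) (at x)"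
  by (auto simp: frechet_derivative_works)

lemma Ck_on_frechet: "Ck_on (Suc k) S f \<Longrightarrow> Ck_on k S (\<lambda>x. fderiv f x v)"
  by simp

lemma Ck_on_const: "Ck_on k S (\<lambda>x. c)"
  by (induction k arbitrary: c) (auto simp: frechet_derivative_const)

lemma Ck_on_bounded_linear:
  assumes L: "bounded_linear L" and S: "open S"
  shows "Ck_on k S f \<Longrightarrow> Ck_on k S (\<lambda>x. L (f x))"
proof (induction k arbitrary: f)
  case 0 then show ?case using L by (auto intro: continuous_intros bounded_linear.continuous_on)
next
  case (Suc k)
  show ?case
  proof (rule Ck_on_SucI[OF S])
    show "((\<lambda>x. L (f x)) has_derivative (\<lambda>v. L (fderiv f x v))) (at x)" if "x \<in> S" for x
      by (rule bounded_linear.has_derivative[OF L Ck_on_has_derivative[OF Suc.prems that]])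
    show "Ck_on k S (\<lambda>x. L (fderiv f x v))" for v
      by (rule Suc.IH[OF Ck_on_frechet[OF Suc.prems]])
  qed
qed

lemma Ck_on_ident: "Ck_on k S (\<lambda>x. x)"
  by (cases k) (simp_all add: frechet_derivative_ident Ck_on_const)

lemma Ck_on_linear: "bounded_linear L \<Longrightarrow> Ck_on k UNIV L"
  using Ck_on_bounded_linear[OF _ open_UNIV Ck_on_ident, of L] by simp

lemma Ck_on_add:
  assumes S: "open S"
  shows "Ck_on k S f \<Longrightarrow> Ck_on k S g \<Longrightarrow> Ck_on k S (\<lambda>x. f x + g x)"
proof (induction k arbitrary: f g)
  case 0 then show ?case by (auto intro: continuous_intros)
next
  case (Suc k)
  show ?case
  proof (rule Ck_on_SucI[OF S])
    show "((\<lambda>x. f x + g x) has_derivative (\<lambda>v. fderiv f x v + fderiv g x v)) (at x)"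
      if "x \<in> S" for x
      by (intro has_derivative_add Ck_on_has_derivative[OF Suc.prems(1) that] Ck_on_has_derivative[OF Suc.prems(2) that])
    show "Ck_on k S (\<lambda>x. fderiv f x v + fderiv g x v)" for v
      by (intro Suc.IH Ck_on_frechet Suc.prems)
  qed
qed

lemma Ck_on_sum:
  assumes S: "open S"
  shows "(\<And>i. i \<in> I \<Longrightarrow> Ck_on k S (f i)) \<Longrightarrow> Ck_on k S (\<lambda>x. \<Sum>i\<in>I. f i x)"
  by (induction I rule: infinite_finite_induct) (auto intro: Ck_on_const Ck_on_add[OF S])

lemma Ck_on_bilinear:
  assumes B: "bounded_bilinear B" and S: "open S"
  shows "Ck_on k S f \<Longrightarrow> Ck_on k S g \<Longrightarrow> Ck_on k S (\<lambda>x. B (f x) (g x))"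
proof (induction k arbitrary: f g)
  case 0 then show ?case by (auto intro: bounded_bilinear.continuous_on[OF B])
next
  case (Suc k)
  show ?case
  proof (rule Ck_on_SucI[OF S])
    show "((\<lambda>x. B (f x) (g x)) has_derivative (\<lambda>v. B (f x) (fderiv g x v) + B (fderiv f x v) (g x))) (at x)"
      if "x \<in> S" for x
      by (intro bounded_bilinear.FDERIV[OF B] Ck_on_has_derivative[OF Suc.prems(1) that] Ck_on_has_derivative[OF Suc.prems(2) that])
    show "Ck_on k S (\<lambda>x. B (f x) (fderiv g x v) + B (fderiv f x v) (g x))" for v
      by (intro Suc.IH Ck_on_add[OF S] Ck_on_frechet Suc.prems Ck_on_Suc_imp[OF Suc.prems(1)] Ck_on_Suc_imp[OF Suc.prems(2)])
  qed
qed

lemmas Ck_on_scaleR = Ck_on_bilinear[OF bounded_bilinear_scaleR]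
lemmas Ck_on_mult = Ck_on_bilinear[OF bounded_bilinear_mult]

text \<open>\<open>Ck_on\<close> speaks of derivatives in fixed directions, whereas the chain rule
  applies the derivative of \<open>g\<close> in the moving direction \<open>fderiv f x v\<close>.
  Expanding that direction in a basis leaves products of scalar functions with directional
  derivatives of \<open>g\<close> composed with \<open>f\<close>, to which the induction hypothesis
  applies.\<close>

lemma Ck_on_compose:
  fixes f :: "'a::real_normed_vector \<Rightarrow> 'b::euclidean_space" and g :: "'b \<Rightarrow> 'c::real_normed_vector"
  assumes S: "open S" and fS: "f ` S \<subseteq> T"
  shows "Ck_on k S f \<Longrightarrow> Ck_on k T g \<Longrightarrow> Ck_on k S (\<lambda>x. g (f x))"
proof (induction k arbitrary: g)
  case 0 then show ?case using fS by (auto intro: continuous_on_compose2)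
next
  case (Suc k)
  let ?D = "\<lambda>x v. \<Sum>b\<in>Basis. (fderiv f x v \<bullet> b) *\<^sub>R fderiv g (f x) b"
  show ?case
  proof (rule Ck_on_SucI[OF S])
    show "((\<lambda>x. g (f x)) has_derivative ?D x) (at x)" if "x \<in> S" for x
    proof -
      have fx: "f x \<in> T" using fS that by auto
      have l: "linear (fderiv g (f x))"
        using Ck_on_has_derivative[OF Suc.prems(2) fx] by (rule has_derivative_linear)
      have "((\<lambda>x. g (f x)) has_derivative (\<lambda>v. fderiv g (f x) (fderiv f x v))) (at x)"
        by (rule has_derivative_compose[OF Ck_on_has_derivative[OF Suc.prems(1) that] Ck_on_has_derivative[OF Suc.prems(2) fx]])
      moreover have "fderiv g (f x) w = (\<Sum>b\<in>Basis. (w \<bullet> b) *\<^sub>R fderiv g (f x) b)" for w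
        by (rule linear_expand[OF l])
      ultimately show ?thesis by (metis (no_types, lifting) ext)
    qed
    show "Ck_on k S (\<lambda>x. ?D x v)" for v
      by (intro Ck_on_sum[OF S] Ck_on_scaleR[OF S] Ck_on_bounded_linear[OF bounded_linear_inner_left S] Ck_on_frechet
          Suc.IH[OF Ck_on_Suc_imp[OF Suc.prems(1)]] Suc.prems)
  qed
qed

lemma Ck_on_Pair:
  assumes S: "open S" and "Ck_on k S f" "Ck_on k S g"
  shows "Ck_on k S (\<lambda>x. (f x, g x))"
proof -
  have l: "bounded_linear (\<lambda>u. (u, 0))" "bounded_linear (\<lambda>u. (0, u))"
    by (auto intro!: bounded_linear_intros bounded_linear_Pair)
  have "(\<lambda>x. (f x, g x)) = (\<lambda>x. (f x, 0) + (0, g x))" by auto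
  then show ?thesis using Ck_on_add[OF S Ck_on_bounded_linear[OF l(1) S assms(2)] Ck_on_bounded_linear[OF l(2) S assms(3)]]
    by simp
qed

lemma Ck_on_Union:
  assumes "\<And>U. U \<in> C \<Longrightarrow> open U" "\<And>U. U \<in> C \<Longrightarrow> Ck_on k U f"
  shows "Ck_on k (\<Union>C) f"
  using assms(2)
proof (induction k arbitrary: f)
  case 0 then show ?case using assms(1) by (auto intro!: continuous_on_open_Union)
qed auto

lemma smooth_on_local:
  assumes "\<And>x. x \<in> S \<Longrightarrow> \<exists>U. open U \<and> x \<in> U \<and> smooth_on U f"
  shows "smooth_on S f"
  unfolding smooth_on_def
proof
  fix k
  let ?C = "{U. open U \<and> smooth_on U f}"
  have "Ck_on k (\<Union>?C) f" by (rule Ck_on_Union) (auto simp: smooth_on_def)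
  then show "Ck_on k S f" by (rule Ck_on_subset) (use assms in blast)
qed

lemma smooth_on_compose:
  fixes f :: "'a::real_normed_vector \<Rightarrow> 'b::euclidean_space" and g :: "'b \<Rightarrow> 'c::real_normed_vector"
  assumes "open S" "f ` S \<subseteq> T" "smooth_on S f" "smooth_on T g"
  shows "smooth_on S (\<lambda>x. g (f x))"
  using assms unfolding smooth_on_def by (blast intro: Ck_on_compose)

lemma smooth_on_subset: "smooth_on S f \<Longrightarrow> T \<subseteq> S \<Longrightarrow> smooth_on T f"
  unfolding smooth_on_def by (auto intro: Ck_on_subset)

lemma smooth_on_cong: "open S \<Longrightarrow> (\<And>y. y \<in> S \<Longrightarrow> f y = g y) \<Longrightarrow> smooth_on S f \<longleftrightarrow> smooth_on S g"
  unfolding smooth_on_def using Ck_on_cong by blast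

lemma smooth_on_continuous: "smooth_on S f \<Longrightarrow> continuous_on S f"
  unfolding smooth_on_def using Ck_on.simps(1) by blast

lemma smooth_on_has_derivative:
  "smooth_on S f \<Longrightarrow> x \<in> S \<Longrightarrow> (f has_derivative fderiv f x) (at x)"
  unfolding smooth_on_def using Ck_on_has_derivative by blast

lemma linear_fderiv: "smooth_on S f \<Longrightarrow> x \<in> S \<Longrightarrow> linear (fderiv f x)"
  by (rule has_derivative_linear[OF smooth_on_has_derivative])

lemma smooth_on_frechet: "smooth_on S f \<Longrightarrow> smooth_on S (\<lambda>x. fderiv f x v)"
  unfolding smooth_on_def using Ck_on_frechet by blast

lemma smooth_on_bounded_linear: "bounded_linear L \<Longrightarrow> open S \<Longrightarrow> smooth_on S f \<Longrightarrow> smooth_on S (\<lambda>x. L (f x))"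
  unfolding smooth_on_def by (auto intro: Ck_on_bounded_linear)

lemma linear_imp_smooth_on: "bounded_linear L \<Longrightarrow> smooth_on UNIV L"
  unfolding smooth_on_def by (auto intro: Ck_on_linear)

lemma smooth_on_Pair: "open S \<Longrightarrow> smooth_on S f \<Longrightarrow> smooth_on S g \<Longrightarrow> smooth_on S (\<lambda>x. (f x, g x))"
  unfolding smooth_on_def by (auto intro: Ck_on_Pair)

lemma smooth_on_const: "smooth_on S (\<lambda>x. c)"
  unfolding smooth_on_def by (auto intro: Ck_on_const)

lemma smooth_on_ident: "smooth_on S (\<lambda>x. x)"
  unfolding smooth_on_def by (auto intro: Ck_on_ident)

lemma smooth_on_sum: "open S \<Longrightarrow> (\<And>i. i \<in> I \<Longrightarrow> smooth_on S (f i)) \<Longrightarrow> smooth_on S (\<lambda>x. \<Sum>i\<in>I. f i x)"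
  unfolding smooth_on_def by (auto intro: Ck_on_sum)

lemma smooth_on_scaleR: "open S \<Longrightarrow> smooth_on S f \<Longrightarrow> smooth_on S g \<Longrightarrow> smooth_on S (\<lambda>x. f x *\<^sub>R g x)"
  unfolding smooth_on_def by (auto intro: Ck_on_scaleR)

lemma has_vector_derivative_line:
  assumes "(F has_derivative D) (at (c + s *\<^sub>R v))"
  shows "((\<lambda>s. F (c + s *\<^sub>R v)) has_vector_derivative D v) (at s)"
proof -
  have "((\<lambda>s. c + s *\<^sub>R v) has_derivative (\<lambda>r. r *\<^sub>R v)) (at s)" by (auto intro!: derivative_eq_intros)
  from has_derivative_compose[OF this assms] show ?thesis
    using has_derivative_linear[OF assms] by (simp add: has_vector_derivative_def linear_cmul)
qed

section \<open>Symmetry of second derivatives\<close>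

text \<open>The mean value theorem is applied once in each direction. The left side is symmetric in
  \<open>v\<close> and \<open>w\<close>, the right side is not; comparing the two orders yields the
  symmetry of second derivatives.\<close>

lemma second_difference:
  fixes F :: "'a::real_normed_vector \<Rightarrow> real"
  assumes F: "Ck_on (Suc (Suc 0)) UNIV F" and h: "h > 0"
  shows "\<exists>s t. 0 < s \<and> s < h \<and> 0 < t \<and> t < h \<and>
    F (x + h *\<^sub>R v + h *\<^sub>R w) - F (x + h *\<^sub>R v) - F (x + h *\<^sub>R w) + F x =
    h * h * fderiv (\<lambda>y. fderiv F y v) (x + s *\<^sub>R v + t *\<^sub>R w) w"
proof -
  let ?D = "\<lambda>y. fderiv F y v"
  have d1: "((\<lambda>s. F (c + s *\<^sub>R v)) has_real_derivative ?D (c + s *\<^sub>R v)) (at s)" for c s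
    unfolding real_vector_derivative
    by (rule has_vector_derivative_line[OF Ck_on_has_derivative[OF F UNIV_I]])
  have d2: "((\<lambda>t. ?D (c + t *\<^sub>R w)) has_real_derivative fderiv ?D (c + t *\<^sub>R w) w) (at t)" for c t
    unfolding real_vector_derivative
    by (rule has_vector_derivative_line[OF Ck_on_has_derivative[OF Ck_on_frechet[OF F] UNIV_I]])
  let ?\<phi> = "\<lambda>s. F ((x + h *\<^sub>R w) + s *\<^sub>R v) - F (x + s *\<^sub>R v)"
  have "\<exists>s>0. s < h \<and> ?\<phi> h - ?\<phi> 0 = (h - 0) * (?D ((x + h *\<^sub>R w) + s *\<^sub>R v) - ?D (x + s *\<^sub>R v))"
    by (rule MVT2[OF h]) (intro DERIV_diff d1)
  then obtain s where s: "0 < s" "s < h" "?\<phi> h - ?\<phi> 0 = h * (?D ((x + h *\<^sub>R w) + s *\<^sub>R v) - ?D (x + s *\<^sub>R v))" by auto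
  have "\<exists>t>0. t < h \<and> ?D ((x + s *\<^sub>R v) + h *\<^sub>R w) - ?D ((x + s *\<^sub>R v) + 0 *\<^sub>R w) =
      (h - 0) * fderiv ?D ((x + s *\<^sub>R v) + t *\<^sub>R w) w"
    by (rule MVT2[OF h]) (rule d2)
  then obtain t where t: "0 < t" "t < h" "?D ((x + s *\<^sub>R v) + h *\<^sub>R w) - ?D (x + s *\<^sub>R v) =
      h * fderiv ?D ((x + s *\<^sub>R v) + t *\<^sub>R w) w" by auto
  show ?thesis using s t by (intro exI[of _ s] exI[of _ t]) (simp add: algebra_simps)
qed

text \<open>This is what cancels the second-order terms in the commutator of two left-invariant
  fields.\<close>

lemma frechet_derivative_commute:
  fixes F :: "'a::real_normed_vector \<Rightarrow> real"
  assumes F: "Ck_on (Suc (Suc 0)) UNIV F"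
  shows "fderiv (\<lambda>y. fderiv F y v) x w =
         fderiv (\<lambda>y. fderiv F y w) x v"
proof -
  let ?G = "\<lambda>v w y. fderiv (\<lambda>y. fderiv F y v) y w"
  have cont: "continuous_on UNIV (?G v w)" for v w
    using F by simp
  let ?h = "\<lambda>n. inverse (real (Suc n))"
  have lim: "\<exists>X. X \<longlonglongrightarrow> ?G v w x \<and> (\<forall>n. F (x + ?h n *\<^sub>R v + ?h n *\<^sub>R w) - F (x + ?h n *\<^sub>R v) - F (x + ?h n *\<^sub>R w) + F x = ?h n * ?h n * X n)" for v w
  proof -
    have "\<forall>n. \<exists>s t. 0 < s \<and> s < ?h n \<and> 0 < t \<and> t < ?h n \<and>
    F (x + ?h n *\<^sub>R v + ?h n *\<^sub>R w) - F (x + ?h n *\<^sub>R v) - F (x + ?h n *\<^sub>R w) + F x =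
    ?h n * ?h n * ?G v w (x + s *\<^sub>R v + t *\<^sub>R w)"
      by (intro allI second_difference[OF F]) simp
    from choice[OF this] obtain s where "\<forall>n. \<exists>t. 0 < s n \<and> s n < ?h n \<and> 0 < t \<and> t < ?h n \<and>
    F (x + ?h n *\<^sub>R v + ?h n *\<^sub>R w) - F (x + ?h n *\<^sub>R v) - F (x + ?h n *\<^sub>R w) + F x =
    ?h n * ?h n * ?G v w (x + s n *\<^sub>R v + t *\<^sub>R w)" by blast
    from choice[OF this] obtain t where st: "\<forall>n. 0 < s n \<and> s n < ?h n \<and> 0 < t n \<and> t n < ?h n \<and>
    F (x + ?h n *\<^sub>R v + ?h n *\<^sub>R w) - F (x + ?h n *\<^sub>R v) - F (x + ?h n *\<^sub>R w) + F x =
    ?h n * ?h n * ?G v w (x + s n *\<^sub>R v + t n *\<^sub>R w)" by blast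
    have "s \<longlonglongrightarrow> 0" "t \<longlonglongrightarrow> 0"
      using st by (auto intro!: tendsto_sandwich[OF _ _ tendsto_const LIMSEQ_inverse_real_of_nat] always_eventually less_imp_le)
    then have "(\<lambda>n. x + s n *\<^sub>R v + t n *\<^sub>R w) \<longlonglongrightarrow> x + 0 *\<^sub>R v + 0 *\<^sub>R w" by (intro tendsto_intros)
    then have "(\<lambda>n. ?G v w (x + s n *\<^sub>R v + t n *\<^sub>R w)) \<longlonglongrightarrow> ?G v w x"
      using cont[of v w] by (auto simp: continuous_on_eq_continuous_at intro: isCont_tendsto_compose)
    then show ?thesis using st by blast
  qed
  obtain X where X: "X \<longlonglongrightarrow> ?G v w x" "\<And>n. F (x + ?h n *\<^sub>R v + ?h n *\<^sub>R w) - F (x + ?h n *\<^sub>R v) - F (x + ?h n *\<^sub>R w) + F x = ?h n * ?h n * X n" using lim by blast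
  obtain Y where Y: "Y \<longlonglongrightarrow> ?G w v x" "\<And>n. F (x + ?h n *\<^sub>R w + ?h n *\<^sub>R v) - F (x + ?h n *\<^sub>R w) - F (x + ?h n *\<^sub>R v) + F x = ?h n * ?h n * Y n" using lim by blast
  have "X n = Y n" for n
  proof -
    have "x + ?h n *\<^sub>R v + ?h n *\<^sub>R w = x + ?h n *\<^sub>R w + ?h n *\<^sub>R v" by (simp add: algebra_simps)
    then have "?h n * ?h n * X n = ?h n * ?h n * Y n"
      unfolding X(2)[symmetric] Y(2)[symmetric] by (simp only:)
    then show ?thesis by simp
  qed
  then have "X = Y" by auto
  then show ?thesis using X(1) Y(1) LIMSEQ_unique by blast
qed

section \<open>Flat functions and bumps\<close>

text \<open>The polynomial factor makes the family closed under differentiation, so that smoothness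
  follows by induction over all \<open>P\<close> at once.\<close>

definition flat :: "real poly \<Rightarrow> real \<Rightarrow> real" where
  "flat P t = (if t > 0 then poly P (1 / t) * exp (- (1 / t)) else 0)"

lemma tendsto_poly_exp: "((\<lambda>y. poly P y * exp (- y)) \<longlongrightarrow> 0) at_top" for P :: "real poly"
proof -
  have "((\<lambda>y. \<Sum>i\<le>degree P. coeff P i * (y ^ i / exp y)) \<longlongrightarrow> (\<Sum>i\<le>degree P. coeff P i * 0)) at_top"
    by (intro tendsto_intros tendsto_power_div_exp_0)
  then show ?thesis by (simp add: poly_altdef sum_distrib_right exp_minus divide_inverse mult.assoc)
qed

text \<open>With s = 1 / t one has d/dt = - s^2 d/ds, which turns P(s) exp (- s) into s^2 (P(s) -
  P'(s)) exp (- s); \<open>[:0, 0, 1:]\<close> is the factor s^2.\<close>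

lemma flat_derivative:
  "(flat P has_real_derivative flat ([:0, 0, 1:] * (P - pderiv P)) t) (at t)"
proof -
  consider "t > 0" | "t < 0" | "t = 0" by linarith
  then show ?thesis
  proof cases
    case 1
    have "((\<lambda>t. poly P (1 / t) * exp (- (1 / t))) has_real_derivative flat ([:0, 0, 1:] * (P - pderiv P)) t) (at t)"
      using 1 by (auto intro!: derivative_eq_intros DERIV_chain2[OF poly_DERIV] simp: flat_def field_simps power2_eq_square)
    then show ?thesis
      by (rule has_field_derivative_transform_within_open[where S = "{0<..}"]) (use 1 in \<open>auto simp: flat_def\<close>)
  next
    case 2
    have "((\<lambda>t. 0) has_real_derivative flat ([:0, 0, 1:] * (P - pderiv P)) t) (at t)" using 2 by (simp add: flat_def)
    then show ?thesis
      by (rule has_field_derivative_transform_within_open[where S = "{..<0}"]) (use 2 in \<open>auto simp: flat_def\<close>)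
  next
    case 3
    \<comment> \<open>The difference quotient at 0 from the right is s P(s) exp (- s) for s = 1 / t
      tending to infinity.\<close>
    have "((\<lambda>t. flat P t / t) \<longlongrightarrow> 0) (at_right 0)"
    proof -
      have "((\<lambda>t. poly ([:0, 1:] * P) (inverse t) * exp (- inverse t)) \<longlongrightarrow> 0) (at_right 0)"
        by (rule filterlim_compose[OF tendsto_poly_exp filterlim_inverse_at_top_right])
      then show ?thesis
        by (rule Lim_transform_eventually)
           (auto simp: eventually_at_filter flat_def field_simps intro!: always_eventually)
    qed
    moreover have "((\<lambda>t. flat P t / t) \<longlongrightarrow> 0) (at_left 0)"
      by (rule Lim_transform_eventually[OF tendsto_const]) (auto simp: eventually_at_filter flat_def)
    ultimately have "((\<lambda>t. flat P t / t) \<longlongrightarrow> 0) (at 0)" by (simp add: filterlim_split_at_real)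
    then show ?thesis unfolding 3 by (simp add: has_field_derivative_iff flat_def)
  qed
qed

lemma smooth_flat: "smooth_on UNIV (flat P)"
  unfolding smooth_on_def
proof
  fix k show "Ck_on k UNIV (flat P)"
  proof (induction k arbitrary: P)
    case 0 show ?case using flat_derivative by (auto intro!: continuous_at_imp_continuous_on DERIV_isCont)
  next
    case (Suc k)
    show ?case
    proof (rule Ck_on_SucI[OF open_UNIV])
      show "(flat P has_derivative (\<lambda>v. flat ([:0, 0, 1:] * (P - pderiv P)) t * v)) (at t)" for t
        using flat_derivative[of P t] by (simp add: has_field_derivative_def)
      show "Ck_on k UNIV (\<lambda>t. flat ([:0, 0, 1:] * (P - pderiv P)) t * v)" for v
        by (intro Ck_on_mult Suc Ck_on_const open_UNIV)
    qed
  qed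
qed

lemma smooth_bump:
  fixes x0 :: "'e::euclidean_space"
  assumes r: "r > 0"
  obtains \<psi> :: "'e \<Rightarrow> real" where "smooth_on UNIV \<psi>" "\<And>x. \<psi> x \<ge> 0" "\<psi> x0 > 0" "\<And>x. x \<notin> cball x0 r \<Longrightarrow> \<psi> x = 0"
proof
  let ?q = "\<lambda>x. r\<^sup>2 + (- 1) * ((x - x0) \<bullet> (x - x0))"
  have "smooth_on UNIV (\<lambda>x. x + (- x0))"
    unfolding smooth_on_def by (intro allI Ck_on_add Ck_on_ident Ck_on_const open_UNIV)
  then have "smooth_on UNIV ?q"
    unfolding smooth_on_def by (intro allI Ck_on_add Ck_on_mult Ck_on_const Ck_on_bilinear[OF bounded_bilinear_inner] open_UNIV) auto
  then show "smooth_on UNIV (\<lambda>x. flat 1 (?q x))"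
    by (intro smooth_on_compose[OF open_UNIV _ _ smooth_flat]) auto
  show "flat 1 (?q x) \<ge> 0" for x by (simp add: flat_def)
  show "flat 1 (?q x0) > 0" using r by (simp add: flat_def)
  show "flat 1 (?q x) = 0" if "x \<notin> cball x0 r" for x
  proof -
    have "r < norm (x - x0)" using that by (simp add: dist_norm norm_minus_commute)
    then have "r\<^sup>2 < (norm (x - x0))\<^sup>2" using r by (intro power_strict_mono) auto
    then show ?thesis by (simp add: flat_def dot_square_norm)
  qed
qed

section \<open>Change of variables in Euclidean spaces\<close>

text \<open>The library states the change of variables formula for \<open>real ^ 'n\<close>; this index type transfers it
  to an arbitrary Euclidean space.\<close>

typedef (overloaded) 'e bas = "Basis :: 'e::euclidean_space set"
  morphisms basis_vector basis_index by (rule nonempty_Basis[THEN ex_in_conv[THEN iffD2]])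

instance bas :: (euclidean_space) finite
proof
  have "(UNIV :: 'a bas set) = basis_index ` Basis"
    by (metis basis_vector basis_vector_inverse image_eqI subsetI subset_antisym subset_UNIV)
  then show "finite (UNIV :: 'a bas set)" by (metis finite_Basis finite_imageI)
qed

text \<open>The change of variables formula asks for a well-ordered index type. The order is pulled
  back along an enumeration; neither determinants nor volumes depend on the choice.\<close>

instantiation bas :: (euclidean_space) wellorder
begin

definition "x \<le> (y::'a bas) \<longleftrightarrow> to_nat_on (UNIV::'a bas set) x \<le> to_nat_on UNIV y"

definition "x < (y::'a bas) \<longleftrightarrow> to_nat_on (UNIV::'a bas set) x < to_nat_on UNIV y"
instance
proof
  have inj: "x = y" if "to_nat_on (UNIV::'a bas set) x = to_nat_on UNIV y" for x y :: "'a bas"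
    using that inj_on_to_nat_on[of "UNIV::'a bas set"] by (auto simp: countable_finite inj_on_def)
  fix x y z :: "'a bas" and P :: "'a bas \<Rightarrow> bool"
  show "x < y \<longleftrightarrow> x \<le> y \<and> \<not> y \<le> x" "x \<le> x" "x \<le> y \<or> y \<le> x"
    "x \<le> y \<Longrightarrow> y \<le> z \<Longrightarrow> x \<le> z"
    by (auto simp: less_eq_bas_def less_bas_def)
  show "x \<le> y \<Longrightarrow> y \<le> x \<Longrightarrow> x = y" using inj by (auto simp: less_eq_bas_def)
  show "P x" if "\<And>x. (\<And>y. y < x \<Longrightarrow> P y) \<Longrightarrow> P x"
    by (rule measure_induct_rule[of "to_nat_on (UNIV::'a bas set)"], rule that) (simp add: less_bas_def)
qed
end

section \<open>Standard coordinates, determinants and Lebesgue measure\<close>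

definition to_cart :: "'e::euclidean_space \<Rightarrow> real ^ 'e bas" where
  "to_cart x = (\<chi> i. x \<bullet> basis_vector i)"

definition of_cart :: "real ^ 'e bas \<Rightarrow> 'e::euclidean_space" where
  "of_cart y = (\<Sum>i\<in>UNIV. (y $ i) *\<^sub>R basis_vector i)"

lemma sum_bas: "(\<Sum>i\<in>(UNIV::'e::euclidean_space bas set). f (basis_vector i)) = (\<Sum>b\<in>Basis. f b)"
  by (rule sum.reindex_bij_witness[of _ basis_index basis_vector])
     (auto simp: basis_vector_inverse basis_index_inverse basis_vector)

lemma prod_bas: "(\<Prod>i\<in>(UNIV::'e::euclidean_space bas set). f (basis_vector i)) = (\<Prod>b\<in>Basis. f b)"
  by (rule prod.reindex_bij_witness[of _ basis_index basis_vector])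
     (auto simp: basis_vector_inverse basis_index_inverse basis_vector)

lemma of_cart_to_cart [simp]: "of_cart (to_cart x) = x"
  by (simp add: of_cart_def to_cart_def sum_bas[of "\<lambda>b. (x \<bullet> b) *\<^sub>R b"] euclidean_representation)

lemma inner_basis_vector: "basis_vector i \<bullet> basis_vector j = (if i = j then 1 else 0)"
  by (simp add: inner_Basis[OF basis_vector basis_vector] basis_vector_inject)

lemma to_cart_of_cart [simp]: "to_cart (of_cart y) = y"
  by (simp add: of_cart_def to_cart_def vec_eq_iff inner_sum_left inner_basis_vector if_distrib cong: if_cong)

lemma linear_to_cart: "linear to_cart"
  by (rule linearI) (auto simp: to_cart_def vec_eq_iff inner_add_left)

lemma linear_of_cart: "linear of_cart"
  by (rule linearI) (auto simp: of_cart_def scaleR_add_left sum.distrib scaleR_sum_right)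

definition Det :: "('e::euclidean_space \<Rightarrow> 'e) \<Rightarrow> real" where
  "Det f = det (matrix (to_cart \<circ> f \<circ> of_cart))"

lemma Det_compose: assumes "linear f" "linear g" shows "Det (f \<circ> g) = Det f * Det g"
proof -
  have "to_cart \<circ> (f \<circ> g) \<circ> of_cart = (to_cart \<circ> f \<circ> of_cart) \<circ> (to_cart \<circ> g \<circ> of_cart)"
    by (simp add: fun_eq_iff)
  then show ?thesis unfolding Det_def
    by (simp add: matrix_compose linear_compose linear_to_cart linear_of_cart assms det_mul)
qed

lemma Det_id: "Det (\<lambda>x. x) = 1"
proof -
  have "to_cart \<circ> (\<lambda>x. x) \<circ> of_cart = (\<lambda>x::real^'a bas. x)" by (simp add: fun_eq_iff)
  then show ?thesis unfolding Det_def by (simp add: matrix_id_mat_1[unfolded id_def])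
qed

lemma inner_of_cart: "of_cart y \<bullet> basis_vector i = y $ i"
  using to_cart_of_cart[of y] by (metis to_cart_def vec_lambda_beta)

lemma ball_Basis: "(\<forall>b\<in>Basis. P b) \<longleftrightarrow> (\<forall>i. P (basis_vector i))"
  by (metis basis_index_inverse basis_vector)

text \<open>\<open>to_cart\<close> only renames coordinates, so the preimage of a box is a box with
  the same edge lengths, and boxes determine Lebesgue measure.\<close>

lemma distr_to_cart: "distr lborel borel to_cart = lborel"
proof (rule lborel_eqI[symmetric])
  have m: "to_cart \<in> borel_measurable borel"
    by (intro borel_measurable_continuous_onI linear_continuous_on linear_imp_bounded linear_to_cart)
  fix l u :: "real^'a bas" assume "\<And>b. b \<in> Basis \<Longrightarrow> l \<bullet> b \<le> u \<bullet> b"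
  then have lu: "l $ i \<le> u $ i" for i
    by (metis axis_in_Basis_iff Basis_real_def inner_axis inner_real_def mult.right_neutral singletonI)
  have "to_cart -` box l u = box (of_cart l) (of_cart u)"
    by (auto simp: mem_box_cart box_def[of "of_cart l"] ball_Basis inner_of_cart to_cart_def)
  moreover have "emeasure lborel (box (of_cart l) (of_cart u)) = (\<Prod>b\<in>Basis. (of_cart u - of_cart l) \<bullet> b)"
    using lu ball_Basis[of "\<lambda>b. of_cart l \<bullet> b \<le> of_cart u \<bullet> b"] by (intro emeasure_lborel_box) (simp add: inner_of_cart)
  moreover have "(\<Prod>b\<in>Basis. (of_cart u - of_cart l) \<bullet> b) = (\<Prod>i\<in>UNIV. u $ i - l $ i)"
    by (subst prod_bas[symmetric]) (simp add: inner_diff_left inner_of_cart)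
  moreover have "(\<Prod>b\<in>Basis. (u - l) \<bullet> b) = (\<Prod>i\<in>UNIV. u $ i - l $ i)"
  proof -
    have B: "(Basis :: (real^'a bas) set) = (\<lambda>i. axis i 1) ` UNIV" by (auto simp: Basis_vec_def)
    have "inj (\<lambda>i. axis i (1::real) :: real^'a bas)" by (auto simp: inj_def axis_eq_axis)
    then show ?thesis unfolding B by (subst prod.reindex) (simp_all add: inner_axis)
  qed
  moreover have "emeasure (distr lborel borel to_cart) (box l u) = emeasure lborel (to_cart -` box l u)"
    by (subst emeasure_distr) (use m in simp_all)
  ultimately show "emeasure (distr lborel borel to_cart) (box l u) = ennreal (\<Prod>b\<in>Basis. (u - l) \<bullet> b)"
    by (simp only:)
qed simp

lemma distr_of_cart: "distr lborel borel of_cart = lborel"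
proof -
  have m: "to_cart \<in> borel_measurable borel" "of_cart \<in> borel_measurable borel"
    by (intro borel_measurable_continuous_onI linear_continuous_on linear_imp_bounded linear_to_cart linear_of_cart)+
  have "distr lborel borel of_cart = distr (distr lborel borel to_cart) borel (of_cart :: _ \<Rightarrow> 'a)"
    by (simp add: distr_to_cart)
  also have "\<dots> = distr lborel borel (of_cart \<circ> (to_cart :: 'a \<Rightarrow> _))"
    by (rule distr_distr) (use m in simp_all)
  also have "\<dots> = distr lborel lborel (\<lambda>x::'a. x)" by (rule distr_cong) auto
  finally show ?thesis by (simp add: distr_id)
qed

lemma emeasure_of_cart_vimage:
  fixes B :: "'e::euclidean_space set"
  assumes "B \<in> sets borel"
  shows "emeasure lborel (of_cart -` B) = emeasure lborel B"
proof -
  have "of_cart \<in> borel_measurable borel"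
    by (intro borel_measurable_continuous_onI linear_continuous_on linear_imp_bounded linear_of_cart)
  then have "emeasure (distr lborel borel of_cart) B = emeasure lborel (of_cart -` B)"
    by (subst emeasure_distr) (use assms in auto)
  then show ?thesis by (simp add: distr_of_cart)
qed

text \<open>The preimage of a box under \<open>g\<close> is its image under the inverse map
  \<open>f\<close>, whose volume is \<open>d\<close> times that of the box; boxes are an
  intersection-stable generator. A constant Jacobian covers both applications: left translations,
  with \<open>d\<close> equal to 1, and dilations.\<close>

lemma distr_lborel_const_Jacobian:
  fixes f g :: "'e::euclidean_space \<Rightarrow> 'e"
  assumes f: "\<And>x. (f has_derivative f' x) (at x)" and d: "\<And>x. \<bar>Det (f' x)\<bar> = d"
    and gf: "\<And>x. g (f x) = x" and fg: "\<And>x. f (g x) = x" and g: "continuous_on UNIV g"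
  shows "distr lborel borel g = density lborel (\<lambda>_. ennreal d)"
proof -
  have d0: "d \<ge> 0" using d[of 0] by auto
  have gm [measurable]: "g \<in> borel_measurable borel" by (rule borel_measurable_continuous_onI[OF g])
  let ?F = "to_cart \<circ> f \<circ> of_cart" and ?F' = "\<lambda>y. to_cart \<circ> f' (of_cart y) \<circ> of_cart"
  have bl: "bounded_linear (to_cart :: 'e \<Rightarrow> _)" "bounded_linear (of_cart :: _ \<Rightarrow> 'e)"
    by (intro linear_imp_bounded linear_to_cart linear_of_cart)+
  have ofm: "of_cart \<in> borel_measurable (borel :: (real^'e bas) measure)"
    by (intro borel_measurable_continuous_onI linear_continuous_on bl)
  have F: "(?F has_derivative ?F' y) (at y within S)" for y S
  proof -
    have "((\<lambda>y. to_cart (f (of_cart y))) has_derivative (\<lambda>h. to_cart (f' (of_cart y) (of_cart h)))) (at y within S)"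
      by (rule bounded_linear.has_derivative[OF bl(1)])
         (rule has_derivative_compose[OF bounded_linear_imp_has_derivative[OF bl(2)] f])
    then show ?thesis by (simp add: o_def)
  qed
  have inj: "inj_on ?F S" for S by (rule inj_on_inverseI[where g = "to_cart \<circ> g \<circ> of_cart"]) (simp add: gf)
  have vol: "emeasure lborel (g -` box l u) = d * emeasure lborel (box l u)" for l u :: 'e
  proof -
    let ?S = "of_cart -` box l u :: (real^'e bas) set"
    have S: "?S \<in> sets borel" using measurable_sets_borel[OF ofm] by simp
    have emS: "emeasure lborel ?S = emeasure lborel (box l u)"
      by (rule emeasure_of_cart_vimage) simp
    then have Sl: "?S \<in> lmeasurable"
      using S emeasure_lborel_box_finite[of l u] by (auto simp: fmeasurable_def)
    have "((\<lambda>x. \<bar>det (matrix (?F' x))\<bar>) has_integral d * measure lebesgue ?S) ?S"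
    proof -
      have "((\<lambda>x. 1) has_integral measure lebesgue ?S) ?S"
        using Sl by (simp add: has_integral_iff lmeasure_integral flip: lmeasurable_iff_integrable_on)
      from has_integral_mult_right[OF this, of d] show ?thesis
        using d by (simp add: Det_def)
    qed
    then have im: "?F ` ?S \<in> lmeasurable \<and> measure lebesgue (?F ` ?S) = d * measure lebesgue ?S"
      using has_measure_differentiable_image[OF fmeasurableD[OF Sl] F inj] by blast
    have eq: "?F ` ?S = of_cart -` (g -` box l u)"
    proof (intro subset_antisym subsetI)
      fix y assume "y \<in> of_cart -` (g -` box l u)"
      then show "y \<in> ?F ` ?S" by (intro image_eqI[of _ _ "to_cart (g (of_cart y))"]) (auto simp: fg)
    qed (auto simp: gf)
    have gS: "g -` box l u \<in> sets borel" using measurable_sets_borel[OF gm] by simp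
    have "emeasure lborel (g -` box l u) = emeasure lborel (of_cart -` (g -` box l u) :: (real^'e bas) set)"
      by (rule emeasure_of_cart_vimage[OF gS, symmetric])
    also have "\<dots> = emeasure lebesgue (?F ` ?S)"
    proof -
      have "of_cart -` (g -` box l u) \<in> sets (borel :: (real^'e bas) measure)"
        using measurable_sets_borel[OF ofm gS] by simp
      then show ?thesis unfolding eq by simp
    qed
    also have "\<dots> = ennreal (d * measure lebesgue ?S)"
      using im by (metis emeasure_eq_measure2)
    also have "\<dots> = d * emeasure lborel (box l u)"
    proof -
      have "ennreal (measure lebesgue ?S) = emeasure lborel ?S"
        using emeasure_eq_measure2[OF Sl] S by simp
      then show ?thesis using d0 by (simp only: ennreal_mult' emS)
    qed
    finally show ?thesis .
  qed
  show ?thesis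
  proof (rule measure_eqI_generator_eq[where \<Omega> = UNIV and E = "range (\<lambda>(a, b). box a b)" and A = "\<lambda>n. box (- (real n *\<^sub>R One)) (real n *\<^sub>R One)"])
    show "Int_stable (range (\<lambda>(a, b). box a b :: 'e set))"
      by (auto simp: Int_stable_def box_Int_box)
    show "(\<Union>i. box (- (real i *\<^sub>R One)) (real i *\<^sub>R One)) = (UNIV :: 'e set)" by (rule UN_box_eq_UNIV)
    show "emeasure (distr lborel borel g) X = emeasure (density lborel (\<lambda>_. ennreal d)) X" if "X \<in> range (\<lambda>(a, b). box a b)" for X
      using that by (auto simp: emeasure_distr emeasure_density vol nn_integral_cmult)
    show "emeasure (distr lborel borel g) (box (- (real i *\<^sub>R One)) (real i *\<^sub>R One)) \<noteq> \<infinity>" for i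
      using emeasure_lborel_box_finite by (auto simp: emeasure_distr vol ennreal_mult_eq_top_iff)
  qed (auto simp: borel_eq_box)
qed

section \<open>Lie groups in exponential coordinates\<close>

text \<open>A product rule for a linear map that moves with t. Differentiability is assumed only for
  each fixed vector; expansion in a basis makes it joint.\<close>

lemma has_derivative_linear_family:
  fixes L :: "'a::real_normed_vector \<Rightarrow> 'e::euclidean_space \<Rightarrow> 'b::real_normed_vector"
  assumes lin: "\<And>z. linear (L z)" and L: "\<And>v. ((\<lambda>z. L z v) has_derivative DL v) (at (x t))"
    and x: "(x has_vector_derivative x') (at t)" and V: "(V has_vector_derivative V') (at t)"
  shows "((\<lambda>t. L (x t) (V t)) has_vector_derivative DL (V t) x' + L (x t) V') (at t)"
proof -
  have rep: "L z w = (\<Sum>b\<in>Basis. (w \<bullet> b) *\<^sub>R L z b)" for z w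
    by (rule linear_expand[OF lin])
  have "((\<lambda>z. L z w) has_derivative (\<lambda>h. \<Sum>b\<in>Basis. (w \<bullet> b) *\<^sub>R DL b h)) (at (x t))" for w
    by (subst rep) (intro has_derivative_sum has_derivative_scaleR_right L)
  \<comment> \<open>\<open>DL\<close> is linear in its first argument because derivatives are
    unique.\<close>
  then have repD: "DL w h = (\<Sum>b\<in>Basis. (w \<bullet> b) *\<^sub>R DL b h)" for w h
    using L[of w] has_derivative_unique by (metis (no_types, lifting))
  have Lb: "((\<lambda>t. L (x t) b) has_vector_derivative DL b x') (at t)" for b
    using has_derivative_compose[OF x[unfolded has_vector_derivative_def] L[of b]]
    by (simp add: has_vector_derivative_def linear_cmul[OF has_derivative_linear[OF L]])
  have "((\<lambda>t. \<Sum>b\<in>Basis. (V t \<bullet> b) *\<^sub>R L (x t) b) has_vector_derivative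
      (\<Sum>b\<in>Basis. (V t \<bullet> b) *\<^sub>R DL b x' + (V' \<bullet> b) *\<^sub>R L (x t) b)) (at t)"
  proof (rule has_vector_derivative_sum)
    fix b :: 'e
    have "((\<lambda>t. V t \<bullet> b) has_real_derivative V' \<bullet> b) (at t)"
      unfolding real_vector_derivative
      by (rule bounded_linear.has_vector_derivative[OF bounded_linear_inner_left V])
    from has_vector_derivative_scaleR[OF this Lb[of b]]
    show "((\<lambda>t. (V t \<bullet> b) *\<^sub>R L (x t) b) has_vector_derivative (V t \<bullet> b) *\<^sub>R DL b x' + (V' \<bullet> b) *\<^sub>R L (x t) b) (at t)" .
  qed
  then show ?thesis by (simp add: rep[symmetric] repD[symmetric] sum.distrib)
qed

text \<open>Gronwall's argument: if \<open>K\<close> bounds the operator norm of \<open>T\<close>,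
  then exp (- 2 K t) |U t|^2 is nonincreasing and starts at 0.\<close>

lemma linear_ode_zero:
  fixes U :: "real \<Rightarrow> 'e::euclidean_space"
  assumes T: "linear T" and U: "\<And>t. (U has_vector_derivative T (U t)) (at t)" and "U 0 = 0" "t \<ge> 0"
  shows "U t = 0"
proof -
  obtain K where K: "K > 0" "\<And>x. norm (T x) \<le> norm x * K"
    using bounded_linear.pos_bounded[OF linear_imp_bounded[OF T]] by blast
  let ?g = "\<lambda>t. exp (- 2 * K * t) * (U t \<bullet> U t)"
  have "?g t \<le> ?g 0"
  proof (rule DERIV_nonpos_imp_nonincreasing[OF \<open>t \<ge> 0\<close>])
    fix s :: real
    have d: "((\<lambda>t. U t \<bullet> U t) has_real_derivative 2 * (U s \<bullet> T (U s))) (at s)"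
      using bounded_bilinear.has_vector_derivative[OF bounded_bilinear_inner U U, of s]
      by (simp add: real_vector_derivative inner_commute)
    have "(?g has_real_derivative exp (- 2 * K * s) * (2 * (U s \<bullet> T (U s)) - 2 * K * (U s \<bullet> U s))) (at s)"
      by (rule DERIV_cong[OF DERIV_mult[OF DERIV_fun_exp[OF DERIV_cmult_Id] d]]) (simp add: algebra_simps)
    moreover have "U s \<bullet> T (U s) \<le> K * (U s \<bullet> U s)"
    proof -
      have "U s \<bullet> T (U s) \<le> norm (U s) * norm (T (U s))" by (rule norm_cauchy_schwarz)
      also have "\<dots> \<le> norm (U s) * (norm (U s) * K)" by (intro mult_left_mono K) auto
      finally show ?thesis by (simp add: dot_square_norm power2_eq_square algebra_simps)
    qed
    ultimately show "\<exists>y. (?g has_real_derivative y) (at s) \<and> y \<le> 0"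
      by (intro exI conjI) (auto simp: mult_le_0_iff)
  qed
  then have "U t \<bullet> U t \<le> 0" using assms(3) by (simp add: mult_le_0_iff)
  then show ?thesis by (metis inner_gt_zero_iff not_less)
qed

section \<open>Group laws in exponential coordinates\<close>

text \<open>\<open>ray\<close> is what makes the coordinates exponential: lines through the origin
  are one-parameter subgroups. In particular the group inverse is the linear map x \<mapsto> -
  x.\<close>

locale exp_coordinates =
  fixes m :: "'e::euclidean_space \<Rightarrow> 'e \<Rightarrow> 'e"
  assumes smooth_m: "smooth_on UNIV (\<lambda>(x, y). m x y)"
    and assoc: "m (m x y) z = m x (m y z)"
    and ray: "m (s *\<^sub>R x) (t *\<^sub>R x) = (s + t) *\<^sub>R x"
    and left_zero [simp]: "m 0 x = x" and right_zero [simp]: "m x 0 = x"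
begin

lemma minus_left [simp]: "m (- x) x = 0" and minus_right [simp]: "m x (- x) = 0"
  using ray[of "-1" x 1] ray[of 1 x "-1"] by simp_all

lemma cancel [simp]: "m (- x) (m x y) = y" "m x (m (- x) y) = y"
  by (simp_all flip: assoc)

definition L where "L x = fderiv (m x) 0"

text \<open>Not a right translation: the differential at \<open>x\<close> of the left translation by
  \<open>- x\<close> brings tangent vectors at \<open>x\<close> back to the identity, so
  \<open>R x\<close> is the inverse of \<open>L x\<close>.\<close>

definition R where "R x = fderiv (m (- x)) x"

lemma smooth_translation: "smooth_on UNIV (m x)"
proof -
  have "smooth_on UNIV (\<lambda>y. (\<lambda>(x, y). m x y) (x, y))"
    by (rule smooth_on_compose[where T = UNIV]) (auto intro: smooth_m smooth_on_Pair smooth_on_const smooth_on_ident)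
  then show ?thesis by simp
qed

lemma has_derivative_m: "(m x has_derivative fderiv (m x) y) (at y)"
  by (rule smooth_on_has_derivative[OF smooth_translation]) simp

lemma linear_frechet_m: "linear (fderiv (m x) y)"
  by (rule has_derivative_linear[OF has_derivative_m])

lemma has_derivative_L: "(m x has_derivative L x) (at 0)"
  unfolding L_def by (rule has_derivative_m)

lemma linear_L: "linear (L x)" and linear_R: "linear (R x)"
  by (simp_all add: L_def R_def linear_frechet_m)

text \<open>Partial derivatives become values of the derivative of the joint map, whose smoothness
  makes \<open>L x v\<close> and \<open>R x v\<close> smooth in \<open>x\<close>.\<close>

lemma frechet_m_eq:
  "fderiv (m x) y v = fderiv (\<lambda>(x, y). m x y) (x, y) (0, v)"
proof -
  have "((\<lambda>y. (\<lambda>(x, y). m x y) (x, y)) has_derivative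
      (\<lambda>v. fderiv (\<lambda>(x, y). m x y) (x, y) (0, v))) (at y)"
    by (rule has_derivative_compose[OF _ smooth_on_has_derivative[OF smooth_m UNIV_I]]) (auto intro!: derivative_eq_intros)
  moreover have "(\<lambda>y. (\<lambda>(x, y). m x y) (x, y)) = m x" by auto
  ultimately show ?thesis using has_derivative_unique[OF has_derivative_m] by metis
qed

lemma smooth_L: "smooth_on UNIV (\<lambda>x. L x v)"
  unfolding L_def frechet_m_eq
  by (rule smooth_on_compose[where T = UNIV and f = "\<lambda>x. (x, 0)"])
     (auto intro: smooth_on_frechet smooth_m smooth_on_Pair smooth_on_const smooth_on_ident)

lemma smooth_R: "smooth_on UNIV (\<lambda>x. R x v)"
  unfolding R_def frechet_m_eq
  by (rule smooth_on_compose[where T = UNIV and f = "\<lambda>x. (- x, x)"])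
     (intro smooth_on_Pair smooth_on_ident open_UNIV linear_imp_smooth_on bounded_linear_minus[OF bounded_linear_ident]
       smooth_on_frechet smooth_m subset_UNIV)+

lemma L_zero [simp]: "L 0 = (\<lambda>v. v)"
proof -
  have "m 0 = (\<lambda>x. x)" by auto
  then show ?thesis using has_derivative_unique[OF has_derivative_L[of 0]] by simp
qed

text \<open>Associativity, differentiated in the last factor at 0: the fields y \<mapsto>
  \<open>L y v\<close> are left invariant.\<close>

lemma L_mult: "fderiv (m x) y (L y v) = L (m x y) v"
proof -
  have "(m (m x y) has_derivative (\<lambda>v. fderiv (m x) y (L y v))) (at 0)"
    unfolding assoc[abs_def]
    by (rule has_derivative_compose[OF has_derivative_L]) (simp add: has_derivative_m)
  from fun_cong[OF has_derivative_unique[OF has_derivative_L this]] show ?thesis by simp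
qed

lemma R_L [simp]: "R x (L x v) = v"
  using L_mult[of "- x" x v] by (simp add: R_def)

lemma L_R [simp]: "L x (R x v) = v"
proof -
  have "((\<lambda>y. m x (m (- x) y)) has_derivative (\<lambda>v. L x (R x v))) (at x)"
    by (rule has_derivative_compose[of "m (- x)" "R x"]) (simp_all add: has_derivative_L has_derivative_m R_def)
  moreover have "(\<lambda>y. m x (m (- x) y)) = (\<lambda>y. y)" by auto
  ultimately have "((\<lambda>y. y) has_derivative (\<lambda>v. L x (R x v))) (at x)" by simp
  from has_derivative_unique[OF this has_derivative_ident] show ?thesis by metis
qed

lemma R_zero [simp]: "R 0 v = v"
  using R_L[of 0 v] by simp

text \<open>Differentiating \<open>ray\<close> at s = 0: the one-parameter subgroup in direction
  \<open>x\<close> is a line of constant velocity.\<close>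

lemma L_ray [simp]: "L (t *\<^sub>R x) x = x"
proof -
  have "((\<lambda>s. m (t *\<^sub>R x) (0 + s *\<^sub>R x)) has_vector_derivative L (t *\<^sub>R x) x) (at 0)"
    by (rule has_vector_derivative_line) (simp add: has_derivative_L)
  moreover have "((\<lambda>s. m (t *\<^sub>R x) (0 + s *\<^sub>R x)) has_vector_derivative x) (at 0)"
    by (auto intro!: derivative_eq_intros simp: ray)
  ultimately show ?thesis using vector_derivative_unique_at by blast
qed

abbreviation "DL v x w \<equiv> fderiv (\<lambda>z. L z v) x w"

lemma has_derivative_DL: "((\<lambda>z. L z v) has_derivative DL v x) (at x)"
  by (rule smooth_on_has_derivative[OF smooth_L]) simp

lemma linear_DL: "linear (DL v x)"
  by (rule has_derivative_linear[OF has_derivative_DL])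

lemma linear_DL_left: "linear (\<lambda>v. DL v x w)"
proof (rule linearI)
  show "DL (u + v) x w = DL u x w + DL v x w" for u v
  proof -
    have "((\<lambda>z. L z (u + v)) has_derivative (\<lambda>w. DL u x w + DL v x w)) (at x)"
      unfolding linear_add[OF linear_L] by (intro has_derivative_add has_derivative_DL)
    from fun_cong[OF has_derivative_unique[OF has_derivative_DL this]] show ?thesis .
  qed
  show "DL (c *\<^sub>R v) x w = c *\<^sub>R DL v x w" for c v
  proof -
    have "((\<lambda>z. L z (c *\<^sub>R v)) has_derivative (\<lambda>w. c *\<^sub>R DL v x w)) (at x)"
      unfolding linear_cmul[OF linear_L] by (intro has_derivative_scaleR_right has_derivative_DL)
    from fun_cong[OF has_derivative_unique[OF has_derivative_DL this]] show ?thesis .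
  qed
qed

lemma has_vector_derivative_R:
  "\<exists>D. ((\<lambda>t. t *\<^sub>R R (t *\<^sub>R x) y) has_vector_derivative D) (at t)"
proof -
  have "((\<lambda>s. R (0 + s *\<^sub>R x) y) has_vector_derivative fderiv (\<lambda>x. R x y) (0 + t *\<^sub>R x) x) (at t)"
    by (intro has_vector_derivative_line smooth_on_has_derivative[OF smooth_R UNIV_I])
  from has_vector_derivative_scaleR[OF DERIV_ident this] show ?thesis by auto
qed

end

text \<open>In coordinates the commutator of two vector fields is DY X - DX Y. Thus
  \<open>structure_eq\<close> says, at every point \<open>a\<close>, that the field generated by
  \<open>br x y\<close> is the commutator of those generated by \<open>x\<close> and
  \<open>y\<close>; it is the Maurer-Cartan equation.\<close>

locale exp_coordinates_bracket = exp_coordinates +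
  fixes br :: "'a \<Rightarrow> 'a \<Rightarrow> 'a"
  assumes structure_eq: "L a (br x y) = DL y a (L a x) - DL x a (L a y)"
begin

lemma linear_br: "linear (br x)"
proof -
  have "br x = (\<lambda>y. DL y 0 x - DL x 0 y)" using structure_eq[of 0] by auto
  then show ?thesis by (simp add: linear_compose_sub linear_DL linear_DL_left)
qed

text \<open>Differentiate \<open>L (t x) V = t y\<close> and \<open>L u u = u\<close>, and compare with the structure equation.\<close>

lemma exp_differential_ode:
  "((\<lambda>t. t *\<^sub>R R (t *\<^sub>R x) y) has_vector_derivative y - br x (t *\<^sub>R R (t *\<^sub>R x) y)) (at t)"
proof -
  let ?V = "\<lambda>t. t *\<^sub>R R (t *\<^sub>R x) y"
  obtain V' where V': "(?V has_vector_derivative V') (at t)" using has_vector_derivative_R by blast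
  have x': "((\<lambda>t. t *\<^sub>R x) has_vector_derivative x) (at t)" by (auto intro!: derivative_eq_intros)
  have "((\<lambda>t. L (t *\<^sub>R x) (?V t)) has_vector_derivative DL (?V t) (t *\<^sub>R x) x + L (t *\<^sub>R x) V') (at t)"
    by (rule has_derivative_linear_family[OF linear_L has_derivative_DL x' V'])
  moreover have "((\<lambda>t. L (t *\<^sub>R x) (?V t)) has_vector_derivative y) (at t)"
    by (simp add: linear_cmul[OF linear_L]) (auto intro!: derivative_eq_intros)
  ultimately have 1: "y = DL (?V t) (t *\<^sub>R x) x + L (t *\<^sub>R x) V'" using vector_derivative_unique_at by blast
  have y': "((\<lambda>s. t *\<^sub>R x + s *\<^sub>R y) has_vector_derivative y) (at 0)" by (auto intro!: derivative_eq_intros)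
  have "((\<lambda>s. L (t *\<^sub>R x + s *\<^sub>R y) (t *\<^sub>R x + s *\<^sub>R y)) has_vector_derivative
      DL (t *\<^sub>R x + 0 *\<^sub>R y) (t *\<^sub>R x + 0 *\<^sub>R y) y + L (t *\<^sub>R x + 0 *\<^sub>R y) y) (at 0)"
    by (rule has_derivative_linear_family[OF linear_L has_derivative_DL y' y'])
  moreover have "((\<lambda>s. L (t *\<^sub>R x + s *\<^sub>R y) (t *\<^sub>R x + s *\<^sub>R y)) has_vector_derivative y) (at 0)"
    using y' L_ray[of 1] by simp
  ultimately have "y = DL (t *\<^sub>R x) (t *\<^sub>R x) y + L (t *\<^sub>R x) y" using vector_derivative_unique_at by fastforce
  then have 2: "DL x (t *\<^sub>R x) (t *\<^sub>R y) = y - L (t *\<^sub>R x) y"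
    by (simp add: linear_cmul[OF linear_DL] linear_cmul[OF linear_DL_left] algebra_simps)
  have "L (t *\<^sub>R x) (br x (?V t)) = DL (?V t) (t *\<^sub>R x) (L (t *\<^sub>R x) x) - DL x (t *\<^sub>R x) (L (t *\<^sub>R x) (?V t))"
    by (rule structure_eq)
  also have "\<dots> = DL (?V t) (t *\<^sub>R x) x - DL x (t *\<^sub>R x) (t *\<^sub>R y)"
    by (simp add: linear_cmul[OF linear_L])
  also have "\<dots> = L (t *\<^sub>R x) y - L (t *\<^sub>R x) V'" using 1 2 by (simp add: algebra_simps)
  finally have "R (t *\<^sub>R x) (L (t *\<^sub>R x) (br x (?V t))) = R (t *\<^sub>R x) (L (t *\<^sub>R x) (y - V'))"
    by (simp add: linear_diff[OF linear_L])
  then have "V' = y - br x (?V t)" by simp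
  then show ?thesis using V' by simp
qed

text \<open>Applying \<open>d\<close> to the solution of the differential equation for
  \<open>x\<close>, \<open>y\<close> gives a solution of the one for \<open>d x\<close>,
  \<open>d y\<close>. Both vanish at t = 0 because of the factor t, so they agree; at t = 1 this is
  the claim for \<open>R\<close>, which is then inverted.\<close>

lemma L_automorphism:
  assumes d: "linear d" and br: "\<And>x y. br (d x) (d y) = d (br x y)"
  shows "L (d x) (d y) = d (L x y)"
proof -
  have R: "d (R x y) = R (d x) (d y)" for y
  proof -
    let ?U = "\<lambda>t. d (t *\<^sub>R R (t *\<^sub>R x) y) - t *\<^sub>R R (t *\<^sub>R d x) (d y)"
    have "?U 1 = 0"
    proof (rule linear_ode_zero)
      show "linear (\<lambda>u. - br (d x) u)" by (intro linear_compose_neg linear_br)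
      show "(?U has_vector_derivative - br (d x) (?U t)) (at t)" for t
      proof -
        have "(?U has_vector_derivative d (y - br x (t *\<^sub>R R (t *\<^sub>R x) y)) - (d y - br (d x) (t *\<^sub>R R (t *\<^sub>R d x) (d y)))) (at t)"
          by (intro has_vector_derivative_diff bounded_linear.has_vector_derivative[OF linear_imp_bounded[OF d]] exp_differential_ode)
        then show ?thesis by (simp add: linear_diff[OF d] linear_diff[OF linear_br] br[symmetric])
      qed
    qed (auto simp: linear_0[OF d])
    then show ?thesis by simp
  qed
  have "L (d x) (d y) = L (d x) (d (R x (L x y)))" by simp
  also have "\<dots> = L (d x) (R (d x) (d (L x y)))" by (simp only: R)
  finally show ?thesis by simp
qed

end

section \<open>Left translations preserve Lebesgue measure\<close>

lemma continuous_on_Det: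
  assumes "\<And>v. continuous_on S (\<lambda>x. f x v)"
  shows "continuous_on S (\<lambda>x. Det (f x))"
  unfolding Det_def det_def
  by (intro continuous_intros)
     (auto simp: matrix_def to_cart_def intro!: continuous_intros assms)

lemma Det_inverse_mult:
  assumes "linear f" "linear g" "\<And>x. f (g x) = x"
  shows "Det f * Det g = 1"
proof -
  have "f \<circ> g = (\<lambda>x. x)" using assms(3) by auto
  then show ?thesis using Det_compose[OF assms(1,2)] Det_id by metis
qed

lemma Det_conjugate:
  fixes f d d' :: "'e::euclidean_space \<Rightarrow> 'e"
  assumes "linear d" "linear d'" "linear f" "\<And>x. d (d' x) = x"
  shows "Det (\<lambda>x. d (f (d' x))) = Det f"
proof -
  have "(\<lambda>x. d (f (d' x))) = d \<circ> (f \<circ> d')" by auto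
  then have "Det (\<lambda>x. d (f (d' x))) = Det d * (Det f * Det d')"
    using Det_compose[OF assms(1) linear_compose[OF assms(2,3)]] Det_compose[OF assms(3,2)] by metis
  then show ?thesis using Det_inverse_mult[OF assms(1,2,4)] by simp
qed

lemma (in exp_coordinates_bracket) Det_L:
  fixes d :: "real \<Rightarrow> 'a \<Rightarrow> 'a"
  assumes lin: "\<And>t. linear (d t)" and br: "\<And>t x y. br (d t x) (d t y) = d t (br x y)"
    and inv: "\<And>t x. d t (d (- t) x) = x" and lim: "\<And>x. ((\<lambda>t. d t x) \<longlongrightarrow> 0) at_bot"
  shows "Det (L x) = 1"
proof -
  have eq: "Det (L (d t x)) = Det (L x)" for t
  proof -
    have "L (d t x) v = d t (L x (d (- t) v))" for v
      using L_automorphism[OF lin br, of t x "d (- t) v"] inv by simp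
    then have "L (d t x) = (\<lambda>v. d t (L x (d (- t) v)))" by auto
    then show ?thesis using Det_conjugate[OF lin lin linear_L inv] by simp
  qed
  have "continuous_on UNIV (\<lambda>x. Det (L x))"
    by (rule continuous_on_Det[OF smooth_on_continuous[OF smooth_L]])
  then have "((\<lambda>t. Det (L (d t x))) \<longlongrightarrow> Det (L 0)) at_bot"
    by (rule continuous_on_tendsto_compose[OF _ lim]) auto
  then have "((\<lambda>t. Det (L x)) \<longlongrightarrow> Det (L 0)) (at_bot :: real filter)" by (simp add: eq)
  then have "Det (L x) = Det (L 0)" using tendsto_unique[OF trivial_limit_at_bot_linorder tendsto_const] by blast
  then show ?thesis by (simp add: Det_id)
qed

locale unimodular_exp_coordinates = exp_coordinates +
  assumes Det_L: "Det (L x) = 1"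
begin

lemma continuous_m: "continuous_on UNIV (\<lambda>(x, y). m x y)"
  by (rule smooth_on_continuous[OF smooth_m])

lemma measurable_m [measurable]: "(\<lambda>p. m (fst p) (snd p)) \<in> borel_measurable borel"
  using borel_measurable_continuous_onI[OF continuous_m] by (simp add: case_prod_beta')

lemma m_measurable [measurable (raw)]:
  "f \<in> borel_measurable M \<Longrightarrow> g \<in> borel_measurable M \<Longrightarrow> (\<lambda>x. m (f x) (g x)) \<in> borel_measurable M"
  using measurable_compose[OF borel_measurable_Pair measurable_m, of f M g] by simp

text \<open>By \<open>L_mult\<close> the differential at an arbitrary point \<open>y\<close> is
  \<open>L (m x y)\<close> times the inverse of \<open>L y\<close>, so determinant 1 at the identity
  propagates to all points.\<close>

lemma Det_frechet_m: "Det (fderiv (m x) y) = 1"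
proof -
  have "fderiv (m x) y \<circ> L y = L (m x y)" using L_mult by auto
  then show ?thesis using Det_compose[OF linear_frechet_m linear_L, of x y y] Det_L by simp
qed

lemma distr_left: "distr lborel borel (m x) = lborel"
proof -
  have "distr lborel borel (m x) = density lborel (\<lambda>_. ennreal 1)"
    by (rule distr_lborel_const_Jacobian[of "m (- x)", OF has_derivative_m])
       (use cancel[of "- x"] smooth_on_continuous[OF smooth_translation] in \<open>auto simp: Det_frechet_m\<close>)
  then show ?thesis by (simp add: density_1)
qed

lemma uminus_m: "- m x y = m (- y) (- x)"
proof -
  have "m (- y) (m (- x) (m x y)) = m (m (- y) (- x)) (m x y)" by (rule assoc[symmetric])
  then have "m (m (- y) (- x)) (m x y) = 0" by simp
  then show ?thesis using assoc[of "m (- y) (- x)" "m x y" "- m x y"] by simp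
qed

lemma distr_uminus: "distr lborel borel uminus = (lborel :: 'a measure)"
  using lborel_affine[of "-1" "0 :: 'a"] by (simp add: density_1)

text \<open>This map is a left translation followed by the reflection y \<mapsto> - y, which is the
  group inverse. Both preserve Lebesgue measure, and right invariance follows in turn.\<close>

lemma distr_right_inverse: "distr lborel borel (\<lambda>y. m (- y) x) = lborel"
proof -
  have eq: "m (- y) x = - m (- x) y" for y by (simp add: uminus_m)
  have "distr lborel borel (\<lambda>y. m (- y) x) = distr (distr lborel borel (m (- x))) borel uminus"
    by (subst distr_distr) (auto simp: o_def eq)
  then show ?thesis by (simp add: distr_left distr_uminus)
qed

lemma distr_right: "distr lborel borel (\<lambda>y. m y x) = lborel"
proof -
  have "distr lborel borel (\<lambda>y. m y x) = distr (distr lborel borel uminus) borel (\<lambda>y. m (- y) x)"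
    by (subst distr_distr) (auto simp: o_def)
  then show ?thesis by (simp add: distr_right_inverse distr_uminus)
qed

lemma nn_integral_distr_eq:
  assumes "distr N borel f = N" "f \<in> borel_measurable N" "h \<in> borel_measurable borel" 
  shows "(\<integral>\<^sup>+y. h (f y) \<partial>N) = (\<integral>\<^sup>+y. h y \<partial>N)"
proof -
  have "(\<integral>\<^sup>+y. h y \<partial>distr N borel f) = (\<integral>\<^sup>+y. h (f y) \<partial>N)"
    by (rule nn_integral_distr) (simp_all add: assms(2,3))
  then show ?thesis by (simp add: assms(1))
qed

text \<open>The usual Tonelli argument for the uniqueness of Haar measure, Lebesgue measure being both left
  and right invariant.\<close>

lemma left_invariant_unique:
  assumes sets: "sets \<mu> = sets borel" and inv: "\<And>x. distr \<mu> borel (m x) = \<mu>"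
    and fin: "\<And>K. compact K \<Longrightarrow> emeasure \<mu> K < \<infinity>" and B: "B \<in> sets borel"
  shows "emeasure \<mu> B * emeasure lborel (cball 0 1 :: 'a set) = emeasure \<mu> (cball 0 1) * emeasure lborel B"
proof -
  have [measurable_cong]: "sets \<mu> = sets borel" by (rule sets)
  have sp: "space \<mu> = UNIV" using sets_eq_imp_space_eq[OF sets] by simp
  have sf: "sigma_finite_measure \<mu>"
  proof
    show "\<exists>A. countable A \<and> A \<subseteq> sets \<mu> \<and> \<Union>A = space \<mu> \<and> (\<forall>a\<in>A. emeasure \<mu> a \<noteq> \<infinity>)"
    proof (intro exI conjI ballI)
      show "countable (range (\<lambda>n. cball 0 (real n) :: 'a set))" by simp
      show "range (\<lambda>n. cball 0 (real n)) \<subseteq> sets \<mu>" by (auto simp: sets)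
      show "\<Union>(range (\<lambda>n. cball 0 (real n))) = space \<mu>"
        using real_arch_simple by (auto simp: sp)
      show "emeasure \<mu> a \<noteq> \<infinity>" if "a \<in> range (\<lambda>n. cball 0 (real n))" for a
        using that fin[of a] by auto
    qed
  qed
  interpret pair_sigma_finite \<mu> "lborel :: 'a measure"
    using sf sigma_finite_lborel by (simp add: pair_sigma_finite_def)
  let ?C = "cball 0 1 :: 'a set"
  have [measurable]: "B \<in> sets borel" "?C \<in> sets borel" using B by auto
  have mm: "m x \<in> borel_measurable borel" for x
    by (rule borel_measurable_continuous_onI[OF smooth_on_continuous[OF smooth_translation]])
  have "emeasure \<mu> B * emeasure lborel ?C = (\<integral>\<^sup>+x. indicator B x * (\<integral>\<^sup>+y. indicator ?C y \<partial>lborel) \<partial>\<mu>)"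
    by (simp add: nn_integral_multc sets)
  \<comment> \<open>Right invariance of Lebesgue measure inserts a shift by x into the indicator of
    the ball. After Tonelli, left invariance of \<mu> moves the shift by y from the ball to
    \<open>B\<close>, and \<open>distr_right_inverse\<close> then integrates \<open>B\<close>
    out.\<close>
  also have "\<dots> = (\<integral>\<^sup>+x. indicator B x * (\<integral>\<^sup>+y. indicator ?C (m y x) \<partial>lborel) \<partial>\<mu>)"
    by (subst nn_integral_distr_eq[OF distr_right]) auto
  also have "\<dots> = (\<integral>\<^sup>+x. (\<integral>\<^sup>+y. indicator B x * indicator ?C (m y x) \<partial>lborel) \<partial>\<mu>)"
    by (intro nn_integral_cong nn_integral_cmult[symmetric]) simp
  also have "\<dots> = (\<integral>\<^sup>+y. (\<integral>\<^sup>+x. indicator B x * indicator ?C (m y x) \<partial>\<mu>) \<partial>lborel)"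
    by (rule Fubini'[symmetric]) simp
  also have "\<dots> = (\<integral>\<^sup>+y. (\<integral>\<^sup>+x. indicator B (m (- y) x) * indicator ?C x \<partial>\<mu>) \<partial>lborel)"
  proof (rule nn_integral_cong)
    fix y :: 'a
    have "(\<integral>\<^sup>+x. (\<lambda>x. indicator B (m (- y) x) * indicator ?C x) (m y x) \<partial>\<mu>) = (\<integral>\<^sup>+x. indicator B (m (- y) x) * indicator ?C x \<partial>\<mu>)"
      by (rule nn_integral_distr_eq[OF inv]) (use mm in auto)
    then show "(\<integral>\<^sup>+x. indicator B x * indicator ?C (m y x) \<partial>\<mu>) = (\<integral>\<^sup>+x. indicator B (m (- y) x) * indicator ?C x \<partial>\<mu>)"
      by simp
  qed
  also have "\<dots> = (\<integral>\<^sup>+x. (\<integral>\<^sup>+y. indicator B (m (- y) x) * indicator ?C x \<partial>lborel) \<partial>\<mu>)"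
    by (rule Fubini') simp
  also have "\<dots> = (\<integral>\<^sup>+x. (\<integral>\<^sup>+y. indicator B (m (- y) x) \<partial>lborel) * indicator ?C x \<partial>\<mu>)"
    by (intro nn_integral_cong nn_integral_multc) simp
  also have "\<dots> = (\<integral>\<^sup>+x. (\<integral>\<^sup>+y. indicator B y \<partial>lborel) * indicator ?C x \<partial>\<mu>)"
    by (subst nn_integral_distr_eq[OF distr_right_inverse]) auto
  also have "\<dots> = emeasure lborel B * emeasure \<mu> ?C"
    by (simp add: nn_integral_cmult sets)
  finally show ?thesis by (simp add: mult.commute)
qed

lemma left_invariant_eq_scaled_lborel:
  assumes sets: "sets \<mu> = sets borel" and inv: "\<And>x. distr \<mu> borel (m x) = \<mu>"
    and fin: "\<And>K. compact K \<Longrightarrow> emeasure \<mu> K < \<infinity>" and nz: "emeasure \<mu> UNIV \<noteq> 0"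
  obtains c where "c > 0" "\<mu> = density lborel (\<lambda>_. ennreal c)"
proof -
  let ?C = "cball 0 1 :: 'a set"
  have C: "emeasure lborel ?C \<noteq> 0" "emeasure lborel ?C \<noteq> \<infinity>"
  proof -
    have "emeasure lborel (ball 0 1 :: 'a set) \<le> emeasure lborel ?C" by (intro emeasure_mono) auto
    moreover have "emeasure lborel (ball 0 1 :: 'a set) \<noteq> 0"
      using open_not_negligible[of "ball 0 1 :: 'a set"] by (auto simp: negligible_iff_emeasure0)
    ultimately show "emeasure lborel ?C \<noteq> 0" by auto
    show "emeasure lborel ?C \<noteq> \<infinity>" using emeasure_lborel_cball_finite[of "0::'a" 1] by (metis infinity_ennreal_def less_irrefl)
  qed
  define k where "k = measure lborel ?C"
  have k: "emeasure lborel ?C = ennreal k" "k > 0"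
    using C by (auto simp: k_def emeasure_eq_ennreal_measure measure_eq_0_null_sets zero_less_measure_iff)
  define a where "a = measure \<mu> ?C"
  have a: "emeasure \<mu> ?C = ennreal a" "a \<ge> 0"
    using fin[of ?C] by (auto simp: a_def emeasure_eq_ennreal_measure less_top)
  have eq: "emeasure \<mu> B = ennreal (a / k) * emeasure lborel B" if B: "B \<in> sets borel" for B
  proof -
    have "emeasure \<mu> B * ennreal k = ennreal a * emeasure lborel B"
      using left_invariant_unique[OF sets inv fin B] k(1) a(1) by simp
    then have "emeasure \<mu> B * ennreal k * ennreal (1 / k) = ennreal a * emeasure lborel B * ennreal (1 / k)" by simp
    moreover have "ennreal k * ennreal (1 / k) = 1" using k(2) by (simp add: ennreal_mult[symmetric])
    moreover have "ennreal a * ennreal (1 / k) = ennreal (a / k)" using k(2) a(2) by (simp add: ennreal_mult[symmetric])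
    ultimately show ?thesis by (metis mult.assoc mult.commute mult_1)
  qed
  have "\<mu> = density lborel (\<lambda>_. ennreal (a / k))"
    by (rule measure_eqI) (auto simp: sets emeasure_density nn_integral_cmult_indicator eq)
  moreover have "a / k > 0" using nz eq[of UNIV] a(2) k(2) by (cases "a = 0") auto
  ultimately show ?thesis using that by blast
qed

end

section \<open>From an atlas to exponential coordinates\<close>

locale lie_group_exp = lie_group atlas
  for atlas :: "('g::{topological_group_add, t2_space, second_countable_topology},
                 'e::euclidean_space) chart set" +
  fixes \<kappa> :: "('g, 'e) chart" and E :: "'e \<Rightarrow> 'g"
  assumes identity_chart: "\<kappa> \<in> atlas" "0 \<in> fst \<kappa>"
    and exponential: "exponential_map \<kappa> E" and diffeomorphism: "global_diffeomorphism atlas E"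
begin

lemma E_inv [simp]: "E (inv E x) = x" and inv_E [simp]: "inv E (E X) = X"
  and continuous_E: "continuous_on S E" and continuous_inv_E: "continuous_on T (inv E)"
  using diffeomorphism unfolding global_diffeomorphism_def homeomorphism_def
  by (auto intro: continuous_on_subset)

lemma E_add: "E ((s + t) *\<^sub>R X) = E (s *\<^sub>R X) + E (t *\<^sub>R X)"
  using exponential unfolding exponential_map_def by blast

lemma E_zero [simp]: "E 0 = 0"
  using E_add[of 0 0 0] add_left_cancel[of "E 0" "E 0" 0] by simp

lemma E_zero_iff [simp]: "E X = 0 \<longleftrightarrow> X = 0"
  by (metis E_zero inv_E)

lemma inv_E_zero [simp]: "inv E 0 = 0"
  by (metis E_zero inv_E)

lemma open_E_vimage: "open S \<Longrightarrow> open (E -` S)"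
  using continuous_E[of UNIV] by (simp add: continuous_on_open_vimage)

lemma chart_inv [simp]: "c \<in> atlas \<Longrightarrow> x \<in> fst c \<Longrightarrow> chart_inv c (snd c x) = x"
  using chart_homeomorphism unfolding homeomorphism_def by blast

lemma smooth_chart_E: "c \<in> atlas \<Longrightarrow> smooth_on (E -` fst c) (\<lambda>X. snd c (E X))"
  using diffeomorphism unfolding global_diffeomorphism_def by (auto simp: o_def)

lemma smooth_inv_E_chart: "c \<in> atlas \<Longrightarrow> smooth_on (chart_image c) (\<lambda>z. inv E (chart_inv c z))"
  using diffeomorphism unfolding global_diffeomorphism_def smooth_fun_def by (auto simp: o_def)

lemma smooth_fun_E:
  assumes "smooth_fun atlas f"
  shows "smooth_on UNIV (\<lambda>X. f (E X))"
proof (rule smooth_on_local)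
  fix X
  obtain c where c: "c \<in> atlas" "E X \<in> fst c" using covers by blast
  have "smooth_on (E -` fst c) (\<lambda>X. (f \<circ> chart_inv c) (snd c (E X)))"
    by (rule smooth_on_compose[where T = "chart_image c"])
       (use assms c open_E_vimage[OF open_domain] smooth_chart_E in \<open>auto simp: smooth_fun_def o_def\<close>)
  then have "smooth_on (E -` fst c) (\<lambda>X. f (E X))"
    by (subst (asm) smooth_on_cong[OF open_E_vimage[OF open_domain[OF c(1)]]]) (use c in auto)
  then show "\<exists>U. open U \<and> X \<in> U \<and> smooth_on U (\<lambda>X. f (E X))"
    using c open_E_vimage[OF open_domain[OF c(1)]] by (intro exI[of _ "E -` fst c"]) auto
qed

lemma smooth_fun_inv_E:
  assumes "smooth_on UNIV F"
  shows "smooth_fun atlas (\<lambda>x. F (inv E x))"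
  unfolding smooth_fun_def o_def
  by (auto intro!: smooth_on_compose[OF open_image _ smooth_inv_E_chart assms])

definition mult :: "'e \<Rightarrow> 'e \<Rightarrow> 'e" where "mult X Y = inv E (E X + E Y)"

lemma smooth_mult: "smooth_on UNIV (\<lambda>(X, Y). mult X Y)"
proof (rule smooth_on_local)
  fix p :: "'e \<times> 'e"
  obtain X Y where p: "p = (X, Y)" by (cases p)
  obtain c where c: "c \<in> atlas" "E X \<in> fst c" using covers by blast
  obtain d where d: "d \<in> atlas" "E Y \<in> fst d" using covers by blast
  obtain e where e: "e \<in> atlas" "E X + E Y \<in> fst e" using covers by blast
  define U where "U = (E \<circ> fst) -` fst c \<inter> (E \<circ> snd) -` fst d \<inter> (\<lambda>p. E (fst p) + E (snd p)) -` fst e"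
  have op: "open U" unfolding U_def o_def
    by (intro open_Int open_vimage open_domain c d e continuous_intros continuous_on_compose2[OF continuous_E[of UNIV]]) auto
  let ?T = "{(snd c x, snd d y) |x y. x \<in> fst c \<and> y \<in> fst d \<and> x + y \<in> fst e}"
  have "smooth_on U (\<lambda>p. (snd c (E (fst p)), snd d (E (snd p))))"
    by (intro smooth_on_Pair[OF op] smooth_on_compose[OF op _ _ smooth_chart_E[OF c(1)]] smooth_on_compose[OF op _ _ smooth_chart_E[OF d(1)]]
        smooth_on_subset[OF linear_imp_smooth_on[OF bounded_linear_fst]] smooth_on_subset[OF linear_imp_smooth_on[OF bounded_linear_snd]])
       (auto simp: U_def)
  then have "smooth_on U (\<lambda>p. (\<lambda>(a, b). snd e (chart_inv c a + chart_inv d b)) (snd c (E (fst p)), snd d (E (snd p))))"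
    by (rule smooth_on_compose[OF op _ _ smooth_product[OF c(1) d(1) e(1)], rotated]) (auto simp: U_def, blast)
  then have "smooth_on U (\<lambda>p. snd e (E (fst p) + E (snd p)))"
    by (subst (asm) smooth_on_cong[OF op]) (use c d in \<open>auto simp: U_def\<close>)
  then have "smooth_on U (\<lambda>p. inv E (chart_inv e (snd e (E (fst p) + E (snd p)))))"
    by (rule smooth_on_compose[OF op _ _ smooth_inv_E_chart[OF e(1)], rotated]) (auto simp: U_def)
  then have "smooth_on U (\<lambda>(X, Y). mult X Y)"
    by (subst (asm) smooth_on_cong[OF op]) (use e in \<open>auto simp: U_def mult_def\<close>)
  then show "\<exists>U. open U \<and> p \<in> U \<and> smooth_on U (\<lambda>(X, Y). mult X Y)"
    using op c d e by (intro exI[of _ U]) (auto simp: U_def p)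
qed

sublocale exp_coordinates mult
proof
  show "smooth_on UNIV (\<lambda>(X, Y). mult X Y)" by (rule smooth_mult)
qed (simp_all add: mult_def add.assoc flip: E_add)

text \<open>The chart \<kappa> and the exponential map both identify the tangent space at 0 with the
  model space. The initial-velocity clause of \<open>exponential_map\<close> makes the two
  identifications agree, so no Jacobian enters the formula for \<open>left_field\<close>.\<close>

lemma has_derivative_inv_E_chart:
  "((\<lambda>z. inv E (chart_inv \<kappa> z)) has_derivative (\<lambda>v. v)) (at (snd \<kappa> 0))"
proof -
  let ?\<psi> = "\<lambda>z. inv E (chart_inv \<kappa> z)" and ?\<phi> = "\<lambda>X. snd \<kappa> (E X)"
  define P where "P = fderiv ?\<psi> (snd \<kappa> 0)"
  define K where "K = fderiv ?\<phi> 0"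
  have P: "(?\<psi> has_derivative P) (at (?\<phi> 0))"
    unfolding P_def using smooth_on_has_derivative[OF smooth_inv_E_chart[OF identity_chart(1)], of "snd \<kappa> 0"] identity_chart by simp
  have K: "(?\<phi> has_derivative K) (at 0)"
    unfolding K_def using smooth_on_has_derivative[OF smooth_chart_E[OF identity_chart(1)]] identity_chart by simp
  have "((\<lambda>X. ?\<psi> (?\<phi> X)) has_derivative (\<lambda>v. P (K v))) (at 0)"
    by (rule has_derivative_compose[OF K P])
  then have "((\<lambda>X. X) has_derivative (\<lambda>v. P (K v))) (at 0)"
    by (rule has_derivative_transform_within_open[OF _ open_E_vimage[OF open_domain[OF identity_chart(1)]]])
       (use identity_chart in auto)
  then have PK: "P (K v) = v" for v using has_derivative_unique[OF has_derivative_ident] by metis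
  have "K v = v" for v
  proof -
    have "((\<lambda>t. ?\<phi> (0 + t *\<^sub>R v)) has_vector_derivative K v) (at 0)"
      by (rule has_vector_derivative_line) (simp add: K)
    moreover have "((\<lambda>t. ?\<phi> (t *\<^sub>R v)) has_vector_derivative v) (at 0)"
      using exponential unfolding exponential_map_def by blast
    ultimately show ?thesis using vector_derivative_unique_at by fastforce
  qed
  then have "P = (\<lambda>v. v)" using PK by auto
  then show ?thesis using P by simp
qed

lemma left_field_E:
  assumes "((\<lambda>X. g (E X)) has_derivative D) (at a)"
  shows "left_field \<kappa> X g (E a) = D (L a X)"
proof -
  let ?\<psi> = "\<lambda>z. inv E (chart_inv \<kappa> z)"
  have \<psi>0: "?\<psi> (snd \<kappa> 0) = 0" using identity_chart by simp
  have "((\<lambda>z. mult a (?\<psi> z)) has_derivative L a) (at (snd \<kappa> 0))"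
    by (rule has_derivative_compose[OF has_derivative_inv_E_chart]) (simp only: \<psi>0 has_derivative_L)
  then have "((\<lambda>z. g (E (mult a (?\<psi> z)))) has_derivative (\<lambda>v. D (L a v))) (at (snd \<kappa> 0))"
    by (rule has_derivative_compose[where g = "\<lambda>X. g (E X)"]) (simp add: \<psi>0 assms)
  then have "((\<lambda>z. g (E a + chart_inv \<kappa> z)) has_derivative (\<lambda>v. D (L a v))) (at (snd \<kappa> 0))"
    by (simp add: mult_def)
  then show ?thesis unfolding left_field_def using frechet_derivative_at by metis
qed

definition bracket0 where "bracket0 X Y = DL Y 0 X - DL X 0 Y"

text \<open>Left invariance pulls both sides back to the identity by H(y) = F(a y). There each
  iterated field is a second derivative of \<open>H\<close> plus the first derivative of
  \<open>H\<close> along \<open>DL\<close>; the second derivatives cancel by symmetry and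
  \<open>bracket0\<close> remains.\<close>

lemma left_field_commutator:
  assumes f: "smooth_fun atlas f"
  shows "left_field \<kappa> X (left_field \<kappa> Y f) x - left_field \<kappa> Y (left_field \<kappa> X f) x =
         left_field \<kappa> (bracket0 X Y) f x"
proof -
  define a where "a = inv E x"
  have x: "x = E a" by (simp add: a_def)
  define F where "F = (\<lambda>X. f (E X))"
  have F: "smooth_on UNIV F" unfolding F_def by (rule smooth_fun_E[OF f])
  have lf: "left_field \<kappa> Y f (E b) = fderiv F b (L b Y)" for b Y
    by (rule left_field_E) (use smooth_on_has_derivative[OF F] in \<open>simp add: F_def\<close>)
  define H where "H = (\<lambda>y. F (mult a y))"
  have H: "smooth_on UNIV H" unfolding H_def
    by (rule smooth_on_compose[OF open_UNIV _ smooth_translation F]) simp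
  have dH: "fderiv H y v = fderiv F (mult a y) (fderiv (mult a) y v)" for y v
  proof -
    have "(H has_derivative (\<lambda>v. fderiv F (mult a y) (fderiv (mult a) y v))) (at y)"
      unfolding H_def by (rule has_derivative_compose[OF has_derivative_m smooth_on_has_derivative[OF F UNIV_I]])
    then show ?thesis using frechet_derivative_at by metis
  qed
  define G where "G = (\<lambda>Y b. fderiv F b (L b Y))"
  have G: "smooth_on UNIV (G Y)" for Y
  proof -
    have "G Y = (\<lambda>b. \<Sum>i\<in>Basis. (L b Y \<bullet> i) *\<^sub>R fderiv F b i)"
    proof
      fix b
      have l: "linear (fderiv F b)"
        by (rule linear_fderiv[OF F UNIV_I])
      show "G Y b = (\<Sum>i\<in>Basis. (L b Y \<bullet> i) *\<^sub>R fderiv F b i)"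
        unfolding G_def by (rule linear_expand[OF l])
    qed
    then show ?thesis
      by (simp only:) (intro smooth_on_sum smooth_on_scaleR smooth_on_bounded_linear[OF bounded_linear_inner_left] smooth_L smooth_on_frechet[OF F] open_UNIV)
  qed
  have GH: "G Y (mult a y) = fderiv H y (L y Y)" for Y y
    unfolding G_def dH L_mult ..
  have XY: "left_field \<kappa> X (left_field \<kappa> Y f) x =
      fderiv (\<lambda>y. fderiv H y Y) 0 X + fderiv H 0 (DL Y 0 X)" for X Y
  proof -
    have GE: "(\<lambda>X. left_field \<kappa> Y f (E X)) = G Y" by (auto simp: lf G_def)
    have GD: "(G Y has_derivative fderiv (G Y) a) (at a)"
      by (rule smooth_on_has_derivative[OF G UNIV_I])
    have 1: "left_field \<kappa> X (left_field \<kappa> Y f) x = fderiv (G Y) a (L a X)"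
      unfolding x by (rule left_field_E) (simp only: GE GD)
    have "((\<lambda>y. G Y (mult a y)) has_derivative (\<lambda>v. fderiv (G Y) a (L a v))) (at 0)"
      by (rule has_derivative_compose[OF has_derivative_L]) (simp add: GD)
    from this have "((\<lambda>y. G Y (mult a y)) has_derivative (\<lambda>v. fderiv (G Y) a (L a v))) (at (0 + 0 *\<^sub>R X))" by simp
    from has_vector_derivative_line[OF this]
    have 2: "((\<lambda>t. fderiv H (t *\<^sub>R X) (L (t *\<^sub>R X) Y)) has_vector_derivative fderiv (G Y) a (L a X)) (at 0)"
      by (simp add: GH)
    have X': "((\<lambda>t. t *\<^sub>R X) has_vector_derivative X) (at 0)" by (auto intro!: derivative_eq_intros)
    have LV: "((\<lambda>t. L (t *\<^sub>R X) Y) has_vector_derivative DL Y 0 X) (at 0)"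
      using has_vector_derivative_line[OF has_derivative_DL[of Y "0 + 0 *\<^sub>R X"]] by simp
    have "((\<lambda>t. fderiv H (t *\<^sub>R X) (L (t *\<^sub>R X) Y)) has_vector_derivative
       fderiv (\<lambda>y. fderiv H y (L (0 *\<^sub>R X) Y)) (0 *\<^sub>R X) X + fderiv H (0 *\<^sub>R X) (DL Y 0 X)) (at 0)"
      by (rule has_derivative_linear_family[where L = "\<lambda>y. fderiv H y", OF _ _ X' LV])
         (auto intro!: linear_fderiv[OF H UNIV_I] smooth_on_has_derivative[OF smooth_on_frechet[OF H] UNIV_I])
    from vector_derivative_unique_at[OF 2 this] show ?thesis unfolding 1 by simp
  qed
  have sym: "fderiv (\<lambda>y. fderiv H y Y) 0 X = fderiv (\<lambda>y. fderiv H y X) 0 Y"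
    by (rule frechet_derivative_commute) (use H in \<open>unfold smooth_on_def, blast\<close>)
  have lH: "linear (fderiv H 0)"
    by (rule linear_fderiv[OF H UNIV_I])
  have "left_field \<kappa> (bracket0 X Y) f x = fderiv H 0 (bracket0 X Y)"
    by (simp add: x lf dH L_def)
  then show ?thesis
    unfolding XY sym bracket0_def linear_diff[OF lH] by simp
qed

lemma smooth_fun_inner: "smooth_fun atlas (\<lambda>x. inv E x \<bullet> b)"
  by (rule smooth_fun_inv_E[OF linear_imp_smooth_on[OF bounded_linear_inner_left]])

lemma left_field_inner: "left_field \<kappa> X (\<lambda>x. inv E x \<bullet> b) (E a) = L a X \<bullet> b"
  by (rule left_field_E) (auto intro!: derivative_eq_intros)

text \<open>Coordinate functions, tested at the identity, single out the vector and thereby justify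
  the definite description in \<open>lie_bracket\<close>.\<close>

lemma lie_bracket_eq: "lie_bracket atlas \<kappa> X Y = bracket0 X Y"
  unfolding lie_bracket_def
proof (rule the_equality)
  fix Z
  assume *: "\<forall>f. smooth_fun atlas f \<longrightarrow> (\<forall>x. left_field \<kappa> Z f x =
       left_field \<kappa> X (left_field \<kappa> Y f) x - left_field \<kappa> Y (left_field \<kappa> X f) x)"
  have "L 0 Z \<bullet> b = L 0 (bracket0 X Y) \<bullet> b" for b
    using *[rule_format, OF smooth_fun_inner, of b "E 0"] unfolding left_field_commutator[OF smooth_fun_inner]
    by (simp only: left_field_inner)
  then show "Z = bracket0 X Y" by (subst vector_eq_rdot[symmetric]) simp
qed (simp add: left_field_commutator)

text \<open>The same coordinate functions, tested at an arbitrary point instead of the identity,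
  turn the commutator formula into \<open>structure_eq\<close>.\<close>

sublocale exp_coordinates_bracket mult "lie_bracket atlas \<kappa>"
proof
  fix a X Y
  have "L a (bracket0 X Y) \<bullet> b = (DL Y a (L a X) - DL X a (L a Y)) \<bullet> b" for b
  proof -
    have *: "left_field \<kappa> X (left_field \<kappa> Y (\<lambda>x. inv E x \<bullet> b)) (E a) = DL Y a (L a X) \<bullet> b" for X Y
    proof (rule left_field_E)
      show "((\<lambda>Xa. left_field \<kappa> Y (\<lambda>x. inv E x \<bullet> b) (E Xa)) has_derivative (\<lambda>v. DL Y a v \<bullet> b)) (at a)"
        unfolding left_field_inner by (rule has_derivative_inner_left[OF has_derivative_DL])
    qed
    show ?thesis
      using left_field_commutator[OF smooth_fun_inner, of X Y b "E a"]
      by (simp add: * left_field_inner inner_diff_left)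
  qed
  then show "L a (lie_bracket atlas \<kappa> X Y) = DL Y a (L a X) - DL X a (L a Y)"
    unfolding lie_bracket_eq by (subst vector_eq_rdot[symmetric]) simp
qed

end

section \<open>Dilations\<close>

lemma Det_diagonal: "Det (\<lambda>x. \<Sum>i\<in>Basis. (c i * (x \<bullet> i)) *\<^sub>R i) = (\<Prod>i\<in>Basis. c i)"
proof -
  let ?M = "matrix (to_cart \<circ> (\<lambda>x. \<Sum>i\<in>Basis. (c i * (x \<bullet> i)) *\<^sub>R i) \<circ> of_cart) :: real ^ 'a bas ^ 'a bas"
  have of_axis: "of_cart (axis k 1) = basis_vector k" for k
    by (simp add: of_cart_def axis_def if_distrib[of "\<lambda>r. r *\<^sub>R _"] cong: if_cong)
  have M: "?M $ j $ k = (if j = k then c (basis_vector k) else 0)" for j k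
  proof -
    have "?M $ j $ k = (\<Sum>i\<in>Basis. (c i * (basis_vector k \<bullet> i)) *\<^sub>R i) \<bullet> basis_vector j"
      by (simp add: matrix_def to_cart_def of_axis)
    also have "\<dots> = c (basis_vector j) * (basis_vector k \<bullet> basis_vector j)"
      by (simp add: basis_vector)
    finally show ?thesis by (auto simp: inner_basis_vector)
  qed
  have "det ?M = (\<Prod>i\<in>UNIV. ?M $ i $ i)" by (rule det_diagonal) (simp add: M)
  then show ?thesis by (simp add: Det_def M prod_bas)
qed

locale dilations =
  fixes A :: "'e::euclidean_space \<Rightarrow> 'e"
  assumes linear_A: "linear A" and diagonalisable_A: "diagonalisable A"
    and positive_eigenvalues: "X \<noteq> 0 \<Longrightarrow> A X = \<nu> *\<^sub>R X \<Longrightarrow> \<nu> > 0"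
begin

text \<open>An eigenbasis need not be orthonormal; \<open>P\<close> carries the standard basis onto
  it, so that \<open>A\<close> is diagonal only after conjugation by \<open>P\<close>.\<close>

lemma eigenbasis:
  obtains P P' :: "'e \<Rightarrow> 'e" and \<nu> where "linear P" "linear P'" "\<And>x. P (P' x) = x" "\<And>x. P' (P x) = x"
    "\<And>i. i \<in> Basis \<Longrightarrow> A (P i) = \<nu> i *\<^sub>R P i" "\<And>i. i \<in> Basis \<Longrightarrow> \<nu> i > 0"
proof -
  obtain B where B: "independent B" "span B = UNIV" "\<forall>b\<in>B. \<exists>\<nu>. A b = \<nu> *\<^sub>R b"
    using diagonalisable_A unfolding diagonalisable_def by blast
  have fin: "finite B" using B(1) by (rule independent_imp_finite)
  have "card B = DIM('e)" using basis_card_eq_dim[of B UNIV] B by (simp add: dim_UNIV)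
  then obtain \<sigma> where \<sigma>: "bij_betw \<sigma> (Basis :: 'e set) B"
    using fin finite_same_card_bij[of "Basis :: 'e set" B] by auto
  define P where "P x = (\<Sum>i\<in>Basis. (x \<bullet> i) *\<^sub>R \<sigma> i)" for x
  have lP: "linear P"
    unfolding P_def by (intro linear_compose_sum ballI linearI) (auto simp: inner_add_left scaleR_add_left)
  have Pi: "P i = \<sigma> i" if "i \<in> Basis" for i
    using that by (simp add: P_def inner_Basis if_distrib[of "\<lambda>r. r *\<^sub>R _"] cong: if_cong)
  have "P ` UNIV = UNIV"
  proof -
    have "P ` UNIV = span (P ` Basis)" using linear_span_image[OF lP, of Basis] by simp
    also have "P ` Basis = B" using \<sigma> Pi by (auto simp: bij_betw_def)
    finally show ?thesis using B by simp
  qed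
  then have "surj P" by simp
  moreover from this have "inj P" using linear_surj_imp_inj[OF lP] by simp
  ultimately have P': "P (inv P x) = x" "inv P (P x) = x" for x
    by (simp_all add: surj_f_inv_f)
  have lP': "linear (inv P)"
    by (rule linearI) (metis P' linear_add[OF lP], metis P' linear_cmul[OF lP])
  have "\<exists>\<nu>. A (P i) = \<nu> *\<^sub>R P i \<and> \<nu> > 0" if i: "i \<in> Basis" for i
  proof -
    have b: "\<sigma> i \<in> B" using \<sigma> i by (auto simp: bij_betw_def)
    then have "\<sigma> i \<noteq> 0" using B(1) dependent_zero by metis
    then show ?thesis using B(3) b positive_eigenvalues by (metis Pi[OF i])
  qed
  then obtain \<nu> where "\<And>i. i \<in> Basis \<Longrightarrow> A (P i) = \<nu> i *\<^sub>R P i \<and> \<nu> i > 0" by metis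
  then show ?thesis using that[OF lP lP' P'] by blast
qed

text \<open>In logarithmic time, \<lambda> = exp t, the dilations form an additive one-parameter
  group with generator \<open>A\<close>.\<close>

definition flow :: "real \<Rightarrow> 'e \<Rightarrow> 'e" where "flow t = algebra_dilation A (exp t)"

lemma algebra_dilation_eq_flow: "r > 0 \<Longrightarrow> algebra_dilation A r = flow (ln r)"
  by (simp add: flow_def)

definition diagonalizes :: "('e \<Rightarrow> 'e) \<Rightarrow> ('e \<Rightarrow> 'e) \<Rightarrow> ('e \<Rightarrow> real) \<Rightarrow> bool" where
  "diagonalizes P P' \<nu> \<longleftrightarrow> linear P \<and> linear P' \<and> (\<forall>x. P (P' x) = x) \<and> (\<forall>x. P' (P x) = x) \<and>
    (\<forall>x. A x = P (\<Sum>i\<in>Basis. (\<nu> i * (P' x \<bullet> i)) *\<^sub>R i)) \<and> (\<forall>i\<in>Basis. \<nu> i > 0) \<and>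
    (\<forall>t x. flow t x = P (\<Sum>i\<in>Basis. (exp (t * \<nu> i) * (P' x \<bullet> i)) *\<^sub>R i))"

text \<open>On an eigenvector the operator series defining a dilation is a scalar exponential
  series.\<close>

lemma flow_eigen: "\<exists>P P' \<nu>. diagonalizes P P' \<nu>"
proof (rule eigenbasis)
  fix P P' :: "'e \<Rightarrow> 'e" and \<nu>
  assume P: "linear P" "linear P'" "\<And>x. P (P' x) = x" "\<And>x. P' (P x) = x"
    "\<And>i. i \<in> Basis \<Longrightarrow> A (P i) = \<nu> i *\<^sub>R P i" "\<And>i. i \<in> Basis \<Longrightarrow> \<nu> i > 0"
  have rep: "x = (\<Sum>i\<in>Basis. (P' x \<bullet> i) *\<^sub>R P i)" for x
  proof -
    have "P (P' x) = (\<Sum>i\<in>Basis. (P' x \<bullet> i) *\<^sub>R P i)"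
      by (rule linear_expand[OF P(1)])
    then show ?thesis using P(3) by simp
  qed
  have A: "A x = P (\<Sum>i\<in>Basis. (\<nu> i * (P' x \<bullet> i)) *\<^sub>R i)" for x
    by (subst rep[of x]) (simp add: linear_sum[OF linear_A] linear_cmul[OF linear_A] linear_sum[OF P(1)] linear_cmul[OF P(1)] P(5) mult.commute)
  have iter: "((\<lambda>Y. s *\<^sub>R A Y) ^^ k) x = (\<Sum>i\<in>Basis. ((s * \<nu> i) ^ k * (P' x \<bullet> i)) *\<^sub>R P i)" for s k x
  proof (induction k)
    case 0 then show ?case using rep by simp
  next
    case (Suc k)
    then show ?case
      by (simp add: linear_sum[OF linear_A] linear_cmul[OF linear_A] scaleR_sum_right P(5)) (simp add: mult_ac)
  qed
  have flow: "flow t x = P (\<Sum>i\<in>Basis. (exp (t * \<nu> i) * (P' x \<bullet> i)) *\<^sub>R i)" for t x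
  proof -
    have "(\<lambda>k. \<Sum>i\<in>Basis. (((t * \<nu> i) ^ k /\<^sub>R fact k) * (P' x \<bullet> i)) *\<^sub>R P i) sums
        (\<Sum>i\<in>Basis. (exp (t * \<nu> i) * (P' x \<bullet> i)) *\<^sub>R P i)"
      by (intro sums_sum sums_scaleR_left sums_mult2 exp_converges)
    moreover have "(1 / fact k) *\<^sub>R ((\<lambda>Y. t *\<^sub>R A Y) ^^ k) x = (\<Sum>i\<in>Basis. (((t * \<nu> i) ^ k /\<^sub>R fact k) * (P' x \<bullet> i)) *\<^sub>R P i)" for k
      by (simp add: iter scaleR_sum_right divide_inverse mult_ac)
    ultimately have "(\<lambda>k. (1 / fact k) *\<^sub>R ((\<lambda>Y. t *\<^sub>R A Y) ^^ k) x) sums (\<Sum>i\<in>Basis. (exp (t * \<nu> i) * (P' x \<bullet> i)) *\<^sub>R P i)"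
      by simp
    then show ?thesis
      by (simp add: flow_def algebra_dilation_def sums_iff linear_sum[OF P(1)] linear_cmul[OF P(1)])
  qed
  show ?thesis unfolding diagonalizes_def using P A flow
    by (intro exI[of _ P] exI[of _ P'] exI[of _ \<nu>]) blast
qed

lemma diagonalizesD:
  assumes "diagonalizes P P' \<nu>"
  shows "linear P" "linear P'" "P (P' x) = x" "P' (P x) = x" "A x = P (\<Sum>i\<in>Basis. (\<nu> i * (P' x \<bullet> i)) *\<^sub>R i)"
    "i \<in> Basis \<Longrightarrow> \<nu> i > 0" "flow t x = P (\<Sum>i\<in>Basis. (exp (t * \<nu> i) * (P' x \<bullet> i)) *\<^sub>R i)"
  using assms unfolding diagonalizes_def by blast+

lemma linear_flow: "linear (flow t)"
proof -
  obtain P P' \<nu> where "diagonalizes P P' \<nu>" using flow_eigen by blast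
  note P = diagonalizesD(1-4)[OF this] and A = diagonalizesD(5)[OF this] and \<nu> = diagonalizesD(6)[OF this]
    and f = diagonalizesD(7)[OF this]
  have "linear (\<lambda>x. \<Sum>i\<in>Basis. (exp (t * \<nu> i) * (P' x \<bullet> i)) *\<^sub>R i)"
    by (intro linear_compose_sum ballI linearI)
       (auto simp: linear_add[OF P(2)] linear_cmul[OF P(2)] inner_add_left algebra_simps)
  from linear_compose[OF this P(1)] show ?thesis by (simp add: o_def f[abs_def])
qed

lemma flow_0 [simp]: "flow 0 x = x"
proof -
  obtain P P' \<nu> where "diagonalizes P P' \<nu>" using flow_eigen by blast
  note P = diagonalizesD(1-4)[OF this] and A = diagonalizesD(5)[OF this] and \<nu> = diagonalizesD(6)[OF this]
    and f = diagonalizesD(7)[OF this]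
  show ?thesis by (simp add: f euclidean_representation P)
qed

lemma flow_add: "flow (s + t) x = flow s (flow t x)"
proof -
  obtain P P' \<nu> where "diagonalizes P P' \<nu>" using flow_eigen by blast
  note P = diagonalizesD(1-4)[OF this] and A = diagonalizesD(5)[OF this] and \<nu> = diagonalizesD(6)[OF this]
    and f = diagonalizesD(7)[OF this]
  show ?thesis unfolding f P
    by (simp add: distrib_right exp_add mult.assoc cong: sum.cong)
qed

lemma flow_minus [simp]: "flow t (flow (- t) x) = x" "flow (- t) (flow t x) = x"
  by (simp_all flip: flow_add)

lemma flow_vector_derivative: "((\<lambda>t. flow t x) has_vector_derivative A (flow t x)) (at t)"
proof -
  obtain P P' \<nu> where "diagonalizes P P' \<nu>" using flow_eigen by blast
  note P = diagonalizesD(1-4)[OF this] and A = diagonalizesD(5)[OF this] and \<nu> = diagonalizesD(6)[OF this]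
    and f = diagonalizesD(7)[OF this]
  have "((\<lambda>t. \<Sum>i\<in>Basis. (exp (t * \<nu> i) * (P' x \<bullet> i)) *\<^sub>R i) has_vector_derivative
     (\<Sum>i\<in>Basis. (\<nu> i * exp (t * \<nu> i) * (P' x \<bullet> i)) *\<^sub>R i)) (at t)"
    by (auto intro!: derivative_eq_intros has_vector_derivative_sum has_vector_derivative_scaleR sum.cong
        simp: has_vector_derivative_def has_field_derivative_def algebra_simps scaleR_sum_right)
  from bounded_linear.has_vector_derivative[OF linear_imp_bounded[OF P(1)] this]
  show ?thesis unfolding f A P
    by (simp add: mult.assoc cong: sum.cong)
qed

lemma flow_tendsto_0: "((\<lambda>t. flow t x) \<longlongrightarrow> 0) at_bot"
proof -
  obtain P P' \<nu> where "diagonalizes P P' \<nu>" using flow_eigen by blast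
  note P = diagonalizesD(1-4)[OF this] and A = diagonalizesD(5)[OF this] and \<nu> = diagonalizesD(6)[OF this]
    and f = diagonalizesD(7)[OF this]
  have "((\<lambda>t. exp (t * \<nu> i)) \<longlongrightarrow> 0) at_bot" if "i \<in> Basis" for i
  proof -
    have "filterlim (\<lambda>t. t * \<nu> i) at_bot at_bot"
      using \<nu>[OF that] filterlim_ident by (subst mult.commute) (rule filterlim_tendsto_pos_mult_at_bot[OF tendsto_const])
    then show ?thesis by (rule filterlim_compose[OF exp_at_bot])
  qed
  then have "((\<lambda>t. \<Sum>i\<in>Basis. (exp (t * \<nu> i) * (P' x \<bullet> i)) *\<^sub>R i) \<longlongrightarrow> (\<Sum>i\<in>Basis. (0 * (P' x \<bullet> i)) *\<^sub>R i)) at_bot"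
    by (intro tendsto_intros)
  from bounded_linear.tendsto[OF linear_imp_bounded[OF P(1)] this]
  show ?thesis by (simp add: f linear_0[OF P(1)])
qed

text \<open>The determinant is the product of the exp (t \<nu>) by conjugation; the trace that
  defines Q is the sum of the \<nu>, even though it is computed in the standard basis.\<close>

lemma Det_flow: "Det (flow t) = exp (t * homogeneous_dimension A)"
proof -
  obtain P P' \<nu> where "diagonalizes P P' \<nu>" using flow_eigen by blast
  note P = diagonalizesD(1-4)[OF this] and A = diagonalizesD(5)[OF this] and \<nu> = diagonalizesD(6)[OF this]
    and f = diagonalizesD(7)[OF this]
  have "homogeneous_dimension A = (\<Sum>j\<in>Basis. \<Sum>i\<in>Basis. \<nu> i * ((P' j \<bullet> i) * (P i \<bullet> j)))"
    unfolding homogeneous_dimension_def A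
    by (simp add: linear_sum[OF P(1)] linear_cmul[OF P(1)] inner_sum_left mult.assoc)
  also have "\<dots> = (\<Sum>i\<in>Basis. \<nu> i * (\<Sum>j\<in>Basis. (P' j \<bullet> i) * (P i \<bullet> j)))"
    by (subst sum.swap) (simp add: sum_distrib_left)
  \<comment> \<open>The inner sum is the diagonal entry at i of \<open>P'\<close> composed with
    \<open>P\<close>, which is the identity.\<close>
  also have "\<dots> = (\<Sum>i\<in>Basis. \<nu> i)"
  proof (rule sum.cong[OF refl])
    fix i :: 'e assume i: "i \<in> Basis"
    have "(\<Sum>j\<in>Basis. (P' j \<bullet> i) * (P i \<bullet> j)) = P' (\<Sum>j\<in>Basis. (P i \<bullet> j) *\<^sub>R j) \<bullet> i"
      by (simp add: linear_sum[OF P(2)] linear_cmul[OF P(2)] inner_sum_left mult.commute)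
    also have "\<dots> = 1" using i by (simp add: euclidean_representation P inner_Basis)
    finally show "\<nu> i * (\<Sum>j\<in>Basis. (P' j \<bullet> i) * (P i \<bullet> j)) = \<nu> i" by simp
  qed
  finally have Q: "homogeneous_dimension A = (\<Sum>i\<in>Basis. \<nu> i)" .
  have "Det (flow t) = Det (\<lambda>x. P' (flow t (P x)))"
    by (rule Det_conjugate[symmetric, OF P(2,1) linear_flow P(4)])
  also have "\<dots> = Det (\<lambda>x. \<Sum>i\<in>Basis. (exp (t * \<nu> i) * (x \<bullet> i)) *\<^sub>R i)" by (simp add: f P)
  also have "\<dots> = exp (t * homogeneous_dimension A)"
    by (simp add: Det_diagonal Q exp_sum sum_distrib_left)
  finally show ?thesis .
qed

text \<open>The density of an image measure is the Jacobian of the inverse map, hence the minus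
  sign.\<close>

lemma distr_flow: "distr lborel borel (flow t) = density lborel (\<lambda>_. ennreal (exp (- t * homogeneous_dimension A)))"
  by (rule distr_lborel_const_Jacobian[where f = "flow (- t)" and f' = "\<lambda>_. flow (- t)"])
     (auto simp: Det_flow intro!: bounded_linear_imp_has_derivative linear_continuous_on
       linear_imp_bounded linear_flow)

end

section \<open>The radial Hardy inequality in coordinates\<close>

lemma norm_powr_eq_inner: "norm x powr r = (x \<bullet> x) powr (r / 2)"
  by (simp add: norm_eq_sqrt_inner powr_half_sqrt[symmetric] powr_powr)

lemma tendsto_norm_powr_0: "r > 0 \<Longrightarrow> ((\<lambda>a::'b::real_normed_vector. norm a powr r) \<longlongrightarrow> 0) (at 0)"
  using tendsto_powr'[of norm 0 "at (0::'b)" "\<lambda>_. r" r] tendsto_norm_zero[OF tendsto_ident_at[of "0::'b" UNIV]] by simp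

lemma continuous_norm_powr:
  fixes g :: "'a::topological_space \<Rightarrow> 'b::real_normed_vector"
  assumes "continuous_on S g" "p > 0"
  shows "continuous_on S (\<lambda>x. norm (g x) powr p)"
  by (rule continuous_on_powr') (use assms in \<open>auto intro: continuous_intros\<close>)

text \<open>The duality map of L^p: p times \<open>J p\<close> is the gradient of the p-th power of
  the norm.\<close>

definition J :: "real \<Rightarrow> 'b::real_inner \<Rightarrow> 'b" where "J p a = norm a powr (p - 2) *\<^sub>R a"

lemma norm_J: "norm (J p a) = norm a powr (p - 1)"
  by (cases "a = 0") (simp_all add: J_def powr_mult_base[symmetric] powr_diff power2_eq_square)

lemma J_inner_self: "J p a \<bullet> a = norm a powr p"
  by (cases "a = 0") (simp_all add: J_def powr_diff dot_square_norm)

text \<open>For p < 2 the factor |a|^(p-2) blows up at the origin, but the norm of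
  \<open>J p a\<close> is |a|^(p-1), which still tends to 0.\<close>

lemma continuous_J:
  assumes "p > 1"
  shows "continuous_on UNIV (J p :: 'b::real_inner \<Rightarrow> 'b)"
  unfolding continuous_on_eq_continuous_at[OF open_UNIV]
proof
  fix a :: 'b
  show "isCont (J p) a"
  proof (cases "a = 0")
    case True
    have "((\<lambda>a::'b. norm (J p a)) \<longlongrightarrow> 0) (at 0)"
      unfolding norm_J using assms by (intro tendsto_norm_powr_0) simp
    then have "(J p \<longlongrightarrow> (0::'b)) (at 0)" by (simp only: tendsto_norm_zero_iff)
    then show ?thesis by (simp add: True isCont_def) (simp add: J_def)
  next
    case False
    have "continuous_on (- {0}) (J p :: 'b \<Rightarrow> 'b)"
      unfolding J_def[abs_def] by (intro continuous_intros) auto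
    then show ?thesis using False continuous_on_eq_continuous_at[of "- {0}" "J p :: 'b \<Rightarrow> 'b"] by auto
  qed
qed

text \<open>At a zero of \<phi> the p-th power is of smaller order than the norm because p > 1,
  which matches \<open>J p 0 = 0\<close>; elsewhere it is a power of the positive function \<phi>
  \<bullet> \<phi>.\<close>

lemma has_derivative_norm_powr:
  fixes \<phi> :: "real \<Rightarrow> 'b::real_inner"
  assumes p: "p > 1" and \<phi>: "(\<phi> has_vector_derivative \<phi>') (at t)"
  shows "((\<lambda>t. norm (\<phi> t) powr p) has_real_derivative p * (J p (\<phi> t) \<bullet> \<phi>')) (at t)"
proof (cases "\<phi> t = 0")
  case True
  have "((\<lambda>a::'b. norm a powr p) has_derivative (\<lambda>_. 0)) (at 0)"
  proof -
    have "((\<lambda>a::'b. norm a powr (p - 1)) \<longlongrightarrow> 0) (at 0)" using p by (intro tendsto_norm_powr_0) simp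
    then have "((\<lambda>a::'b. norm (norm a powr p - norm (0::'b) powr p - 0) / norm (a - 0)) \<longlongrightarrow> 0) (at 0)"
      by (rule Lim_transform_eventually) (auto simp: eventually_at_filter powr_diff)
    then show ?thesis by (simp add: has_derivative_iff_norm)
  qed
  then have "((\<lambda>t. norm (\<phi> t) powr p) has_derivative (\<lambda>_. 0)) (at t)"
    using has_derivative_compose[OF \<phi>[unfolded has_vector_derivative_def], of "\<lambda>a. norm a powr p"] True by simp
  then show ?thesis using True by (simp add: has_field_derivative_def J_def lambda_zero)
next
  case False
  have "((\<lambda>t. \<phi> t \<bullet> \<phi> t) has_real_derivative 2 * (\<phi> t \<bullet> \<phi>')) (at t)"
    using bounded_bilinear.has_vector_derivative[OF bounded_bilinear_inner \<phi> \<phi>]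
    by (simp add: real_vector_derivative inner_commute)
  from DERIV_fun_powr[OF this, of "p / 2"] False
  have "((\<lambda>t. (\<phi> t \<bullet> \<phi> t) powr (p / 2)) has_real_derivative p / 2 * (\<phi> t \<bullet> \<phi> t) powr (p / 2 - 1) * (2 * (\<phi> t \<bullet> \<phi>'))) (at t)"
    by simp
  moreover have "p / 2 - 1 = (p - 2) / 2" by simp
  ultimately show ?thesis unfolding norm_powr_eq_inner J_def by (simp only:) (simp add: mult.assoc)
qed

text \<open>Strict convexity: the slope at an intermediate point is compared with the slope at
  \<open>s\<close>. The case t = 0 is treated apart because the derivative formula is used only at
  positive arguments.\<close>

lemma powr_tangent:
  fixes s t :: real
  assumes p: "p > 1" and s: "s > 0" and t: "t \<ge> 0" and ne: "t \<noteq> s"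
  shows "t powr p > s powr p + p * s powr (p - 1) * (t - s)"
proof -
  have d: "((\<lambda>x. x powr p) has_real_derivative p * x powr (p - 1)) (at x)" if "x > 0" for x
    using that by (auto intro!: derivative_eq_intros)
  consider "t = 0" | "0 < t" "t < s" | "t > s" using t ne by linarith
  then show ?thesis
  proof cases
    case 1
    have "s powr p = s powr (p - 1) * s" using s by (simp add: powr_diff)
    then show ?thesis using 1 p s mult_strict_right_mono[of 1 p "s powr p"] by (simp add: mult.assoc)
  next
    case 2
    obtain z where z: "t < z" "z < s" "s powr p - t powr p = (s - t) * (p * z powr (p - 1))"
      using MVT2[OF 2(2), of "\<lambda>x. x powr p" "\<lambda>x. p * x powr (p - 1)"] d 2 by force
    have "z powr (p - 1) < s powr (p - 1)" using z 2 p by (intro powr_less_mono2) auto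
    then have "(s - t) * (p * z powr (p - 1)) < (s - t) * (p * s powr (p - 1))" using 2 p by simp
    then show ?thesis using z(3) by (simp add: algebra_simps)
  next
    case 3
    obtain z where z: "s < z" "z < t" "t powr p - s powr p = (t - s) * (p * z powr (p - 1))"
      using MVT2[OF 3, of "\<lambda>x. x powr p" "\<lambda>x. p * x powr (p - 1)"] d s by force
    have "s powr (p - 1) < z powr (p - 1)" using z s p by (intro powr_less_mono2) auto
    then have "(t - s) * (p * s powr (p - 1)) < (t - s) * (p * z powr (p - 1))" using 3 p by simp
    then show ?thesis using z(3) by (simp add: algebra_simps)
  qed
qed

text \<open>Cauchy-Schwarz reduces the claim to the scalar one for the two norms. Equality forces
  equal norms by strict convexity, then a \<bullet> b = |a|^2, and hence |a - b|^2 = 0.\<close>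

lemma norm_powr_tangent:
  fixes a b :: "'b::real_inner"
  assumes p: "p > 1"
  shows "norm b powr p \<ge> norm a powr p + p * (J p a \<bullet> (b - a))"
    and "norm b powr p = norm a powr p + p * (J p a \<bullet> (b - a)) \<Longrightarrow> a = b"
proof -
  have "norm b powr p \<ge> norm a powr p + p * (J p a \<bullet> (b - a)) \<and>
      (norm b powr p = norm a powr p + p * (J p a \<bullet> (b - a)) \<longrightarrow> a = b)"
  proof (cases "a = 0")
    case True then show ?thesis using p by (auto simp: J_def)
  next
    case False
    let ?s = "norm a" and ?t = "norm b"
    have s: "?s > 0" using False by simp
    have le: "J p a \<bullet> b \<le> ?s powr (p - 1) * ?t" using norm_cauchy_schwarz[of "J p a" b] by (simp add: norm_J)
    have eq: "J p a \<bullet> (b - a) = J p a \<bullet> b - ?s powr (p - 1) * ?s"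
      using s by (simp add: inner_diff_right J_inner_self powr_diff)
    have tan: "?t powr p \<ge> ?s powr p + p * ?s powr (p - 1) * (?t - ?s)"
      using powr_tangent[OF p s, of ?t] by (cases "?t = ?s") auto
    have le2: "p * (J p a \<bullet> (b - a)) \<le> p * ?s powr (p - 1) * (?t - ?s)"
      using mult_left_mono[OF le, of p] p unfolding eq by (simp add: algebra_simps)
    moreover have "a = b" if e: "?t powr p = ?s powr p + p * (J p a \<bullet> (b - a))"
    proof -
      have ts: "?t = ?s" using powr_tangent[OF p s, of ?t] e le2 by fastforce
      then have "p * (J p a \<bullet> (b - a)) = 0" using e by simp
      then have "J p a \<bullet> b = ?s powr (p - 1) * ?s" using p eq by simp
      then have "?s powr (p - 2) * (a \<bullet> b) = ?s powr (p - 2) * (?s * ?s)"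
        using s by (simp add: J_def powr_diff field_simps power2_eq_square)
      then have "a \<bullet> b = ?s * ?s" using s by simp
      moreover have "(a - b) \<bullet> (a - b) = a \<bullet> a - 2 * (a \<bullet> b) + b \<bullet> b"
        by (simp add: inner_diff_left inner_diff_right inner_commute)
      ultimately have "(a - b) \<bullet> (a - b) = 0" using ts by (simp only: dot_square_norm power2_eq_square)
      then show "a = b" by simp
    qed
    ultimately show ?thesis using tan by linarith
  qed
  then show "norm b powr p \<ge> norm a powr p + p * (J p a \<bullet> (b - a))"
    and "norm b powr p = norm a powr p + p * (J p a \<bullet> (b - a)) \<Longrightarrow> a = b" by auto
qed

text \<open>The set where \<open>g\<close> is nonzero is open and null, hence empty. This is how
  equality of integrals becomes equality at every point.\<close>

lemma continuous_nonneg_integral_0: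
  fixes g :: "'e::euclidean_space \<Rightarrow> real"
  assumes g: "continuous_on UNIV g" "\<And>x. g x \<ge> 0" "integrable lborel g" "integral\<^sup>L lborel g = 0"
  shows "g x = 0"
proof (rule ccontr)
  assume x: "g x \<noteq> 0"
  have "AE x in lborel. g x = 0" using integral_nonneg_eq_0_iff_AE[OF g(3)] g(2,4) by simp
  have S: "open {x. g x \<noteq> 0}"
    using g(1) by (intro open_Collect_neq continuous_on_const)
  then have "{x. g x \<noteq> 0} \<in> sets lborel" by simp
  then have "{x. g x \<noteq> 0} \<in> null_sets lborel"
    using \<open>AE x in lborel. g x = 0\<close> by (subst AE_iff_null_sets) auto
  then have "negligible {x. g x \<noteq> 0}"
    by (simp add: negligible_iff_null_sets null_sets_completionI)
  then show False using open_not_negligible[OF S] x by auto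
qed

section \<open>Functions supported away from the origin\<close>

text \<open>Stated with some compact set rather than with the closure of the support, so that it
  passes at once to any function vanishing wherever \<open>g\<close> does.\<close>

definition punctured :: "('e::euclidean_space \<Rightarrow> 'b::real_normed_vector) \<Rightarrow> bool" where
  "punctured g \<longleftrightarrow> (\<exists>K. compact K \<and> 0 \<notin> K \<and> (\<forall>x. x \<notin> K \<longrightarrow> g x = 0))"

lemma punctured_subset: "punctured g \<Longrightarrow> (\<And>x. g x = 0 \<Longrightarrow> h x = 0) \<Longrightarrow> punctured h"
  unfolding punctured_def by metis

lemma punctured_subset2:
  assumes "punctured f" "punctured g" "\<And>x. f x = 0 \<Longrightarrow> g x = 0 \<Longrightarrow> h x = 0"
  shows "punctured h"
proof -
  obtain K K' where "compact K" "0 \<notin> K" "\<And>x. x \<notin> K \<Longrightarrow> f x = 0" "compact K'" "0 \<notin> K'" "\<And>x. x \<notin> K' \<Longrightarrow> g x = 0"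
    using assms(1,2) unfolding punctured_def by metis
  then show ?thesis unfolding punctured_def using assms(3)
    by (intro exI[of _ "K \<union> K'"]) auto
qed

lemma punctured_at_0: "punctured g \<Longrightarrow> g 0 = 0"
  unfolding punctured_def by metis

lemma punctured_continuous:
  assumes "punctured g" "continuous_on (- {0}) g"
  shows "continuous_on UNIV g"
proof -
  obtain K where K: "compact K" "0 \<notin> K" "\<And>x. x \<notin> K \<Longrightarrow> g x = 0" using assms(1) unfolding punctured_def by metis
  have "continuous_on (- K) g" using K(3) continuous_on_cong[OF refl, of "- K" g "\<lambda>_. 0"] by simp
  moreover have "UNIV = (- {0}) \<union> - K" using K(2) by auto
  ultimately show ?thesis using continuous_on_open_Un[OF _ _ assms(2), of "- K"] K(1)
    by (metis compact_imp_closed open_Compl finite.emptyI finite_imp_closed finite_insert)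
qed

lemma punctured_integrable:
  fixes g :: "'e::euclidean_space \<Rightarrow> real"
  assumes "punctured g" "continuous_on UNIV g"
  shows "integrable lborel g"
proof -
  obtain K where K: "compact K" "0 \<notin> K" "\<And>x. x \<notin> K \<Longrightarrow> g x = 0" using assms(1) unfolding punctured_def by metis
  have "integrable lborel (\<lambda>x. indicator K x *\<^sub>R g x)"
    by (rule borel_integrable_compact[OF K(1) continuous_on_subset[OF assms(2)]]) simp
  moreover have "(\<lambda>x. indicator K x *\<^sub>R g x) = g" by (rule ext) (metis K(3) indicator_simps scaleR_one scaleR_zero_left scaleR_zero_right)
  ultimately show ?thesis by simp
qed

section \<open>Weighted integrals under dilations\<close>

locale radial_core = dilations +
  fixes n :: "'a \<Rightarrow> real"
  assumes continuous_n: "continuous_on S n" and n_nonneg: "n x \<ge> 0"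
    and n_flow: "n (flow t x) = exp t * n x" and n_eq_0 [simp]: "n x = 0 \<longleftrightarrow> x = 0"
begin

abbreviation Q where "Q \<equiv> homogeneous_dimension A"

lemma n_0 [simp]: "n 0 = 0"
  by simp

lemma n_pos [simp]: "0 < n x \<longleftrightarrow> x \<noteq> 0"
  using n_nonneg[of x] n_eq_0[of x] by linarith

lemma flow_eq_0 [simp]: "flow t x = 0 \<longleftrightarrow> x = 0"
  by (metis flow_minus(2) linear_0 linear_flow)

lemma continuous_flow: "continuous_on UNIV (\<lambda>p. flow (fst p) (snd p))"
proof -
  have eq: "(\<lambda>p. flow (fst p) (snd p)) = (\<lambda>p. \<Sum>b\<in>Basis. (snd p \<bullet> b) *\<^sub>R flow (fst p) b)"
    by (rule ext, rule linear_expand[OF linear_flow])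
  have "continuous_on UNIV (\<lambda>t. flow t b)" for b
    by (intro continuous_at_imp_continuous_on ballI has_vector_derivative_continuous[OF flow_vector_derivative])
  then have "continuous_on UNIV (\<lambda>p. flow (fst p) b)" for b
    by (rule continuous_on_compose2) (auto intro: continuous_intros)
  then show ?thesis by (subst eq) (intro continuous_intros)
qed

lemma continuous_flow' [continuous_intros]:
  "continuous_on S f \<Longrightarrow> continuous_on S g \<Longrightarrow> continuous_on S (\<lambda>x. flow (f x) (g x))"
  using continuous_on_compose2[OF continuous_flow, of S "\<lambda>x. (f x, g x)"] by (auto intro: continuous_intros)

lemma measurable_flow [measurable]: "flow t \<in> borel_measurable borel"
  by (rule borel_measurable_continuous_onI) (intro continuous_intros)

lemma flow_A: "flow t (A x) = A (flow t x)"
proof -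
  have "((\<lambda>s. flow t (flow s x)) has_vector_derivative flow t (A (flow 0 x))) (at 0)"
    by (rule bounded_linear.has_vector_derivative[OF linear_imp_bounded[OF linear_flow] flow_vector_derivative])
  moreover have "((\<lambda>s. flow s (flow t x)) has_vector_derivative A (flow 0 (flow t x))) (at 0)"
    by (rule flow_vector_derivative)
  ultimately show ?thesis using vector_derivative_unique_at
    by (simp flip: flow_add add: add.commute) blast
qed

lemma integral_flow:
  fixes g :: "'a \<Rightarrow> real"
  assumes [measurable]: "g \<in> borel_measurable borel"
  shows "(LINT x|lborel. g (flow t x)) = exp (- t * Q) * (LINT x|lborel. g x)"
proof -
  have "(LINT x|lborel. g (flow t x)) = integral\<^sup>L (distr lborel borel (flow t)) g"
    by (rule integral_distr[symmetric]) auto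
  then show ?thesis by (simp add: distr_flow integral_density)
qed

lemma continuous_weight: "continuous_on (- {0}) (\<lambda>x. n x powr q)"
  by (intro continuous_intros continuous_n) auto

lemma punctured_weight:
  fixes g :: "'a \<Rightarrow> real"
  assumes "punctured g" "continuous_on UNIV g"
  shows "continuous_on UNIV (\<lambda>x. g x * n x powr q)" "punctured (\<lambda>x. g x * n x powr q)"
    "integrable lborel (\<lambda>x. g x * n x powr q)"
proof -
  show 1: "punctured (\<lambda>x. g x * n x powr q)" by (rule punctured_subset[OF assms(1)]) simp
  show 2: "continuous_on UNIV (\<lambda>x. g x * n x powr q)"
    by (rule punctured_continuous[OF 1]) (intro continuous_intros continuous_on_subset[OF assms(2)] continuous_weight subset_UNIV)
  show "integrable lborel (\<lambda>x. g x * n x powr q)" by (rule punctured_integrable[OF 1 2])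
qed

text \<open>The Jacobian contributes - Q to the exponent, and the weight, being homogeneous of
  degree - q, contributes q.\<close>

lemma integral_weight_flow:
  fixes h :: "'a \<Rightarrow> real"
  assumes "punctured h" "continuous_on UNIV h"
  shows "(LINT x|lborel. h (flow t x) * n x powr - q) = exp ((q - Q) * t) * (LINT x|lborel. h x * n x powr - q)"
proof -
  have n: "n x powr - q = exp (q * t) * n (flow t x) powr - q" for x
  proof -
    have "(exp t * n x) powr - q = exp t powr - q * n x powr - q" by (simp add: powr_mult n_nonneg)
    also have "\<dots> = exp (- q * t) * n x powr - q" by (simp add: powr_def)
    finally have "exp (q * t) * n (flow t x) powr - q = (exp (q * t) * exp (- q * t)) * n x powr - q"
      by (simp only: n_flow mult.assoc)
    also have "exp (q * t) * exp (- q * t) = 1" using exp_minus_inverse[of "q * t"] by simp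
    finally show ?thesis by simp
  qed
  have "h (flow t x) * n x powr - q = exp (q * t) * (h (flow t x) * n (flow t x) powr - q)" for x
    by (subst n) (rule mult.left_commute)
  then have "(LINT x|lborel. h (flow t x) * n x powr - q) = (LINT x|lborel. exp (q * t) * (h (flow t x) * n (flow t x) powr - q))"
    by (simp only:)
  also have "\<dots> = exp (q * t) * (LINT x|lborel. h (flow t x) * n (flow t x) powr - q)" by simp
  also have "\<dots> = exp (q * t) * (exp (- t * Q) * (LINT x|lborel. h x * n x powr - q))"
    by (subst integral_flow) (auto intro!: borel_measurable_continuous_onI punctured_weight assms)
  also have "exp (q * t) * (exp (- t * Q) * I) = exp ((q - Q) * t) * I" for I
    unfolding mult.assoc[symmetric] exp_add[symmetric] by (simp add: algebra_simps)
  finally show ?thesis .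
qed

lemma punctured_flow:
  assumes "punctured h"
  shows "punctured (\<lambda>x. h (flow t x))"
proof -
  obtain K where K: "compact K" "0 \<notin> K" "\<And>x. x \<notin> K \<Longrightarrow> h x = 0" using assms unfolding punctured_def by metis
  show ?thesis unfolding punctured_def
  proof (intro exI conjI allI impI)
    show "compact (flow (- t) ` K)" by (intro compact_continuous_image K continuous_intros)
    show "0 \<notin> flow (- t) ` K" using K(2) by (auto simp: eq_commute[of 0])
    show "h (flow t x) = 0" if "x \<notin> flow (- t) ` K" for x
      using that K(3) flow_minus(2) by (metis image_eqI)
  qed
qed

text \<open>Sweeping \<open>K\<close> backwards over a unit of time gives a compact set that still
  avoids 0. It contains the supports of all functions \<open>h (flow t x)\<close> with t between 0
  and 1, which makes domination uniform in t.\<close>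

lemma compact_flow_backward:
  assumes "compact K" "0 \<notin> K"
  obtains K' where "compact K'" "0 \<notin> K'" "\<And>t x. t \<in> {0..1} \<Longrightarrow> flow t x \<in> K \<Longrightarrow> x \<in> K'"
proof
  let ?K = "(\<lambda>p. flow (fst p) (snd p)) ` ({-1..0} \<times> K)"
  show "compact ?K"
    by (intro compact_continuous_image compact_Times assms continuous_on_subset[OF continuous_flow]) auto
  show "0 \<notin> ?K" using assms(2) by (auto simp: eq_commute[of 0])
  show "x \<in> ?K" if "t \<in> {0..1}" "flow t x \<in> K" for t x
    using that by (intro image_eqI[of _ _ "(- t, flow t x)"]) auto
qed

text \<open>Differentiating the scaling law \<open>integral_weight_flow\<close> at \<open>t = 0\<close> replaces integration by
  parts in polar coordinates.\<close>

lemma radial_integration_by_parts: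
  fixes h h' :: "'a \<Rightarrow> real"
  assumes h: "punctured h" "continuous_on UNIV h" and h': "punctured h'" "continuous_on UNIV h'"
    and d: "\<And>x t. ((\<lambda>t. h (flow t x)) has_real_derivative h' (flow t x)) (at t)"
  shows "(LINT x|lborel. h' x * n x powr - q) = (q - Q) * (LINT x|lborel. h x * n x powr - q)"
proof -
  obtain K where K: "compact K" "0 \<notin> K" "\<And>x. x \<notin> K \<Longrightarrow> h' x = 0" using h'(1) unfolding punctured_def by metis
  obtain K' where K': "compact K'" and K'0: "0 \<notin> K'" and K'K: "\<And>t x. t \<in> {0..1} \<Longrightarrow> flow t x \<in> K \<Longrightarrow> x \<in> K'"
    using compact_flow_backward[OF K(1,2)] by blast
  obtain C where C: "\<And>x. x \<in> K \<Longrightarrow> norm (h' x) \<le> C"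
    using compact_imp_bounded[OF compact_continuous_image[OF continuous_on_subset[OF h'(2)] K(1)]]
    unfolding bounded_iff by auto
  define C' where "C' = max C 0"
  have C': "norm (h' x) \<le> C'" for x using C[of x] K(3)[of x] unfolding C'_def by (cases "x \<in> K") auto
  let ?t = "\<lambda>k. inverse (real (Suc k))"
  let ?s = "\<lambda>k x. (h (flow (?t k) x) - h x) / ?t k * n x powr - q"
  let ?I = "LINT x|lborel. h x * n x powr - q"
  have [measurable]: "h \<in> borel_measurable borel" "h' \<in> borel_measurable borel" "n \<in> borel_measurable borel"
    using h h' continuous_n by (auto intro!: borel_measurable_continuous_onI)
  have "(\<lambda>k. LINT x|lborel. ?s k x) \<longlonglongrightarrow> (LINT x|lborel. h' x * n x powr - q)"
  \<comment> \<open>By the mean value theorem the difference quotients are values of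
    \<open>h'\<close>, bounded by \<open>C'\<close> and supported in \<open>K'\<close> since the
    time steps are at most 1. The weight is bounded on \<open>K'\<close>, which avoids its
    singularity.\<close>
  proof (rule integral_dominated_convergence[where w = "\<lambda>x. C' * (indicator K' x *\<^sub>R n x powr - q)"])
    show "integrable lborel (\<lambda>x. C' * (indicator K' x *\<^sub>R n x powr - q))"
      by (intro integrable_mult_right borel_integrable_compact K' continuous_on_subset[OF continuous_weight]) (use K'0 in auto)
    show "AE x in lborel. (\<lambda>k. ?s k x) \<longlonglongrightarrow> h' x * n x powr - q"
    proof (rule AE_I2)
      fix x
      have "((\<lambda>t. (h (flow t x) - h (flow 0 x)) / (t - 0)) \<longlongrightarrow> h' (flow 0 x)) (at 0)"
        using d[of x 0] by (simp add: has_field_derivative_iff)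
      moreover have "filterlim ?t (at 0) sequentially"
        using LIMSEQ_inverse_real_of_nat by (auto simp: filterlim_at)
      ultimately have "(\<lambda>k. (h (flow (?t k) x) - h (flow 0 x)) / (?t k - 0)) \<longlonglongrightarrow> h' (flow 0 x)"
        by (rule filterlim_compose)
      then show "(\<lambda>k. ?s k x) \<longlonglongrightarrow> h' x * n x powr - q"
        by (intro tendsto_mult tendsto_const) simp
    qed
    show "AE x in lborel. norm (?s k x) \<le> C' * (indicator K' x *\<^sub>R n x powr - q)" for k
    proof (rule AE_I2)
      fix x
      have "\<exists>z>0. z < ?t k \<and> h (flow (?t k) x) - h (flow 0 x) = (?t k - 0) * h' (flow z x)"
        by (rule MVT2) (auto intro: d)
      then obtain z where z: "0 < z" "z < ?t k" "h (flow (?t k) x) - h x = ?t k * h' (flow z x)" by auto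
      have "norm (h' (flow z x)) \<le> C' * indicator K' x"
      proof (cases "flow z x \<in> K")
        case True
        have "?t k \<le> 1" by (simp add: field_simps)
        then have "x \<in> K'" using K'K[of z x] True z by simp
        then show ?thesis using C' by simp
      qed (use K(3) in \<open>simp add: C'_def\<close>)
      moreover have "(h (flow (?t k) x) - h x) / ?t k = h' (flow z x)" using z(3) by simp
      ultimately show "norm (?s k x) \<le> C' * (indicator K' x *\<^sub>R n x powr - q)"
        by (simp only: norm_mult) (simp add: mult_right_mono mult.assoc[symmetric])
    qed
  qed auto
  moreover have "(LINT x|lborel. ?s k x) = (exp ((q - Q) * ?t k) - 1) / ?t k * ?I" for k
  proof -
    have "integrable lborel (\<lambda>x. h (flow (?t k) x) * n x powr - q)"
    proof (rule punctured_weight)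
      show "punctured (\<lambda>x. h (flow (?t k) x))" by (rule punctured_flow[OF h(1)])
      show "continuous_on UNIV (\<lambda>x. h (flow (?t k) x))"
        by (intro continuous_on_compose2[OF h(2)] continuous_intros) auto
    qed
    moreover have "?s k = (\<lambda>x. (h (flow (?t k) x) * n x powr - q - h x * n x powr - q) / ?t k)"
      by (auto simp: left_diff_distrib)
    ultimately have "(LINT x|lborel. ?s k x) = ((LINT x|lborel. h (flow (?t k) x) * n x powr - q) - ?I) / ?t k"
      using punctured_weight(3)[OF h] by simp
    then show ?thesis unfolding integral_weight_flow[OF h] by (simp add: algebra_simps)
  qed
  moreover have "(\<lambda>k. (exp ((q - Q) * ?t k) - 1) / ?t k * ?I) \<longlonglongrightarrow> (q - Q) * ?I"
  proof -
    have "((\<lambda>t. exp ((q - Q) * t)) has_real_derivative q - Q) (at 0)"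
      by (auto intro!: derivative_eq_intros)
    then have "((\<lambda>t. (exp ((q - Q) * t) - 1) / t) \<longlongrightarrow> q - Q) (at 0)"
      by (simp add: has_field_derivative_iff)
    moreover have "filterlim ?t (at 0) sequentially"
      using LIMSEQ_inverse_real_of_nat by (auto simp: filterlim_at)
    ultimately have "(\<lambda>k. (exp ((q - Q) * ?t k) - 1) / ?t k) \<longlonglongrightarrow> q - Q"
      by (rule filterlim_compose)
    then show ?thesis by (intro tendsto_mult tendsto_const)
  qed
  ultimately show ?thesis using LIMSEQ_unique by fastforce
qed

end

section \<open>The generator of the dilations and the Hardy inequality\<close>

context radial_core begin

text \<open>The Euler field of the dilations: \<open>T\<close> is |x| times the radial derivative,
  but its definition does not involve the quasi-norm.\<close>

definition T :: "('a \<Rightarrow> 'b::real_normed_vector) \<Rightarrow> 'a \<Rightarrow> 'b" where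
  "T F x = fderiv F x (A x)"

lemma norm_scaled_powr: "norm (g /\<^sub>R n x) powr p = norm g powr p * n x powr - p"
  using n_nonneg[of x] by (simp add: powr_mult powr_minus inverse_powr)

lemma J_scaled: "J p (g /\<^sub>R n x) \<bullet> (k /\<^sub>R n x) = (J p g \<bullet> k) * n x powr - p"
proof (cases "x = 0")
  case False
  then have n: "n x > 0" by simp
  define i where "i = inverse (n x)"
  have i: "i > 0" using n by (simp add: i_def)
  have "n x powr - p = i powr p" using n by (simp add: i_def powr_minus inverse_powr)
  also have "\<dots> = i powr (p - 2) * i powr 2" by (simp flip: powr_add)
  also have "\<dots> = i powr (p - 2) * (i * i)" using i by (simp add: power2_eq_square)
  finally show ?thesis using i unfolding i_def[symmetric]
    by (simp add: J_def powr_mult)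
qed (simp add: J_def)

context
  fixes F :: "'a \<Rightarrow> 'b::euclidean_space"
  assumes F: "Ck_on (Suc 0) UNIV F"
begin

lemma continuous_F: "continuous_on UNIV F"
  by (rule Ck_on_continuous[OF F])

lemma T_flow: "((\<lambda>t. F (flow t x)) has_vector_derivative T F (flow t x)) (at t)"
proof -
  have d: "(F has_derivative fderiv F (flow t x)) (at (flow t x))"
    by (rule Ck_on_has_derivative[OF F]) simp
  from has_derivative_compose[OF flow_vector_derivative[unfolded has_vector_derivative_def] d]
  show ?thesis by (simp add: has_vector_derivative_def T_def linear_cmul[OF has_derivative_linear[OF d]])
qed

lemma T_expand: "T F x = (\<Sum>b\<in>Basis. (A x \<bullet> b) *\<^sub>R fderiv F x b)"
proof -
  have l: "linear (fderiv F x)"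
    by (rule has_derivative_linear[OF Ck_on_has_derivative[OF F UNIV_I]])
  show ?thesis unfolding T_def by (rule linear_expand[OF l])
qed

lemma continuous_T: "continuous_on UNIV (T F)"
proof -
  have "continuous_on UNIV A"
    by (rule linear_continuous_on[OF linear_imp_bounded[OF linear_A]])
  moreover have "continuous_on UNIV (\<lambda>x. fderiv F x b)" for b
    using F by simp
  ultimately have "continuous_on UNIV (\<lambda>x. \<Sum>b\<in>Basis. (A x \<bullet> b) *\<^sub>R fderiv F x b)"
    by (intro continuous_intros)
  then show ?thesis by (simp add: T_expand)
qed

end

context
  fixes F :: "'a \<Rightarrow> 'b::euclidean_space"
  assumes F: "Ck_on (Suc 0) UNIV F" and pF: "punctured F"
begin

lemma punctured_T: "punctured (T F)"
proof -
  obtain K where K: "compact K" "0 \<notin> K" "\<And>x. x \<notin> K \<Longrightarrow> F x = 0" using pF unfolding punctured_def by metis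
  have "T F x = 0" if "x \<notin> K" for x
  proof -
    have "open (- K)" using K(1) by (intro open_Compl compact_imp_closed)
    then have "fderiv F x = fderiv (\<lambda>_. 0) x"
      by (rule frechet_derivative_cong) (use K that in auto)
    then show ?thesis by (simp add: T_def frechet_derivative_const)
  qed
  then show ?thesis unfolding punctured_def using K by blast
qed

context
  fixes p :: real
  assumes p: "p > 1"
begin

lemma punctured_norm_powr:
  "punctured (\<lambda>x. norm (F x) powr p)" "continuous_on UNIV (\<lambda>x. norm (F x) powr p)"
  "punctured (\<lambda>x. norm (T F x) powr p)" "continuous_on UNIV (\<lambda>x. norm (T F x) powr p)"
  "punctured (\<lambda>x. J p (F x) \<bullet> T F x)" "continuous_on UNIV (\<lambda>x. J p (F x) \<bullet> T F x)"
proof -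
  show "punctured (\<lambda>x. norm (F x) powr p)" by (rule punctured_subset[OF pF]) simp
  show "punctured (\<lambda>x. norm (T F x) powr p)" by (rule punctured_subset[OF punctured_T]) simp
  show "punctured (\<lambda>x. J p (F x) \<bullet> T F x)" by (rule punctured_subset[OF punctured_T]) simp
  show "continuous_on UNIV (\<lambda>x. norm (F x) powr p)" "continuous_on UNIV (\<lambda>x. norm (T F x) powr p)"
    using p by (auto intro!: continuous_norm_powr continuous_F[OF F] continuous_T[OF F])
  show "continuous_on UNIV (\<lambda>x. J p (F x) \<bullet> T F x)"
    by (intro continuous_intros continuous_T[OF F] continuous_on_compose2[OF continuous_J[OF p] continuous_F[OF F]]) auto
qed

text \<open>Integration by parts for the p-th power of |F|. The order \<open>q\<close> stays free: q
  = p produces the Hardy inequality, q = p + 1 settles its equality case.\<close>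

lemma weighted_identity:
  "p * (LINT x|lborel. (J p (F x) \<bullet> T F x) * n x powr - q) =
   (q - Q) * (LINT x|lborel. norm (F x) powr p * n x powr - q)"
proof -
  have "(LINT x|lborel. (p * (J p (F x) \<bullet> T F x)) * n x powr - q) =
     (q - Q) * (LINT x|lborel. norm (F x) powr p * n x powr - q)"
  proof (rule radial_integration_by_parts)
    show "punctured (\<lambda>x. p * (J p (F x) \<bullet> T F x))"
      by (rule punctured_subset[OF punctured_norm_powr(5)]) simp
  qed (auto intro!: punctured_norm_powr continuous_intros has_derivative_norm_powr[OF p T_flow[OF F]])
  then show ?thesis by (simp add: mult.assoc)
qed

context
  fixes u v :: "'a \<Rightarrow> 'b"
  assumes pQ: "p < Q"
    and u: "\<And>x. u x = - (p / (Q - p)) *\<^sub>R (T F x /\<^sub>R n x)" and v: "\<And>x. v x = F x /\<^sub>R n x"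
begin

lemma continuous_uv: "continuous_on UNIV u" "continuous_on UNIV v" "punctured u" "punctured v"
proof -
  show 1: "punctured u" unfolding u by (rule punctured_subset[OF punctured_T]) simp
  show 2: "punctured v" unfolding v by (rule punctured_subset[OF pF]) simp
  have c: "continuous_on (- {0}) (\<lambda>x. inverse (n x))" by (intro continuous_intros continuous_n) auto
  show "continuous_on UNIV u" unfolding u
    by (rule punctured_continuous[OF 1[unfolded u]]) (intro continuous_intros c continuous_on_subset[OF continuous_T[OF F]] subset_UNIV)
  show "continuous_on UNIV v" unfolding v
    by (rule punctured_continuous[OF 2[unfolded v]]) (intro continuous_intros c continuous_on_subset[OF continuous_F[OF F]] subset_UNIV)
qed

lemma integrable_uv:
  "integrable lborel (\<lambda>x. norm (u x) powr p)" "integrable lborel (\<lambda>x. norm (v x) powr p)"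
  "integrable lborel (\<lambda>x. J p (v x) \<bullet> (u x - v x))"
proof -
  show "integrable lborel (\<lambda>x. norm (u x) powr p)"
    by (rule punctured_integrable[OF punctured_subset[OF continuous_uv(3)]])
       (use p in \<open>auto intro!: continuous_norm_powr continuous_uv\<close>)
  show "integrable lborel (\<lambda>x. norm (v x) powr p)"
    by (rule punctured_integrable[OF punctured_subset[OF continuous_uv(4)]])
       (use p in \<open>auto intro!: continuous_norm_powr continuous_uv\<close>)
  show "integrable lborel (\<lambda>x. J p (v x) \<bullet> (u x - v x))"
    by (rule punctured_integrable[OF punctured_subset[OF continuous_uv(4)]])
       (auto simp: J_def[of p 0] intro!: continuous_intros continuous_uv continuous_on_compose2[OF continuous_J[OF p] continuous_uv(2)])
qed

text \<open>At q = p the factor in \<open>weighted_identity\<close> is - (Q - p). The constant - p /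
  (Q - p) in \<open>u\<close> is chosen to cancel it, so that pairing \<open>J p v\<close> with
  \<open>u\<close> or with \<open>v\<close> gives the same integral.\<close>

lemma integral_orthogonal: "(LINT x|lborel. J p (v x) \<bullet> (u x - v x)) = 0"
proof -
  have eq: "J p (v x) \<bullet> (u x - v x) = - (p / (Q - p)) * ((J p (F x) \<bullet> T F x) * n x powr - p) - norm (F x) powr p * n x powr - p" for x
  proof -
    have "J p (v x) \<bullet> u x = - (p / (Q - p)) * ((J p (F x) \<bullet> T F x) * n x powr - p)"
      unfolding u v J_scaled[symmetric] by (rule inner_scaleR_right)
    moreover have "J p (v x) \<bullet> v x = norm (F x) powr p * n x powr - p"
      unfolding J_inner_self unfolding v norm_scaled_powr ..
    ultimately show ?thesis by (simp only: inner_diff_right)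
  qed
  have "(LINT x|lborel. J p (v x) \<bullet> (u x - v x)) =
     - (p / (Q - p)) * (LINT x|lborel. (J p (F x) \<bullet> T F x) * n x powr - p) - (LINT x|lborel. norm (F x) powr p * n x powr - p)"
    unfolding eq
    by (subst Bochner_Integration.integral_diff)
       (auto intro!: integrable_mult_right punctured_weight(3) punctured_norm_powr simp del: mult_minus_left)
  also have "\<dots> = 0"
    using weighted_identity[of p] pQ by (simp add: field_simps)
  finally show ?thesis .
qed

text \<open>The Bregman divergence of the p-th power of the norm between \<open>u\<close> and
  \<open>v\<close>.\<close>

definition deficit where "deficit x = norm (u x) powr p - norm (v x) powr p - p * (J p (v x) \<bullet> (u x - v x))"

lemma integrable_deficit: "integrable lborel deficit"
  unfolding deficit_def[abs_def] by (intro Bochner_Integration.integrable_diff integrable_mult_right integrable_uv)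

lemma integral_deficit:
  "(LINT x|lborel. deficit x) = (LINT x|lborel. norm (u x) powr p) - (LINT x|lborel. norm (v x) powr p)"
  unfolding deficit_def
  by (subst Bochner_Integration.integral_diff | intro Bochner_Integration.integrable_diff integrable_mult_right integrable_uv)+
     (simp add: integral_orthogonal)

lemma deficit_nonneg: "deficit x \<ge> 0"
  using norm_powr_tangent(1)[OF p, of "v x" "u x"] by (simp add: deficit_def)

lemma hardy_le: "(LINT x|lborel. norm (v x) powr p) \<le> (LINT x|lborel. norm (u x) powr p)"
proof -
  have "0 \<le> (LINT x|lborel. deficit x)" by (rule Bochner_Integration.integral_nonneg) (rule deficit_nonneg)
  then show ?thesis by (simp add: integral_deficit)
qed

text \<open>Equality forces \<open>T F = - ((Q - p) / p) F\<close>; testing this against a weight of another order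
  in \<open>weighted_identity\<close> leaves only \<open>F = 0\<close>.\<close>

lemma hardy_eq:
  assumes eq: "(LINT x|lborel. norm (v x) powr p) = (LINT x|lborel. norm (u x) powr p)"
  shows "F x = 0"
proof -
  have "deficit x = 0" for x
  proof (rule continuous_nonneg_integral_0[OF _ deficit_nonneg integrable_deficit])
    show "continuous_on UNIV deficit" unfolding deficit_def[abs_def]
      using p by (intro continuous_intros continuous_norm_powr continuous_uv continuous_on_compose2[OF continuous_J[OF p] continuous_uv(2)]) auto
  qed (simp add: integral_deficit eq)
  then have "norm (u x) powr p = norm (v x) powr p + p * (J p (v x) \<bullet> (u x - v x))" for x
    unfolding deficit_def by (simp add: diff_diff_eq)
  then have vu: "v x = u x" for x by (rule norm_powr_tangent(2)[OF p])
  have T: "T F x = - ((Q - p) / p) *\<^sub>R F x" for x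
  proof (cases "x = 0")
    case True then show ?thesis using punctured_at_0[OF punctured_T] punctured_at_0[OF pF] by simp
  next
    case False
    then have "n x *\<^sub>R v x = n x *\<^sub>R u x" using vu by simp
    then have "F x = - (p / (Q - p)) *\<^sub>R T F x" using False by (simp add: u v)
    then have "- ((Q - p) / p) *\<^sub>R F x = (((Q - p) / p) * (p / (Q - p))) *\<^sub>R T F x" by simp
    then show ?thesis using p pQ by simp
  qed
  let ?I = "LINT x|lborel. norm (F x) powr p * n x powr - (p + 1)"
  have "p * (LINT x|lborel. (- ((Q - p) / p)) * (norm (F x) powr p * n x powr - (p + 1))) = (p + 1 - Q) * ?I"
    using weighted_identity[of "p + 1"] by (simp add: T J_inner_self mult.assoc)
  moreover have "(LINT x|lborel. (- ((Q - p) / p)) * (norm (F x) powr p * n x powr - (p + 1))) = - ((Q - p) / p) * ?I"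
    by (rule integral_mult_right_zero)
  moreover have "p * (- ((Q - p) / p) * I) = - (Q - p) * I" for I using p by (simp add: field_simps)
  ultimately have "- (Q - p) * ?I = (p + 1 - Q) * ?I" by (simp only:)
  \<comment> \<open>The coefficients p - Q and p + 1 - Q of the same integral differ by 1.\<close>
  then have I: "?I = 0" by algebra
  have "norm (F x) powr p * n x powr - (p + 1) = 0"
    by (rule continuous_nonneg_integral_0[OF _ _ _ I]) (auto intro!: punctured_weight punctured_norm_powr)
  then show ?thesis using punctured_at_0[OF pF] by (cases "x = 0") auto
qed

end
end
end
end

text \<open>An antiderivative of \<open>\<xi> |w|\<^bsup>p-2\<^esup>\<close> for the affine function \<open>w\<close> with slope \<open>d\<close> is
  \<open>\<xi> J p w / ((p - 1) d) - |w|\<^bsup>p\<^esup> / (p (p - 1) d\<^sup>2)\<close>.\<close>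

lemma remainder_identity:
  fixes u v :: real
  assumes p: "p > 1"
  shows "p * (remainder_weight p v u * \<bar>v - u\<bar>\<^sup>2) = norm u powr p - norm v powr p - p * (J p v \<bullet> (u - v))"
proof (cases "v = u")
  case False
  define d where "d = v - u"
  have d: "d \<noteq> 0" using False by (simp add: d_def)
  define w where "w \<xi> = \<xi> *\<^sub>R v + (1 - \<xi>) *\<^sub>R u" for \<xi>
  have w': "(w has_vector_derivative d) (at \<xi>)" for \<xi>
    unfolding w_def[abs_def] d_def real_vector_derivative[symmetric]
    by (auto intro!: derivative_eq_intros)
  have w_eq: "w \<xi> = u + \<xi> * d" for \<xi> by (simp add: w_def d_def algebra_simps)
  define g where "g \<xi> = norm (w \<xi>) powr (p - 2) * \<xi>" for \<xi>
  define H where "H \<xi> = \<xi> * J p (w \<xi>) / ((p - 1) * d) - norm (w \<xi>) powr p / (p * (p - 1) * d\<^sup>2)" for \<xi>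
  have np: "((\<lambda>\<xi>. norm (w \<xi>) powr p) has_real_derivative p * (J p (w \<xi>) * d)) (at \<xi>)" for \<xi>
    using has_derivative_norm_powr[OF p w'] by simp
  have J_eq: "J p x = norm x powr p / x" for x :: real
    using J_inner_self[of p x] by (cases "x = 0") (simp_all add: J_def[of _ 0] field_simps)
  have J': "((\<lambda>\<xi>. J p (w \<xi>)) has_real_derivative (p - 1) * d * norm (w \<xi>) powr (p - 2)) (at \<xi>)" if "w \<xi> \<noteq> 0" for \<xi>
  proof -
    have "((\<lambda>\<xi>. norm (w \<xi>) powr p / w \<xi>) has_real_derivative
        (p * (J p (w \<xi>) * d) * w \<xi> - norm (w \<xi>) powr p * d) / (w \<xi> * w \<xi>)) (at \<xi>)"
      by (rule DERIV_divide[OF np]) (use w' that in \<open>auto simp: real_vector_derivative\<close>)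
    moreover have "(p * (J p (w \<xi>) * d) * w \<xi> - norm (w \<xi>) powr p * d) / (w \<xi> * w \<xi>) = (p - 1) * d * norm (w \<xi>) powr (p - 2)"
    proof -
      have "norm (w \<xi>) powr p = norm (w \<xi>) powr (p - 2) * (w \<xi> * w \<xi>)"
        using J_inner_self[of p "w \<xi>"] by (simp add: J_def)
      then show ?thesis using that by (simp add: J_def field_simps)
    qed
    ultimately show ?thesis by (simp add: J_eq)
  qed
  have cw: "continuous_on S w" for S
    by (intro continuous_at_imp_continuous_on ballI has_vector_derivative_continuous[OF w'])
  have cJ: "continuous_on S (\<lambda>\<xi>. J p (w \<xi>))" for S
    by (rule continuous_on_compose2[OF continuous_J[OF p] cw]) simp
  have int: "(g has_integral H 1 - H 0) {0..1}"
  \<comment> \<open>\<open>w\<close> vanishes at - u / d, where for p < 2 the integrand is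
    unbounded. \<open>H\<close> remains continuous there, so a single exceptional point is
    admissible.\<close>
  proof (rule fundamental_theorem_of_calculus_interior_strong[where S = "{- u / d}"])
    fix \<xi> assume "\<xi> \<in> {0<..<1} - {- u / d}"
    then have w0: "w \<xi> \<noteq> 0" using d by (auto simp: w_eq field_simps add_eq_0_iff)
    have "(H has_real_derivative (1 * J p (w \<xi>) + (p - 1) * d * norm (w \<xi>) powr (p - 2) * \<xi>) / ((p - 1) * d)
        - p * (J p (w \<xi>) * d) / (p * (p - 1) * d\<^sup>2)) (at \<xi>)"
      unfolding H_def[abs_def] by (intro DERIV_diff DERIV_cdivide DERIV_mult DERIV_ident J' w0 np)
    moreover have "(1 * j + k * d * X * \<xi>) / (k * d) - p * (j * d) / (p * k * d\<^sup>2) = X * \<xi>" if "k \<noteq> 0" for j k X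
      using p d that by (simp add: field_simps power2_eq_square)
    from this[of "p - 1" "J p (w \<xi>)" "norm (w \<xi>) powr (p - 2)"] p
    have "(1 * J p (w \<xi>) + (p - 1) * d * norm (w \<xi>) powr (p - 2) * \<xi>) / ((p - 1) * d)
        - p * (J p (w \<xi>) * d) / (p * (p - 1) * d\<^sup>2) = g \<xi>"
      by (simp add: g_def)
    ultimately show "(H has_vector_derivative g \<xi>) (at \<xi>)"
      by (simp add: real_vector_derivative)
  next
    show "continuous_on {0..1} H" unfolding H_def[abs_def]
      using p d by (intro continuous_intros cJ continuous_norm_powr cw) auto
  qed auto
  \<comment> \<open>Nonnegativity upgrades gauge integrability to absolute integrability, which
    identifies the result with the Lebesgue integral in \<open>remainder_weight\<close>.\<close>
  have "g absolutely_integrable_on {0..1}"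
    by (rule nonnegative_absolutely_integrable_1) (use int in \<open>auto simp: g_def\<close>)
  moreover have "set_borel_measurable borel {0..1} g"
    unfolding set_borel_measurable_def g_def[abs_def] w_def[abs_def] by measurable
  ultimately have "set_integrable lborel {0..1} g"
    unfolding set_integrable_def set_borel_measurable_def by (subst (asm) integrable_completion) auto
  then have "(LINT \<xi>:{0..1}|lborel. g \<xi>) = H 1 - H 0"
    using int set_borel_integral_eq_integral(2) integral_unique by metis
  then have rw: "remainder_weight p v u = (p - 1) * (H 1 - H 0)"
    by (simp add: remainder_weight_def g_def w_def)
  have H1: "H 1 = J p v / ((p - 1) * d) - norm v powr p / (p * (p - 1) * d\<^sup>2)" and H0: "H 0 = - (norm u powr p / (p * (p - 1) * d\<^sup>2))"
    by (simp_all add: H_def w_def)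
  have alg: "p * (k * (j / (k * d) - V / (p * k * d\<^sup>2) - - (U / (p * k * d\<^sup>2))) * d\<^sup>2) = p * d * j - V + U"
    if "k \<noteq> 0" for j k U V
    using p d that by (simp add: field_simps power2_eq_square)
  have "p * (remainder_weight p v u * \<bar>v - u\<bar>\<^sup>2) = p * ((p - 1) * (H 1 - H 0) * d\<^sup>2)"
    by (simp add: rw d_def)
  also have "\<dots> = p * d * J p v - norm v powr p + norm u powr p"
    unfolding H1 H0 by (rule alg) (use p in simp)
  finally show ?thesis by (simp add: d_def algebra_simps)
qed simp

section \<open>Sharpness of the constant\<close>

text \<open>Write x^p = x x^(p-1) and enlarge the second factor. It lets the integrals of many
  nonnegative pieces add up from below, even where the pieces overlap.\<close>

lemma powr_superadditive:
  fixes a b :: real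
  assumes "a \<ge> 0" "b \<ge> 0" "p \<ge> 1"
  shows "a powr p + b powr p \<le> (a + b) powr p"
proof -
  have e: "x powr p = x * x powr (p - 1)" if "x \<ge> 0" for x :: real
    using that powr_mult_base[of x "p - 1"] by simp
  have "a * a powr (p - 1) + b * b powr (p - 1) \<le> a * (a + b) powr (p - 1) + b * (a + b) powr (p - 1)"
    using assms by (intro add_mono mult_left_mono powr_mono2) auto
  also have "\<dots> = (a + b) powr p" using assms by (simp add: e distrib_right)
  finally show ?thesis using assms by (simp add: e)
qed

text \<open>Convexity applied to x + y = \<theta> (x / \<theta>) + (1 - \<theta>) (y / (1 -
  \<theta>)), by way of the tangent at x + y. The coefficient of the main term x can be brought as
  close to 1 as desired, at the expense of that of the error y.\<close>

lemma powr_split: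
  fixes x y \<theta> :: real
  assumes p: "p > 1" and xy: "x \<ge> 0" "y \<ge> 0" and \<theta>: "0 < \<theta>" "\<theta> < 1"
  shows "(x + y) powr p \<le> \<theta> powr (1 - p) * x powr p + (1 - \<theta>) powr (1 - p) * y powr p"
proof (cases "x + y = 0")
  case True then show ?thesis using xy by (simp add: add_nonneg_eq_0_iff)
next
  case False
  define s where "s = x + y"
  have s: "s > 0" using False xy by (simp add: s_def)
  have t: "t powr p \<ge> s powr p + p * s powr (p - 1) * (t - s)" if "t \<ge> 0" for t
    using powr_tangent[OF p s that] by (cases "t = s") auto
  have e: "\<eta> * (z / \<eta>) powr p = \<eta> powr (1 - p) * z powr p" if "\<eta> > 0" "z \<ge> 0" for \<eta> z :: real
  proof -
    have "\<eta> powr (1 - p) = \<eta> / \<eta> powr p" using that by (simp add: powr_diff)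
    then show ?thesis using that by (simp add: powr_divide)
  qed
  have "s powr p = \<theta> * (s powr p + p * s powr (p - 1) * (x / \<theta> - s)) + (1 - \<theta>) * (s powr p + p * s powr (p - 1) * (y / (1 - \<theta>) - s))"
  proof -
    have "\<theta> * (x / \<theta> - s) + (1 - \<theta>) * (y / (1 - \<theta>) - s) = 0"
      using \<theta> by (simp add: right_diff_distrib s_def) (simp add: algebra_simps)
    then have "p * s powr (p - 1) * (\<theta> * (x / \<theta> - s) + (1 - \<theta>) * (y / (1 - \<theta>) - s)) = 0" by simp
    moreover have "\<theta> * (S + k * X) + (1 - \<theta>) * (S + k * Y) = S + k * (\<theta> * X + (1 - \<theta>) * Y)" for S k X Y :: real
      by (simp add: algebra_simps)
    ultimately show ?thesis by simp
  qed
  also have "\<dots> \<le> \<theta> * (x / \<theta>) powr p + (1 - \<theta>) * (y / (1 - \<theta>)) powr p"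
    using \<theta> xy by (intro add_mono mult_left_mono t) auto
  finally show ?thesis using \<theta> xy by (simp add: e s_def)
qed

section \<open>Averages along the orbits of the dilations\<close>

context radial_core begin

text \<open>Differentiation under the integral sign. The derivative of the integrand is packaged as
  a bounded linear function, whose joint continuity is checked on basis vectors.\<close>

lemma has_derivative_flow_average:
  fixes \<psi> :: "'a \<Rightarrow> real"
  assumes \<psi>: "Ck_on (Suc 0) UNIV \<psi>" and \<eta>: "continuous_on UNIV \<eta>"
  shows "((\<lambda>x. integral {0..1} (\<lambda>t. \<eta> t * \<psi> (flow t x))) has_derivative
     (\<lambda>v. integral {0..1} (\<lambda>t. \<eta> t * fderiv \<psi> (flow t x) (flow t v)))) (at x)"
proof -
  let ?D = "\<lambda>y. fderiv \<psi> y"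
  have d: "(\<psi> has_derivative ?D y) (at y)" for y by (rule Ck_on_has_derivative[OF \<psi> UNIV_I])
  have rep: "?D y w = (\<Sum>b\<in>Basis. (w \<bullet> b) * ?D y b)" for y w
    by (rule linear_expand[OF has_derivative_linear[OF d], unfolded real_scaleR_def])
  define fx where "fx x t = Blinfun (\<lambda>v. \<eta> t * ?D (flow t x) (flow t v))" for x t
  have fx: "blinfun_apply (fx x t) = (\<lambda>v. \<eta> t * ?D (flow t x) (flow t v))" for x t
    unfolding fx_def
    by (intro bounded_linear_Blinfun_apply bounded_linear_const_mult
        bounded_linear_compose[OF has_derivative_bounded_linear[OF d]] linear_imp_bounded[OF linear_flow])
  have c\<eta>: "continuous_on S (\<lambda>p. \<eta> (f p))" if "continuous_on S f" for S :: "'z::topological_space set" and f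
    by (rule continuous_on_compose2[OF \<eta> that]) simp
  have cD: "continuous_on S (\<lambda>p. ?D (f p) b)" if "continuous_on S f" for S :: "'z::topological_space set" and f b
  proof -
    have "continuous_on UNIV (\<lambda>x. ?D x b)" using \<psi> by simp
    then show ?thesis by (rule continuous_on_compose2[OF _ that]) simp
  qed
  have cfx: "continuous_on (UNIV \<times> cbox 0 1) (\<lambda>(x, t). fx x t)"
  proof (rule continuous_on_blinfun_componentwise)
    fix i :: 'a
    have "continuous_on (UNIV \<times> cbox 0 1) (\<lambda>p. \<eta> (snd p) * (\<Sum>b\<in>Basis. (flow (snd p) i \<bullet> b) * ?D (flow (snd p) (fst p)) b))"
      by (intro continuous_intros c\<eta> cD)
    then show "continuous_on (UNIV \<times> cbox 0 1) (\<lambda>p. blinfun_apply (case p of (x, t) \<Rightarrow> fx x t) i)"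
      by (simp only: rep[symmetric] case_prod_beta fx)
  qed
  have "((\<lambda>x. integral (cbox 0 1) (\<lambda>t. \<eta> t * \<psi> (flow t x))) has_derivative integral (cbox 0 1) (fx x)) (at x within UNIV)"
  proof (rule leibniz_rule[OF _ _ cfx])
    show "((\<lambda>x. \<eta> t * \<psi> (flow t x)) has_derivative blinfun_apply (fx x t)) (at x within UNIV)" for x t
      unfolding fx
      by (intro has_derivative_mult_right has_derivative_compose[OF _ d] bounded_linear_imp_has_derivative
          linear_imp_bounded[OF linear_flow])
    show "(\<lambda>t. \<eta> t * \<psi> (flow t x)) integrable_on cbox 0 1" for x
      by (intro integrable_continuous continuous_intros c\<eta> continuous_on_compose2[OF Ck_on_continuous[OF \<psi>]]) auto
  qed auto
  moreover have "fx x integrable_on cbox 0 1"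
  proof (rule integrable_continuous)
    show "continuous_on (cbox 0 1) (fx x)"
    proof -
      have "continuous_on (cbox 0 1) (\<lambda>t. (\<lambda>(x, t). fx x t) (x, t))"
        by (rule continuous_on_compose2[OF cfx]) (auto intro!: continuous_on_Pair continuous_on_const continuous_on_id)
      then show ?thesis by simp
    qed
  qed
  then have "blinfun_apply (integral (cbox 0 1) (fx x)) = (\<lambda>v. integral {0..1} (\<lambda>t. \<eta> t * ?D (flow t x) (flow t v)))"
    by (intro ext) (simp add: blinfun_apply_integral fx)
  ultimately show ?thesis by simp
qed

text \<open>Differentiation produces averages of partial derivatives of \<psi> in which the weight
  is multiplied by coordinates of \<open>flow t v\<close>. The induction therefore runs over all
  continuous weights, not only exponentials.\<close>

lemma Ck_on_flow_average:
  fixes \<psi> :: "'a \<Rightarrow> real"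
  assumes "Ck_on k UNIV \<psi>" "continuous_on UNIV \<eta>"
  shows "Ck_on k UNIV (\<lambda>x. integral {0..1} (\<lambda>t. \<eta> t * \<psi> (flow t x)))"
  using assms
proof (induction k arbitrary: \<psi> \<eta>)
  case 0
  have "continuous_on UNIV (\<lambda>x. integral (cbox 0 1) (\<lambda>t. \<eta> t * \<psi> (flow t x)))"
  proof (rule integral_continuous_on_param)
    show "continuous_on (UNIV \<times> cbox 0 1) (\<lambda>(x, t). \<eta> t * \<psi> (flow t x))"
      unfolding case_prod_beta
    proof (rule continuous_on_mult)
      show "continuous_on (UNIV \<times> cbox 0 1) (\<lambda>p. \<eta> (snd p))"
        by (rule continuous_on_compose2[OF 0(2)]) (auto intro: continuous_intros)
      have "continuous_on UNIV \<psi>" using 0(1) by simp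
      then show "continuous_on (UNIV \<times> cbox 0 1) (\<lambda>p. \<psi> (flow (snd p) (fst p)))"
        by (rule continuous_on_compose2) (auto intro!: continuous_intros)
    qed
  qed
  then show ?case by simp
next
  case (Suc k)
  let ?D = "\<lambda>b y. fderiv \<psi> y b"
  have C1: "Ck_on (Suc 0) UNIV \<psi>" using Suc.prems(1) by (rule Ck_on_le) simp
  show ?case
  proof (rule Ck_on_SucI[OF open_UNIV has_derivative_flow_average[OF C1 Suc.prems(2)]])
    fix v
    have l: "linear (fderiv \<psi> y)" for y
      by (rule has_derivative_linear[OF Ck_on_has_derivative[OF C1 UNIV_I]])
    have rep: "?D w y = (\<Sum>b\<in>Basis. (w \<bullet> b) * ?D b y)" for y w
      by (rule linear_expand[OF l, unfolded real_scaleR_def])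
    have Dk: "Ck_on k UNIV (?D b)" for b by (rule Ck_on_frechet[OF Suc.prems(1)])
    have \<eta>': "continuous_on UNIV (\<lambda>t. \<eta> t * (flow t v \<bullet> b))" for b
      by (intro continuous_intros Suc.prems(2))
    have "integral {0..1} (\<lambda>t. \<eta> t * ?D (flow t v) (flow t x)) =
        (\<Sum>b\<in>Basis. integral {0..1} (\<lambda>t. (\<eta> t * (flow t v \<bullet> b)) * ?D b (flow t x)))" for x
    proof -
      have "integral {0..1} (\<lambda>t. \<eta> t * ?D (flow t v) (flow t x)) = integral {0..1} (\<lambda>t. \<Sum>b\<in>Basis. (\<eta> t * (flow t v \<bullet> b)) * ?D b (flow t x))"
        by (subst rep) (simp add: sum_distrib_left mult.assoc)
      also have "\<dots> = (\<Sum>b\<in>Basis. integral {0..1} (\<lambda>t. (\<eta> t * (flow t v \<bullet> b)) * ?D b (flow t x)))"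
      proof (rule integral_sum)
        fix b
        show "(\<lambda>t. (\<eta> t * (flow t v \<bullet> b)) * ?D b (flow t x)) integrable_on {0..1}"
          by (intro integrable_continuous_real continuous_on_mult continuous_on_subset[OF \<eta>'] subset_UNIV
              continuous_on_compose2[OF Ck_on_continuous[OF Dk]] continuous_intros)
      qed simp
      finally show ?thesis .
    qed
    then show "Ck_on k UNIV (\<lambda>x. integral {0..1} (\<lambda>t. \<eta> t * ?D (flow t v) (flow t x)))"
      by (simp only:) (intro Ck_on_sum[OF open_UNIV] Suc.IH[OF Dk \<eta>'])
  qed
qed

lemma punctured_flow_average:
  fixes \<psi> :: "'a \<Rightarrow> real" and \<eta> :: "real \<Rightarrow> real"
  assumes "punctured \<psi>"
  shows "punctured (\<lambda>x. integral {0..1} (\<lambda>t. \<eta> t * \<psi> (flow t x)))"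
proof -
  obtain K where K: "compact K" "0 \<notin> K" "\<And>x. x \<notin> K \<Longrightarrow> \<psi> x = 0" using assms unfolding punctured_def by metis
  obtain K' where K': "compact K'" "0 \<notin> K'" "\<And>t x. t \<in> {0..1} \<Longrightarrow> flow t x \<in> K \<Longrightarrow> x \<in> K'"
    using compact_flow_backward[OF K(1,2)] by blast
  have "integral {0..1} (\<lambda>t. \<eta> t * \<psi> (flow t x)) = 0" if "x \<notin> K'" for x
  proof -
    have "\<psi> (flow t x) = 0" if "t \<in> {0..1}" for t
      using K(3) K'(3) that \<open>x \<notin> K'\<close> by blast
    then have "((\<lambda>t. \<eta> t * \<psi> (flow t x)) has_integral 0) {0..1}"
      by (intro has_integral_is_0) auto
    then show ?thesis by (rule integral_unique)
  qed
  then show ?thesis unfolding punctured_def using K' by blast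
qed

text \<open>Averaging along the flow with weight \<open>e\<^bsup>\<alpha>t\<^esup>\<close> gives almost eigenfunctions of \<open>T\<close>
  for the critical eigenvalue \<open>- \<alpha>\<close>.\<close>

lemma T_flow_average:
  fixes \<psi> :: "'a \<Rightarrow> real" and \<alpha> :: real
  assumes \<psi>: "Ck_on (Suc 0) UNIV \<psi>"
  defines "G \<equiv> \<lambda>x. integral {0..1} (\<lambda>t. exp (\<alpha> * t) * \<psi> (flow t x))"
  shows "T G x = - \<alpha> * G x + exp \<alpha> * \<psi> (flow 1 x) - \<psi> x"
proof -
  have c: "continuous_on UNIV (\<lambda>t. exp (\<alpha> * t))" by (intro continuous_intros)
  have "fderiv G x = (\<lambda>v. integral {0..1} (\<lambda>t. exp (\<alpha> * t) * fderiv \<psi> (flow t x) (flow t v)))"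
    unfolding G_def by (rule frechet_derivative_at[symmetric, OF has_derivative_flow_average[OF \<psi> c]])
  then have TG: "T G x = integral {0..1} (\<lambda>t. exp (\<alpha> * t) * T \<psi> (flow t x))"
    by (simp add: T_def flow_A)
  have "((\<lambda>t. exp (\<alpha> * t) * T \<psi> (flow t x) + \<alpha> * (exp (\<alpha> * t) * \<psi> (flow t x))) has_integral
      exp (\<alpha> * 1) * \<psi> (flow 1 x) - exp (\<alpha> * 0) * \<psi> (flow 0 x)) {0..1}"
  proof (rule fundamental_theorem_of_calculus)
    fix t :: real
    have "((\<lambda>t. exp (\<alpha> * t) * \<psi> (flow t x)) has_real_derivative exp (\<alpha> * t) * T \<psi> (flow t x) + \<alpha> * (exp (\<alpha> * t) * \<psi> (flow t x))) (at t)"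
      by (rule DERIV_cong[OF DERIV_mult[OF _ T_flow[OF \<psi>, unfolded real_vector_derivative[symmetric]]]])
         (auto intro!: derivative_eq_intros)
    then show "((\<lambda>t. exp (\<alpha> * t) * \<psi> (flow t x)) has_vector_derivative exp (\<alpha> * t) * T \<psi> (flow t x) + \<alpha> * (exp (\<alpha> * t) * \<psi> (flow t x))) (at t within {0..1})"
      by (simp add: real_vector_derivative has_vector_derivative_at_within)
  qed simp
  moreover have i1: "(\<lambda>t. exp (\<alpha> * t) * T \<psi> (flow t x)) integrable_on {0..1}"
    by (intro integrable_continuous_real continuous_intros continuous_on_compose2[OF continuous_T[OF \<psi>]]) auto
  moreover have i2: "(\<lambda>t. exp (\<alpha> * t) * \<psi> (flow t x)) integrable_on {0..1}"
    by (intro integrable_continuous_real continuous_intros continuous_on_compose2[OF continuous_F[OF \<psi>]]) auto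
  ultimately have "integral {0..1} (\<lambda>t. exp (\<alpha> * t) * T \<psi> (flow t x)) + \<alpha> * integral {0..1} (\<lambda>t. exp (\<alpha> * t) * \<psi> (flow t x))
      = exp \<alpha> * \<psi> (flow 1 x) - \<psi> x"
    using has_integral_add[OF integrable_integral[OF i1] has_integral_mult_right[OF integrable_integral[OF i2], of \<alpha>]]
    by (auto dest: has_integral_unique)
  then show ?thesis unfolding TG by (simp add: G_def)
qed

text \<open>The exponent makes \<open>scaled p j\<close>, the dilation by \<open>e\<^sup>j\<close>, an isometry of \<open>\<parallel>g/|x|\<parallel>\<close> in \<open>L\<^sup>p\<close>.\<close>

definition scaled :: "real \<Rightarrow> real \<Rightarrow> ('a \<Rightarrow> real) \<Rightarrow> 'a \<Rightarrow> real" where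
  "scaled p j g x = exp ((Q - p) / p * j) * g (flow j x)"

text \<open>This is the p-th power of the L^p norm of g / |x|; no root is taken, so that
  contributions can be added.\<close>

abbreviation weighted_norm :: "real \<Rightarrow> ('a \<Rightarrow> real) \<Rightarrow> real" where
  "weighted_norm p g \<equiv> LINT x|lborel. norm (g x) powr p * n x powr - p"

lemma smooth_scaled: "smooth_on UNIV g \<Longrightarrow> smooth_on UNIV (scaled p j g)"
  unfolding scaled_def[abs_def] real_scaleR_def[symmetric]
  by (intro smooth_on_scaleR smooth_on_const smooth_on_compose[OF _ _ linear_imp_smooth_on] linear_imp_bounded linear_flow) auto

lemma punctured_scaled: "punctured g \<Longrightarrow> punctured (scaled p j g)"
  by (rule punctured_subset[OF punctured_flow]) (auto simp: scaled_def)

lemma T_scaled: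
  assumes "smooth_on UNIV g"
  shows "T (scaled p j g) x = scaled p j (T g) x"
proof -
  have "(scaled p j g has_derivative (\<lambda>v. exp ((Q - p) / p * j) * fderiv g (flow j x) (flow j v))) (at x)"
    unfolding scaled_def[abs_def]
    by (intro has_derivative_mult_right has_derivative_compose[OF _ smooth_on_has_derivative[OF assms UNIV_I]] bounded_linear_imp_has_derivative
        linear_imp_bounded linear_flow)
  from frechet_derivative_at[OF this] show ?thesis by (metis T_def flow_A scaled_def)
qed

lemma weighted_integrable:
  assumes "punctured g" "continuous_on UNIV g" "p > 0"
  shows "integrable lborel (\<lambda>x. norm (g x :: real) powr p * n x powr - p)"
proof (rule punctured_weight)
  show "punctured (\<lambda>x. norm (g x) powr p)" by (rule punctured_subset[OF assms(1)]) simp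
  show "continuous_on UNIV (\<lambda>x. norm (g x) powr p)" by (rule continuous_norm_powr[OF assms(2,3)])
qed

lemma weighted_norm_scaled:
  assumes g: "punctured g" "continuous_on UNIV g" and p: "p > 0"
  shows "weighted_norm p (scaled p j g) = weighted_norm p g"
proof -
  have e: "norm (scaled p j g x) powr p = exp ((Q - p) * j) * norm (g (flow j x)) powr p" for x
  proof -
    have "norm (scaled p j g x) powr p = exp ((Q - p) / p * j) powr p * norm (g (flow j x)) powr p"
      by (simp add: scaled_def abs_mult powr_mult)
    also have "exp ((Q - p) / p * j) powr p = exp ((Q - p) * j)" using p by (simp add: powr_def)
    finally show ?thesis .
  qed
  have "weighted_norm p (scaled p j g) = exp ((Q - p) * j) * (LINT x|lborel. norm (g (flow j x)) powr p * n x powr - p)"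
    unfolding e mult.assoc by (rule integral_mult_right_zero)
  also have "(LINT x|lborel. norm (g (flow j x)) powr p * n x powr - p) = exp ((p - Q) * j) * weighted_norm p g"
  proof (rule integral_weight_flow)
    show "punctured (\<lambda>x. norm (g x) powr p)" by (rule punctured_subset[OF g(1)]) simp
  qed (rule continuous_norm_powr[OF g(2) p])
  also have "exp ((Q - p) * j) * (exp ((p - Q) * j) * weighted_norm p g) = weighted_norm p g"
    unfolding mult.assoc[symmetric] exp_add[symmetric] by (simp add: algebra_simps)
  finally show ?thesis .
qed

text \<open>If C were below 1 / \<alpha>, the assumed inequality applied to \<open>F k\<close> would
  give X \<le> r X + B for its weighted norm X, with r < 1 and B independent of k. But X is at least
  k c, because \<open>F k\<close> consists of k nonnegative pieces of equal weighted norm c >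
  0.\<close>

lemma hardy_sharp:
  assumes p: "1 < p" "p < Q" and C: "C \<ge> 0"
    and hardy: "\<And>F :: 'a \<Rightarrow> real. smooth_on UNIV F \<Longrightarrow> punctured F \<Longrightarrow> weighted_norm p F \<le> C powr p * weighted_norm p (T F)"
  shows "p / (Q - p) \<le> C"
proof (rule ccontr)
  assume "\<not> p / (Q - p) \<le> C"
  define \<alpha> where "\<alpha> = (Q - p) / p"
  have \<alpha>: "\<alpha> > 0" using p by (simp add: \<alpha>_def)
  have C\<alpha>: "C * \<alpha> < 1" using \<open>\<not> p / (Q - p) \<le> C\<close> p by (simp add: \<alpha>_def field_simps)
  obtain x0 :: 'a where x0: "x0 \<noteq> 0" using nonempty_Basis nonzero_Basis by blast
  obtain \<psi> :: "'a \<Rightarrow> real" where \<psi>: "smooth_on UNIV \<psi>" "\<And>x. \<psi> x \<ge> 0" "\<psi> x0 > 0" "\<And>x. x \<notin> cball x0 (norm x0 / 2) \<Longrightarrow> \<psi> x = 0"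
    using smooth_bump[of "norm x0 / 2" x0] x0 by auto
  have p\<psi>: "punctured \<psi>" unfolding punctured_def
    using \<psi>(4) x0 by (intro exI[of _ "cball x0 (norm x0 / 2)"]) auto
  have C\<psi>: "Ck_on k UNIV \<psi>" for k using \<psi>(1) by (simp add: smooth_on_def)
  define G where "G x = integral {0..1} (\<lambda>t. exp (\<alpha> * t) * \<psi> (flow t x))" for x
  have c\<eta>: "continuous_on UNIV (\<lambda>t. exp (\<alpha> * t))" by (intro continuous_intros)
  have sG: "smooth_on UNIV G" unfolding smooth_on_def G_def[abs_def]
    by (intro allI Ck_on_flow_average C\<psi> c\<eta>)
  have pG: "punctured G" unfolding G_def[abs_def] by (rule punctured_flow_average[OF p\<psi>])
  have TG: "T G x = - \<alpha> * G x + exp \<alpha> * \<psi> (flow 1 x) - \<psi> x" for x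
    unfolding G_def[abs_def] by (rule T_flow_average[OF C\<psi>])
  have cG: "continuous_on UNIV G" and c\<psi>: "continuous_on UNIV \<psi>"
    using sG \<psi>(1) by (auto intro: smooth_on_continuous)
  have ci: "continuous_on {0..1} (\<lambda>t. exp (\<alpha> * t) * \<psi> (flow t x))" for x
    by (intro continuous_intros continuous_on_compose2[OF c\<psi>]) auto
  have G0: "G x \<ge> 0" for x unfolding G_def
    by (rule Henstock_Kurzweil_Integration.integral_nonneg[OF integrable_continuous_real[OF ci]]) (simp add: \<psi>(2))
  have Gx0: "G x0 > 0"
  proof (rule ccontr)
    assume "\<not> G x0 > 0"
    then have "integral {0..1} (\<lambda>t. exp (\<alpha> * t) * \<psi> (flow t x0)) = 0" using G0[of x0] by (simp add: G_def)
    then have "\<forall>t\<in>{0..1}. exp (\<alpha> * t) * \<psi> (flow t x0) = 0"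
      using integral_eq_0_iff[OF ci, of x0] \<psi>(2) by simp
    then have "\<psi> x0 = 0" by (metis atLeastAtMost_iff exp_not_eq_zero flow_0 mult_eq_0_iff order_refl zero_le_one)
    then show False using \<psi>(3) by simp
  qed
  define c where "c = weighted_norm p G"
  have c: "c > 0"
  proof (rule ccontr)
    assume "\<not> c > 0"
    moreover have "c \<ge> 0" unfolding c_def by (rule Bochner_Integration.integral_nonneg) simp
    ultimately have "c = 0" by simp
    have "norm (G x0) powr p * n x0 powr - p = 0"
    proof (rule continuous_nonneg_integral_0[where g = "\<lambda>x. norm (G x) powr p * n x powr - p"])
      show "continuous_on UNIV (\<lambda>x. norm (G x) powr p * n x powr - p)"
        by (rule punctured_weight(1)[OF punctured_subset[OF pG] continuous_norm_powr[OF cG]]) (use p in auto)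
      show "integrable lborel (\<lambda>x. norm (G x) powr p * n x powr - p)"
        by (rule weighted_integrable[OF pG cG]) (use p in simp)
      show "weighted_norm p G = 0" using \<open>c = 0\<close> by (simp only: c_def)
    qed simp
    then show False using Gx0 x0 by simp
  qed
  \<comment> \<open>\<open>F k\<close> is the average over times from 0 to k, cut into unit
    intervals. Each piece is a \<open>scaled\<close> copy of \<open>G\<close>, so all have the same
    weighted norm, and the boundary terms of \<open>T_flow_average\<close> telescope to
    \<open>b k\<close>.\<close>
  define F where "F k x = (\<Sum>j<k. scaled p (real j) G x)" for k :: nat and x
  define b where "b k x = scaled p (real k) \<psi> x - \<psi> x" for k :: nat and x
  have FS: "F (Suc k) = (\<lambda>x. F k x + scaled p (real k) G x)" for k by (auto simp: F_def)
  have sF: "smooth_on UNIV (F k)" for k unfolding F_def[abs_def]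
    by (intro smooth_on_sum open_UNIV smooth_scaled sG)
  have pF: "punctured (F k)" for k
  proof (induction k)
    case 0 then show ?case by (auto simp: F_def punctured_def intro: exI[of _ "{}"])
  next
    case (Suc k) show ?case unfolding FS by (rule punctured_subset2[OF Suc punctured_scaled[OF pG]]) simp
  qed
  have F0: "F k x \<ge> 0" for k x unfolding F_def scaled_def by (intro sum_nonneg) (simp add: G0)
  have TF: "T (F k) x = - \<alpha> * F k x + b k x" for k x
  proof (induction k)
    case 0 then show ?case by (simp add: F_def[abs_def] b_def T_def scaled_def frechet_derivative_const)
  next
    case (Suc k)
    have "T (F (Suc k)) x = T (F k) x + T (scaled p (real k) G) x"
      unfolding FS T_def
      by (subst frechet_derivative_at[symmetric, OF has_derivative_add[OF smooth_on_has_derivative[OF sF UNIV_I] smooth_on_has_derivative[OF smooth_scaled[OF sG] UNIV_I]]]) simp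
    also have "T (scaled p (real k) G) x = - \<alpha> * scaled p (real k) G x + scaled p (real (Suc k)) \<psi> x - scaled p (real k) \<psi> x"
      unfolding T_scaled[OF sG] unfolding scaled_def TG \<alpha>_def[symmetric]
      by (simp add: flow_add[symmetric] exp_add algebra_simps)
    finally show ?case using Suc by (simp add: FS b_def algebra_simps)
  qed
  have cF: "continuous_on UNIV (F k)" for k by (rule smooth_on_continuous[OF sF])
  have cs: "continuous_on UNIV (scaled p (real k) g)" if "smooth_on UNIV g" for k g
    by (rule smooth_on_continuous[OF smooth_scaled[OF that]])
  have wi: "integrable lborel (\<lambda>x. norm (g x) powr p * n x powr - p)" if "punctured g" "continuous_on UNIV g" for g :: "'a \<Rightarrow> real"
    using weighted_integrable[OF that] p by simp
  have lower: "real k * c \<le> weighted_norm p (F k)" for k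
  proof (induction k)
    case 0
    have "0 \<le> weighted_norm p (F 0)" by (rule Bochner_Integration.integral_nonneg) simp
    then show ?case by simp
  next
    case (Suc k)
    have "real (Suc k) * c \<le> weighted_norm p (F k) + weighted_norm p (scaled p (real k) G)"
      using Suc weighted_norm_scaled[OF pG cG, of p "real k"] p by (simp add: c_def algebra_simps)
    also have "\<dots> = (LINT x|lborel. norm (F k x) powr p * n x powr - p + norm (scaled p (real k) G x) powr p * n x powr - p)"
      by (intro Bochner_Integration.integral_add[symmetric] wi pF cF punctured_scaled pG cs sG)
    also have "\<dots> \<le> weighted_norm p (F (Suc k))"
    proof (rule integral_mono)
      fix x
      have "norm (F k x) powr p + norm (scaled p (real k) G x) powr p \<le> norm (F (Suc k) x) powr p"
        using powr_superadditive[of "F k x" "scaled p (real k) G x" p] F0[of k x] G0[of "flow (real k) x"] p by (simp add: FS scaled_def)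
      then show "norm (F k x) powr p * n x powr - p + norm (scaled p (real k) G x) powr p * n x powr - p \<le> norm (F (Suc k) x) powr p * n x powr - p"
        by (simp add: distrib_right[symmetric] mult_right_mono)
    qed (intro Bochner_Integration.integrable_add wi pF cF punctured_scaled pG cs sG)+
    finally show ?case .
  qed
  define K where "K = weighted_norm p \<psi>"
  have pb: "punctured (b k)" for k unfolding b_def
    by (rule punctured_subset2[OF punctured_scaled[OF p\<psi>] p\<psi>]) simp
  have cb: "continuous_on UNIV (b k)" for k unfolding b_def
    by (intro continuous_intros cs \<psi>(1) c\<psi>)
  have b_le: "weighted_norm p (b k) \<le> 2 * K" for k
  proof -
    have "weighted_norm p (b k) \<le> (LINT x|lborel. norm (scaled p (real k) \<psi> x) powr p * n x powr - p + norm (\<psi> x) powr p * n x powr - p)"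
    proof (rule integral_mono)
      fix x
      let ?s = "scaled p (real k) \<psi> x"
      have s: "?s \<ge> 0" "\<psi> x \<ge> 0" using \<psi>(2) by (simp_all add: scaled_def)
      \<comment> \<open>A difference of two nonnegative numbers is at most their maximum, so no
        factor depending on p arises.\<close>
      have "norm (b k x) powr p \<le> max ?s (\<psi> x) powr p"
        using s p by (intro powr_mono2) (auto simp: b_def)
      also have "\<dots> \<le> ?s powr p + \<psi> x powr p" by (simp add: max_def)
      finally have "norm (b k x) powr p \<le> norm ?s powr p + norm (\<psi> x) powr p" using s by simp
      then show "norm (b k x) powr p * n x powr - p \<le> norm ?s powr p * n x powr - p + norm (\<psi> x) powr p * n x powr - p"
        by (simp add: distrib_right[symmetric] mult_right_mono)
    qed (intro Bochner_Integration.integrable_add wi pb cb punctured_scaled p\<psi> cs \<psi>(1) c\<psi>)+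
    also have "\<dots> = weighted_norm p (scaled p (real k) \<psi>) + weighted_norm p \<psi>"
      by (intro Bochner_Integration.integral_add wi punctured_scaled p\<psi> cs \<psi>(1) c\<psi>)
    finally show ?thesis using weighted_norm_scaled[OF p\<psi> c\<psi>, of p "real k"] p by (simp add: K_def)
  qed
  define \<gamma> where "\<gamma> = (C * \<alpha>) powr p"
  have \<gamma>: "0 \<le> \<gamma>" "\<gamma> < 1"
    using C\<alpha> C \<alpha> p powr_less_mono2[of p "C * \<alpha>" 1] by (auto simp: \<gamma>_def)
  \<comment> \<open>\<theta> is chosen with \<theta>^(p-1) midway between \<gamma> and 1, so that
    \<gamma> \<theta>^(1-p) = 2 \<gamma> / (\<gamma> + 1) stays below 1.\<close>
  define \<theta> where "\<theta> = ((\<gamma> + 1) / 2) powr (1 / (p - 1))"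
  have \<theta>: "0 < \<theta>" "\<theta> < 1" "\<theta> powr (p - 1) = (\<gamma> + 1) / 2"
    using \<gamma> p powr_less_mono2[of "1 / (p - 1)" "(\<gamma> + 1) / 2" 1] by (auto simp: \<theta>_def powr_powr)
  have \<theta>': "\<gamma> * \<theta> powr (1 - p) < 1"
  proof -
    have "\<theta> powr (1 - p) = inverse (\<theta> powr (p - 1))" by (simp flip: powr_minus)
    then have e: "\<theta> powr (1 - p) = 2 / (\<gamma> + 1)" by (simp add: \<theta>(3))
    show ?thesis unfolding e using \<gamma> by (simp add: field_simps)
  qed
  define B where "B = C powr p * ((1 - \<theta>) powr (1 - p) * (2 * K))"
  \<comment> \<open>\<open>powr_split\<close> separates the eigenfunction part \<alpha>
    \<open>F k\<close> of \<open>T (F k)\<close> from the boundary part \<open>b k\<close>; the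
    constants C and \<alpha> then combine into \<gamma>.\<close>
  have upper: "weighted_norm p (F k) \<le> \<gamma> * \<theta> powr (1 - p) * weighted_norm p (F k) + B" for k
  proof -
    have "weighted_norm p (T (F k)) \<le> (LINT x|lborel. \<theta> powr (1 - p) * \<alpha> powr p * (norm (F k x) powr p * n x powr - p)
        + (1 - \<theta>) powr (1 - p) * (norm (b k x) powr p * n x powr - p))"
    proof (rule integral_mono)
      have Ck: "Ck_on (Suc 0) UNIV (F k)" using sF by (simp add: smooth_on_def)
      show "integrable lborel (\<lambda>x. norm (T (F k) x) powr p * n x powr - p)"
        by (intro wi punctured_T[OF Ck pF] continuous_T[OF Ck])
      fix x
      have "norm (T (F k) x) powr p \<le> (\<alpha> * F k x + norm (b k x)) powr p"
      proof (rule powr_mono2)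
        have "\<alpha> * F k x \<ge> 0" using F0[of k x] \<alpha> by simp
        then show "norm (T (F k) x) \<le> \<alpha> * F k x + norm (b k x)" unfolding TF by simp
      qed (use p in auto)
      also have "\<dots> \<le> \<theta> powr (1 - p) * (\<alpha> * F k x) powr p + (1 - \<theta>) powr (1 - p) * norm (b k x) powr p"
        using F0[of k x] \<alpha> by (intro powr_split p \<theta>) auto
      also have "(\<alpha> * F k x) powr p = \<alpha> powr p * norm (F k x) powr p" using F0[of k x] \<alpha> by (simp add: powr_mult)
      finally have "norm (T (F k) x) powr p * n x powr - p \<le> (\<theta> powr (1 - p) * (\<alpha> powr p * norm (F k x) powr p) + (1 - \<theta>) powr (1 - p) * norm (b k x) powr p) * n x powr - p"
        by (rule mult_right_mono) simp
      then show "norm (T (F k) x) powr p * n x powr - p \<le> \<theta> powr (1 - p) * \<alpha> powr p * (norm (F k x) powr p * n x powr - p)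
        + (1 - \<theta>) powr (1 - p) * (norm (b k x) powr p * n x powr - p)"
        by (simp only: distrib_right mult.assoc)
    qed (intro Bochner_Integration.integrable_add integrable_mult_right wi pF cF pb cb)
    also have "\<dots> = \<theta> powr (1 - p) * \<alpha> powr p * weighted_norm p (F k) + (1 - \<theta>) powr (1 - p) * weighted_norm p (b k)"
      by (subst Bochner_Integration.integral_add) (intro integrable_mult_right wi pF cF pb cb | simp)+
    also have "\<dots> \<le> \<theta> powr (1 - p) * \<alpha> powr p * weighted_norm p (F k) + (1 - \<theta>) powr (1 - p) * (2 * K)"
      by (intro add_left_mono mult_left_mono b_le) simp
    finally have "C powr p * weighted_norm p (T (F k)) \<le> C powr p * (\<theta> powr (1 - p) * \<alpha> powr p * weighted_norm p (F k) + (1 - \<theta>) powr (1 - p) * (2 * K))"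
      by (rule mult_left_mono) simp
    also have "\<dots> = C powr p * \<alpha> powr p * \<theta> powr (1 - p) * weighted_norm p (F k) + B"
      by (simp add: B_def distrib_left mult_ac)
    also have "C powr p * \<alpha> powr p = \<gamma>" using C \<alpha> by (simp add: \<gamma>_def powr_mult)
    finally show ?thesis using hardy[OF sF pF, of k] by linarith
  qed
  define \<delta> where "\<delta> = 1 - \<gamma> * \<theta> powr (1 - p)"
  have \<delta>: "\<delta> > 0" using \<theta>' by (simp add: \<delta>_def)
  have "real k * c * \<delta> \<le> B" for k
  proof -
    have "real k * c * \<delta> \<le> weighted_norm p (F k) * \<delta>" using lower[of k] \<delta> by (intro mult_right_mono) auto
    also have "\<dots> \<le> B" using upper[of k] by (simp add: \<delta>_def algebra_simps)
    finally show ?thesis .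
  qed
  moreover obtain k :: nat where "real k > B / (c * \<delta>)" using reals_Archimedean2 by blast
  then have "real k * c * \<delta> > B" using c \<delta> by (simp add: pos_divide_less_eq mult.assoc)
  ultimately show False by (meson not_less)
qed

end

section \<open>Hardy inequalities on homogeneous groups\<close>

lemma powr_le_iff: "a \<ge> 0 \<Longrightarrow> b \<ge> 0 \<Longrightarrow> q > 0 \<Longrightarrow> a powr q \<le> b powr q \<longleftrightarrow> a \<le> (b::real)"
  using powr_mono2[of q a b] powr_less_mono2[of q b a] by fastforce

lemma powr_eq_iff: "a \<ge> 0 \<Longrightarrow> b \<ge> 0 \<Longrightarrow> q > 0 \<Longrightarrow> a powr q = b powr q \<longleftrightarrow> a = (b::real)"
  using powr_le_iff[of a b q] powr_le_iff[of b a q] by linarith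

locale haar_homogeneous_group = homogeneous_group atlas \<kappa> A
  for atlas :: "('g::{topological_group_add, t2_space, second_countable_topology},
                 'e::euclidean_space) chart set"
    and \<kappa> :: "('g, 'e) chart" and A :: "'e \<Rightarrow> 'e" +
  fixes E :: "'e \<Rightarrow> 'g" and M :: "'g measure" and N :: "'g \<Rightarrow> real"
  assumes exponential: "exponential_map \<kappa> E" and diffeomorphism: "global_diffeomorphism atlas E"
    and haar: "haar_measure M" and quasi_norm: "homogeneous_quasi_norm A E N"
begin

sublocale coord: lie_group_exp atlas \<kappa> E
  by unfold_locales (fact identity_chart exponential diffeomorphism)+

sublocale dil: dilations A
  by (rule dilations.intro[OF linear_A diagonalisable_A positive_eigenvalues])

sublocale unimodular: unimodular_exp_coordinates coord.mult
proof
  show "Det (coord.L x) = 1" for x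
  proof (rule coord.Det_L[where d = dil.flow])
    show "lie_bracket atlas \<kappa> (dil.flow t x) (dil.flow t y) = dil.flow t (lie_bracket atlas \<kappa> x y)" for t x y
      unfolding dil.flow_def by (rule dilation_morphism[symmetric]) simp
  qed (auto simp: dil.linear_flow dil.flow_tendsto_0)
qed

lemma sets_M: "sets M = sets borel"
  using haar by (simp add: haar_measure_def)

lemma space_M: "space M = UNIV"
  using sets_eq_imp_space_eq[OF sets_M] by simp

lemma E_measurable: "E \<in> borel_measurable borel" and inv_E_measurable: "inv E \<in> borel_measurable borel"
  by (intro borel_measurable_continuous_onI coord.continuous_E coord.continuous_inv_E)+

lemma inv_E_measurable_M: "inv E \<in> measurable M borel"
  using inv_E_measurable measurable_cong_sets[OF sets_M refl] by blast

text \<open>Pulled back by the exponential map, \<open>M\<close> is a measure on the Lie algebra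
  invariant under the group law in coordinates, hence a multiple of Lebesgue measure by
  uniqueness.\<close>

lemma haar_exp:
  obtains c where "c > 0" "M = distr (density lborel (\<lambda>_. ennreal c)) borel E"
proof -
  let ?\<mu> = "distr M borel (inv E)"
  have em: "emeasure ?\<mu> B = emeasure M (inv E -` B)" if "B \<in> sets borel" for B
    by (subst emeasure_distr[OF inv_E_measurable_M that]) (simp add: space_M)
  have vB: "inv E -` B \<in> sets borel" if "B \<in> sets borel" for B
    using measurable_sets_borel[OF inv_E_measurable that] by simp
  have mm: "coord.mult x \<in> borel_measurable borel" for x
    by (rule borel_measurable_continuous_onI[OF smooth_on_continuous[OF coord.smooth_translation]])
  have inv: "distr ?\<mu> borel (coord.mult x) = ?\<mu>" for x
  proof (rule measure_eqI)
    fix B assume "B \<in> sets (distr ?\<mu> borel (coord.mult x))"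
    then have B: "B \<in> sets borel" by simp
    have mB: "coord.mult x -` B \<in> sets borel" using measurable_sets_borel[OF mm B] by simp
    have "emeasure (distr ?\<mu> borel (coord.mult x)) B = emeasure ?\<mu> (coord.mult x -` B)"
      by (subst emeasure_distr) (use mm B in auto)
    also have "\<dots> = emeasure M (inv E -` (coord.mult x -` B))" by (rule em[OF mB])
    \<comment> \<open>\<open>haar_measure\<close> states invariance for images of sets,
      \<open>distr\<close> uses preimages; the preimage under translation by \<open>E x\<close> is
      the image under translation by \<open>- E x\<close>.\<close>
    also have "inv E -` (coord.mult x -` B) = (+) (- E x) ` (inv E -` B)"
    proof (intro subset_antisym subsetI)
      fix y assume "y \<in> inv E -` (coord.mult x -` B)"
      then show "y \<in> (+) (- E x) ` (inv E -` B)"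
        by (intro image_eqI[of _ _ "E x + y"]) (auto simp: coord.mult_def add.assoc[symmetric])
    qed (auto simp: coord.mult_def add.assoc[symmetric])
    also have "emeasure M \<dots> = emeasure M (inv E -` B)"
      using haar vB[OF B] by (simp add: haar_measure_def)
    also have "\<dots> = emeasure ?\<mu> B" by (rule em[OF B, symmetric])
    finally show "emeasure (distr ?\<mu> borel (coord.mult x)) B = emeasure ?\<mu> B" .
  qed simp
  have fin: "emeasure ?\<mu> K < \<infinity>" if K: "compact K" for K
  proof -
    have "inv E -` K = E ` K" by (force simp: image_iff)
    moreover have "compact (E ` K)" by (rule compact_continuous_image[OF coord.continuous_E K])
    ultimately show ?thesis using haar em[of K] K by (simp add: haar_measure_def borel_compact)
  qed
  have nz: "emeasure ?\<mu> UNIV \<noteq> 0" using haar em[of UNIV] by (simp add: haar_measure_def)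
  obtain c where c: "c > 0" "?\<mu> = density lborel (\<lambda>_. ennreal c)"
    using unimodular.left_invariant_eq_scaled_lborel[OF _ inv fin nz] by auto
  have "distr ?\<mu> borel E = distr M M (\<lambda>x. x)"
    unfolding distr_distr[OF E_measurable inv_E_measurable_M] by (rule distr_cong) (auto simp: sets_M)
  then have "M = distr (density lborel (\<lambda>_. ennreal c)) borel E" by (simp add: distr_id c(2))
  then show ?thesis using that c(1) by blast
qed

lemma continuous_E_borel:
  assumes "continuous_on UNIV (\<lambda>X. g (E X))"
  shows "g \<in> borel_measurable borel"
proof -
  have "continuous_on UNIV (\<lambda>x. g (E (inv E x)))"
    by (rule continuous_on_compose2[OF assms coord.continuous_inv_E]) simp
  then show ?thesis by (simp add: borel_measurable_continuous_onI)
qed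

text \<open>The normalisation of \<open>M\<close> against Lebesgue measure, fixed once. It
  multiplies every integral and so cancels from all inequalities.\<close>

definition exp_density :: real where
  "exp_density = (SOME c. c > 0 \<and> M = distr (density lborel (\<lambda>_. ennreal c)) borel E)"

lemma exp_density: "exp_density > 0" "M = distr (density lborel (\<lambda>_. ennreal exp_density)) borel E"
  using haar_exp someI_ex[of "\<lambda>c. c > 0 \<and> M = distr (density lborel (\<lambda>_. ennreal c)) borel E"]
  unfolding exp_density_def by metis+

lemma
  fixes g :: "'g \<Rightarrow> real"
  assumes g: "continuous_on UNIV (\<lambda>X. g (E X))"
  shows integrable_E: "integrable lborel (\<lambda>X. g (E X)) \<Longrightarrow> integrable M g"
    and integral_E: "(LINT x|M. g x) = exp_density * (LINT X|lborel. g (E X))"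
proof -
  have Em: "E \<in> measurable (density lborel (\<lambda>_. ennreal exp_density)) borel" using E_measurable by simp
  have gm: "(\<lambda>X. g (E X)) \<in> borel_measurable lborel" using borel_measurable_continuous_onI[OF g] by simp
  note c = exp_density(1)
  show "integrable M g" if "integrable lborel (\<lambda>X. g (E X))"
    by (subst exp_density(2)) (use that c gm in \<open>simp add: integrable_distr_eq[OF Em continuous_E_borel[OF g]] integrable_density\<close>)
  show "(LINT x|M. g x) = exp_density * (LINT X|lborel. g (E X))"
    by (subst exp_density(2)) (use c gm in \<open>simp add: integral_distr[OF Em continuous_E_borel[OF g]] integral_density\<close>)
qed

lemma group_dilation_E: "r > 0 \<Longrightarrow> group_dilation A E r (E X) = E (dil.flow (ln r) X)"
  by (simp add: group_dilation_def dil.algebra_dilation_eq_flow)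

abbreviation Q where "Q \<equiv> homogeneous_dimension A"

sublocale core: radial_core A "\<lambda>X. N (E X)"
proof
  show "continuous_on S (\<lambda>X. N (E X))" for S
    using quasi_norm by (auto simp: homogeneous_quasi_norm_def intro: continuous_on_compose2[OF _ coord.continuous_E])
  show "N (E X) \<ge> 0" for X using quasi_norm by (simp add: homogeneous_quasi_norm_def)
  show "N (E X) = 0 \<longleftrightarrow> X = 0" for X using quasi_norm by (simp add: homogeneous_quasi_norm_def)
  show "N (E (dil.flow t X)) = exp t * N (E X)" for t X
  proof -
    have "N (group_dilation A E (exp t) (E X)) = exp t * N (E X)"
      using quasi_norm unfolding homogeneous_quasi_norm_def by (meson exp_gt_zero)
    then show ?thesis by (simp add: group_dilation_E)
  qed
qed

text \<open>The radius r is exp t along an orbit, so the chain rule for ln turns the derivative in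
  t, which is \<open>T\<close>, into the derivative in r with a factor 1 / |x|.\<close>

lemma radial_derivative_E:
  fixes f :: "'g \<Rightarrow> 'b::euclidean_space"
  assumes F: "Ck_on (Suc 0) UNIV (\<lambda>X. f (E X))"
  shows "radial_derivative A E N f (E X) = core.T (\<lambda>X. f (E X)) X /\<^sub>R N (E X)"
proof (cases "X = 0")
  \<comment> \<open>At the origin the curve is constant, so the left side is 0; the right side is 0
    by division by zero.\<close>
  case True
  have "((\<lambda>Y. c *\<^sub>R A Y) ^^ k) 0 = 0" for c k
    by (induction k) (auto simp: linear_0[OF linear_A])
  then have "group_dilation A E r 0 = 0" for r
    by (simp add: group_dilation_def algebra_dilation_def)
  then show ?thesis using True core.n_0 by (simp add: radial_derivative_def)
next
  case False
  define \<rho> where "\<rho> = N (E X)"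
  have \<rho>: "\<rho> > 0" using False by (simp add: \<rho>_def)
  define Y where "Y = dil.flow (- ln \<rho>) X"
  have Y: "group_dilation A E (1 / \<rho>) (E X) = E Y" "dil.flow (ln \<rho>) Y = X"
    using \<rho> by (simp_all add: group_dilation_E Y_def ln_div)
  have "((\<lambda>t. f (E (dil.flow t Y))) has_vector_derivative core.T (\<lambda>X. f (E X)) (dil.flow (ln \<rho>) Y)) (at (ln \<rho>))"
    by (rule core.T_flow[OF F])
  moreover have "(ln has_vector_derivative 1 / \<rho>) (at \<rho>)"
    using \<rho> DERIV_ln_divide by (simp add: real_vector_derivative)
  ultimately have "((\<lambda>r. f (E (dil.flow (ln r) Y))) has_vector_derivative (1 / \<rho>) *\<^sub>R core.T (\<lambda>X. f (E X)) X) (at \<rho>)"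
    using vector_diff_chain_at[of ln "1 / \<rho>" \<rho> "\<lambda>t. f (E (dil.flow t Y))"] by (simp add: o_def Y(2))
  then have "((\<lambda>r. f (group_dilation A E r (E Y))) has_vector_derivative (1 / \<rho>) *\<^sub>R core.T (\<lambda>X. f (E X)) X) (at \<rho>)"
    by (rule has_vector_derivative_transform_within_open[where S = "{0<..}"]) (use \<rho> in \<open>auto simp: group_dilation_E\<close>)
  then show ?thesis
    by (simp add: radial_derivative_def \<rho>_def[symmetric] Y(1) vector_derivative_at inverse_eq_divide)
qed

lemma test_function_E:
  assumes f: "test_function atlas f"
  shows "smooth_on UNIV (\<lambda>X. f (E X))" "punctured (\<lambda>X. f (E X))"
proof -
  show "smooth_on UNIV (\<lambda>X. f (E X))" using f coord.smooth_fun_E by (auto simp: test_function_def)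
  let ?K = "closure {x. f x \<noteq> 0}"
  have K: "compact ?K" "0 \<notin> ?K" using f by (auto simp: test_function_def)
  show "punctured (\<lambda>X. f (E X))" unfolding punctured_def
  proof (intro exI[of _ "inv E ` ?K"] conjI allI impI)
    show "compact (inv E ` ?K)" by (rule compact_continuous_image[OF coord.continuous_inv_E K(1)])
    show "0 \<notin> inv E ` ?K" using K(2) by (metis coord.E_inv coord.E_zero imageE)
    show "f (E X) = 0" if "X \<notin> inv E ` ?K" for X
    proof -
      have "E X \<notin> ?K" using that by (metis coord.inv_E imageI)
      then show ?thesis using closure_subset[of "{x. f x \<noteq> 0}"] by auto
    qed
  qed
qed

lemma test_function_inv_E:
  fixes F :: "'e \<Rightarrow> 'b::euclidean_space"
  assumes "smooth_on UNIV F" "punctured F"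
  shows "test_function atlas (\<lambda>x. F (inv E x))"
proof -
  obtain K where K: "compact K" "0 \<notin> K" "\<And>X. X \<notin> K \<Longrightarrow> F X = 0" using assms(2) unfolding punctured_def by metis
  have EK: "compact (E ` K)" by (rule compact_continuous_image[OF coord.continuous_E K(1)])
  have "{x. F (inv E x) \<noteq> 0} \<subseteq> E ` K" using K(3) by (metis (mono_tags, lifting) coord.E_inv imageI mem_Collect_eq subsetI)
  then have sub: "closure {x. F (inv E x) \<noteq> 0} \<subseteq> E ` K"
    by (rule closure_minimal) (rule compact_imp_closed[OF EK])
  have "0 \<notin> E ` K" using K(2) by (metis coord.E_zero_iff imageE)
  moreover have "compact (closure {x. F (inv E x) \<noteq> 0})"
    using closed_Int_compact[OF closed_closure EK, of "{x. F (inv E x) \<noteq> 0}"] sub by (simp add: Int_absorb2)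
  ultimately show ?thesis unfolding test_function_def
    using coord.smooth_fun_inv_E[OF assms(1)] sub by auto
qed

context
  fixes f :: "'g \<Rightarrow> 'b::euclidean_space" and p :: real
  assumes f: "test_function atlas f" and p: "1 < p" "p < Q"
begin

abbreviation F where "F \<equiv> \<lambda>X. f (E X)"
abbreviation u where "u \<equiv> \<lambda>X. - (p / (Q - p)) *\<^sub>R (core.T F X /\<^sub>R N (E X))"
abbreviation v where "v \<equiv> \<lambda>X. F X /\<^sub>R N (E X)"

lemma Ck_F: "Ck_on k UNIV F"
  using test_function_E(1)[OF f] by (simp add: smooth_on_def)

lemmas punctured_F = test_function_E(2)[OF f]

lemmas radial_F = radial_derivative_E[OF Ck_F]

lemmas cont_uv = core.continuous_uv[OF Ck_F punctured_F p(1) p(2) refl refl]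

lemma continuous_radial: "continuous_on UNIV (\<lambda>X. radial_derivative A E N f (E X))"
    "punctured (\<lambda>X. radial_derivative A E N f (E X))"
proof -
  have e: "(\<lambda>X. radial_derivative A E N f (E X)) = (\<lambda>X. - ((Q - p) / p) *\<^sub>R u X)"
  proof -
    have k: "- ((Q - p) / p) * - (p / (Q - p)) = 1" using p by (simp add: field_simps)
    show ?thesis
      by (rule ext) (simp only: radial_F scaleR_scaleR[of "- ((Q - p) / p)" "- (p / (Q - p))"] k scaleR_one)
  qed
  show "continuous_on UNIV (\<lambda>X. radial_derivative A E N f (E X))"
    unfolding e by (intro continuous_on_scaleR continuous_on_const cont_uv(1))
  show "punctured (\<lambda>X. radial_derivative A E N f (E X))"
    unfolding e by (rule punctured_subset[OF cont_uv(3)]) (simp only: scaleR_zero_right)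
qed

end

lemma in_Lp_E:
  fixes g :: "'g \<Rightarrow> 'b::euclidean_space"
  assumes g: "continuous_on UNIV (\<lambda>X. g (E X))" "punctured (\<lambda>X. g (E X))" and p: "p > 0"
  shows "in_Lp p M g"
proof -
  have c: "continuous_on UNIV (\<lambda>X. norm (g (E X)) powr p)" by (rule continuous_norm_powr[OF g(1) p])
  have "integrable M (\<lambda>x. norm (g x) powr p)"
    by (rule integrable_E[OF c punctured_integrable[OF punctured_subset[OF g(2)] c]]) simp
  moreover have "g \<in> borel_measurable M"
    using continuous_E_borel[OF g(1)] measurable_cong_sets[OF sets_M refl] by blast
  ultimately show ?thesis by (simp add: in_Lp_def)
qed

lemma Lp_norm_powr:
  assumes "p > 0"
  shows "Lp_norm p M g powr p = (LINT x|M. norm (g x) powr p)"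
  using assms by (simp add: Lp_norm_def powr_powr)

lemma Lp_norm_scale:
  assumes "k \<ge> 0" "p > 0"
  shows "k * Lp_norm p M g = (k powr p * (LINT x|M. norm (g x) powr p)) powr (1 / p)"
  using assms by (simp add: Lp_norm_def powr_mult powr_powr)

lemma Lp_norm_le_scale_iff:
  assumes "k \<ge> 0" "p > 0"
  shows "Lp_norm p M f \<le> k * Lp_norm p M g \<longleftrightarrow>
    (LINT x|M. norm (f x) powr p) \<le> k powr p * (LINT x|M. norm (g x) powr p)"
  unfolding Lp_norm_scale[OF assms] unfolding Lp_norm_def
  by (rule powr_le_iff) (use assms in simp_all)

lemma Lp_norm_eq_scale_iff:
  assumes "k \<ge> 0" "p > 0"
  shows "Lp_norm p M f = k * Lp_norm p M g \<longleftrightarrow>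
    (LINT x|M. norm (f x) powr p) = k powr p * (LINT x|M. norm (g x) powr p)"
  unfolding Lp_norm_scale[OF assms] unfolding Lp_norm_def
  by (rule powr_eq_iff) (use assms in simp_all)

context
  fixes f :: "'g \<Rightarrow> 'b::euclidean_space" and p :: real
  assumes f: "test_function atlas f" and p: "1 < p" "p < Q"
begin

lemma f_Lp: "in_Lp p M (\<lambda>x. f x /\<^sub>R N x)"
  using cont_uv[OF f p] p by (intro in_Lp_E) auto

lemma radial_Lp: "in_Lp p M (radial_derivative A E N f)"
  using continuous_radial[OF f p] p by (intro in_Lp_E) auto

lemma norm_u: "norm (u f p X) powr p = (p / (Q - p)) powr p * norm (radial_derivative A E N f (E X)) powr p"
proof -
  have "norm (u f p X) = p / (Q - p) * norm (radial_derivative A E N f (E X))"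
    unfolding radial_F[OF f p] norm_scaleR[of "- (p / (Q - p))"] using p by simp
  then show ?thesis by (simp only:) (rule powr_mult; use p in simp)
qed

lemma radial_hardy:
  "Lp_norm p M (\<lambda>x. f x /\<^sub>R N x) \<le> p / (Q - p) * Lp_norm p M (radial_derivative A E N f)"
  "Lp_norm p M (\<lambda>x. f x /\<^sub>R N x) = p / (Q - p) * Lp_norm p M (radial_derivative A E N f) \<longleftrightarrow> f = (\<lambda>x. 0)"
proof -
  have k: "p / (Q - p) \<ge> 0" "p > 0" using p by auto
  have V: "(LINT x|M. norm (f x /\<^sub>R N x) powr p) = exp_density * (LINT X|lborel. norm (v f X) powr p)"
    by (rule integral_E) (use cont_uv(2)[OF f p] p in \<open>intro continuous_norm_powr, auto\<close>)
  have "(LINT x|M. norm (radial_derivative A E N f x) powr p) = exp_density * (LINT X|lborel. norm (radial_derivative A E N f (E X)) powr p)"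
    by (rule integral_E) (use continuous_radial(1)[OF f p] p in \<open>intro continuous_norm_powr, auto\<close>)
  then have U: "(p / (Q - p)) powr p * (LINT x|M. norm (radial_derivative A E N f x) powr p) = exp_density * (LINT X|lborel. norm (u f p X) powr p)"
    unfolding norm_u by simp
  note hyps = Ck_F[OF f p] punctured_F[OF f p] p refl refl
  show "Lp_norm p M (\<lambda>x. f x /\<^sub>R N x) \<le> p / (Q - p) * Lp_norm p M (radial_derivative A E N f)"
    unfolding Lp_norm_le_scale_iff[OF k] V U using core.hardy_le[OF hyps] exp_density(1) by simp
  show "Lp_norm p M (\<lambda>x. f x /\<^sub>R N x) = p / (Q - p) * Lp_norm p M (radial_derivative A E N f) \<longleftrightarrow> f = (\<lambda>x. 0)"
    unfolding Lp_norm_eq_scale_iff[OF k] V U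
  proof
    assume "exp_density * (LINT X|lborel. norm (v f X) powr p) = exp_density * (LINT X|lborel. norm (u f p X) powr p)"
    then have "(LINT X|lborel. norm (v f X) powr p) = (LINT X|lborel. norm (u f p X) powr p)" using exp_density(1) by simp
    from core.hardy_eq[OF hyps this] have "f (E X) = 0" for X .
    then show "f = (\<lambda>x. 0)" by (metis coord.E_inv)
  qed (simp add: core.T_def frechet_derivative_const)
qed

end

text \<open>Real near-extremals are regarded as complex-valued functions. Replacing C by the larger
  \<open>max C 0\<close> supplies the nonnegativity asked for by \<open>hardy_sharp\<close> and
  loses nothing, as p / (Q - p) is positive.\<close>

lemma radial_hardy_sharp:
  assumes p: "1 < p" "p < Q"
    and C: "\<And>f :: 'g \<Rightarrow> complex. test_function atlas f \<Longrightarrow>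
      Lp_norm p M (\<lambda>x. f x /\<^sub>R N x) \<le> C * Lp_norm p M (radial_derivative A E N f)"
  shows "p / (Q - p) \<le> C"
proof -
  have k: "max C 0 \<ge> 0" "p > 0" using p by auto
  have "p / (Q - p) \<le> max C 0"
  proof (rule core.hardy_sharp[OF p])
    fix F :: "'e \<Rightarrow> real"
    assume F: "smooth_on UNIV F" "punctured F"
    define f where "f x = complex_of_real (F (inv E x))" for x
    have f: "test_function atlas f" unfolding f_def
    proof (rule test_function_inv_E)
      show "smooth_on UNIV (\<lambda>X. complex_of_real (F X))"
        by (rule smooth_on_bounded_linear[OF bounded_linear_of_real open_UNIV F(1)])
      show "punctured (\<lambda>X. complex_of_real (F X))" by (rule punctured_subset[OF F(2)]) simp
    qed
    have fE: "(\<lambda>X. f (E X)) = (\<lambda>X. complex_of_real (F X))" by (simp add: f_def)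
    have Tf: "core.T (\<lambda>X. f (E X)) X = complex_of_real (core.T F X)" for X
    proof -
      have "((\<lambda>X. complex_of_real (F X)) has_derivative (\<lambda>v. complex_of_real (fderiv F X v))) (at X)"
        by (rule bounded_linear.has_derivative[OF bounded_linear_of_real smooth_on_has_derivative[OF F(1) UNIV_I]])
      from frechet_derivative_at[OF this] show ?thesis unfolding fE core.T_def by metis
    qed
    have "Lp_norm p M (\<lambda>x. f x /\<^sub>R N x) \<le> max C 0 * Lp_norm p M (radial_derivative A E N f)"
      using C[OF f] mult_right_mono[of C "max C 0" "Lp_norm p M (radial_derivative A E N f)"] by (simp add: Lp_norm_def)
    then have "(LINT x|M. norm (f x /\<^sub>R N x) powr p) \<le> max C 0 powr p * (LINT x|M. norm (radial_derivative A E N f x) powr p)"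
      unfolding Lp_norm_le_scale_iff[OF k] .
    moreover have "(LINT x|M. norm (f x /\<^sub>R N x) powr p) = exp_density * (LINT X|lborel. norm (v f X) powr p)"
      by (rule integral_E) (use cont_uv(2)[OF f p] p in \<open>intro continuous_norm_powr, auto\<close>)
    moreover have "norm (v f X) powr p = norm (F X) powr p * N (E X) powr - p" for X
      unfolding core.norm_scaled_powr by (simp add: f_def)
    moreover have "(LINT x|M. norm (radial_derivative A E N f x) powr p) = exp_density * (LINT X|lborel. norm (radial_derivative A E N f (E X)) powr p)"
      by (rule integral_E) (use continuous_radial(1)[OF f p] p in \<open>intro continuous_norm_powr, auto\<close>)
    moreover have "norm (radial_derivative A E N f (E X)) powr p = norm (core.T F X) powr p * N (E X) powr - p" for X
      unfolding radial_F[OF f p] core.norm_scaled_powr Tf by simp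
    ultimately have "exp_density * core.weighted_norm p F \<le> exp_density * (max C 0 powr p * core.weighted_norm p (core.T F))"
      by (simp add: mult.left_commute)
    then show "core.weighted_norm p F \<le> max C 0 powr p * core.weighted_norm p (core.T F)"
      using exp_density(1) by simp
  qed simp
  moreover have "p / (Q - p) > 0" using p by simp
  ultimately show ?thesis by linarith
qed

lemma real_remainder:
  fixes f u' v' :: "'g \<Rightarrow> real"
  assumes p: "1 < p" "p < Q" and f: "test_function atlas f"
    and u': "u' = (\<lambda>x. - (p / (Q - p)) * radial_derivative A E N f x)" and v': "v' = (\<lambda>x. f x / N x)"
  shows "in_Lp p M u'" "in_Lp p M v'"
    "integrable M (\<lambda>x. remainder_weight p (v' x) (u' x) * \<bar>v' x - u' x\<bar>\<^sup>2)"
    "Lp_norm p M u' powr p - Lp_norm p M v' powr p =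
      p * (LINT x|M. remainder_weight p (v' x) (u' x) * \<bar>v' x - u' x\<bar>\<^sup>2)"
proof -
  have uE: "u' (E X) = u f p X" for X unfolding u' radial_F[OF f p] by simp
  have vE: "v' (E X) = v f X" for X unfolding v' by (simp add: divide_inverse mult.commute)
  note cu = cont_uv[OF f p]
  show "in_Lp p M u'" 
  proof (rule in_Lp_E)
    show "continuous_on UNIV (\<lambda>X. u' (E X))" unfolding uE by (rule cu(1))
    show "punctured (\<lambda>X. u' (E X))" unfolding uE by (rule cu(3))
  qed (use p in simp)
  show "in_Lp p M v'" 
  proof (rule in_Lp_E)
    show "continuous_on UNIV (\<lambda>X. v' (E X))" unfolding vE by (rule cu(2))
    show "punctured (\<lambda>X. v' (E X))" unfolding vE by (rule cu(4))
  qed (use p in simp)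
  let ?D = "\<lambda>X. norm (u f p X) powr p - norm (v f X) powr p - p * (J p (v f X) \<bullet> (u f p X - v f X))"
  have rE: "remainder_weight p (v' (E X)) (u' (E X)) * \<bar>v' (E X) - u' (E X)\<bar>\<^sup>2 = 1 / p * ?D X" for X
    unfolding uE vE using remainder_identity[OF p(1), of "v f X" "u f p X"] p by (simp add: field_simps)
  note hyps = Ck_F[OF f p] punctured_F[OF f p] p refl refl
  have cD: "continuous_on UNIV (\<lambda>X. 1 / p * ?D X)"
    using p by (intro continuous_on_mult continuous_on_const continuous_on_diff continuous_norm_powr cu
        continuous_on_inner continuous_on_compose2[OF continuous_J[OF p(1)] cu(2)]) auto
  have iD: "integrable lborel ?D"
    using core.integrable_deficit[OF hyps] unfolding core.deficit_def[OF hyps] .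
  show "integrable M (\<lambda>x. remainder_weight p (v' x) (u' x) * \<bar>v' x - u' x\<bar>\<^sup>2)"
    by (rule integrable_E) (simp_all only: rE cD integrable_mult_right iD)
  have "p * (LINT x|M. remainder_weight p (v' x) (u' x) * \<bar>v' x - u' x\<bar>\<^sup>2) = p * (exp_density * (LINT X|lborel. 1 / p * ?D X))"
    by (subst integral_E) (simp_all only: rE cD)
  also have "\<dots> = exp_density * (LINT X|lborel. ?D X)"
    using p by (simp only: integral_mult_right_zero) simp
  also have "(LINT X|lborel. ?D X) = (LINT X|lborel. norm (u f p X) powr p) - (LINT X|lborel. norm (v f X) powr p)"
    using core.integral_deficit[OF hyps] unfolding core.deficit_def[OF hyps] .
  also have "exp_density * \<dots> = (LINT x|M. norm (u' x) powr p) - (LINT x|M. norm (v' x) powr p)"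
    using integral_E[of "\<lambda>x. norm (u' x) powr p"] integral_E[of "\<lambda>x. norm (v' x) powr p"] continuous_norm_powr[OF cu(1), of p] continuous_norm_powr[OF cu(2), of p] p
    unfolding uE vE by (simp add: right_diff_distrib)
  finally show "Lp_norm p M u' powr p - Lp_norm p M v' powr p =
      p * (LINT x|M. remainder_weight p (v' x) (u' x) * \<bar>v' x - u' x\<bar>\<^sup>2)"
    using p by (simp add: Lp_norm_powr)
qed

text \<open>For p = 2 the duality map is the identity and the Bregman divergence is |u - v|^2, in
  any Euclidean target space. The integrated deficit is then itself the identity, rescaled by k = (Q
  - 2) / 2 with radial derivative - k u.\<close>

lemma L2_identity:
  fixes f :: "'g \<Rightarrow> 'b::euclidean_space"
  assumes Q: "Q \<ge> 3" and f: "test_function atlas f"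
  shows "(Lp_norm 2 M (radial_derivative A E N f))\<^sup>2 =
          ((Q - 2) / 2)\<^sup>2 * (Lp_norm 2 M (\<lambda>x. f x /\<^sub>R N x))\<^sup>2 +
          (Lp_norm 2 M (\<lambda>x. radial_derivative A E N f x + ((Q - 2) / 2) *\<^sub>R (f x /\<^sub>R N x)))\<^sup>2"
proof -
  have p: "1 < (2::real)" "2 < Q" using Q by auto
  define k where "k = (Q - 2) / 2"
  have k: "k > 0" using Q by (simp add: k_def)
  have sq: "x powr 2 = x\<^sup>2" if "x \<ge> 0" for x :: real using that by (cases "x = 0") auto
  have J2: "J 2 a = a" for a :: 'b by (cases "a = 0") (auto simp: J_def)
  note cu = cont_uv[OF f p] and hyps = Ck_F[OF f p] punctured_F[OF f p] p refl refl
  have Lp2: "(Lp_norm 2 M g)\<^sup>2 = exp_density * (LINT X|lborel. norm (g (E X)) powr 2)"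
    if "continuous_on UNIV (\<lambda>X. g (E X))" for g :: "'g \<Rightarrow> 'b"
  proof -
    have "(Lp_norm 2 M g)\<^sup>2 = Lp_norm 2 M g powr 2" by (rule sq[symmetric]) (simp add: Lp_norm_def)
    then show ?thesis using Lp_norm_powr[of 2 g] integral_E[OF continuous_norm_powr[OF that, of 2]] by simp
  qed
  have RE: "radial_derivative A E N f (E X) = - k *\<^sub>R u f 2 X" for X
  proof -
    have "- k * - (2 / (Q - 2)) = 1" using Q by (simp add: k_def)
    then show ?thesis unfolding radial_F[OF f p] scaleR_scaleR[of "- k" "- (2 / (Q - 2))"] by simp
  qed
  let ?U = "LINT X|lborel. norm (u f 2 X) powr 2" and ?V = "LINT X|lborel. norm (v f X) powr 2"
  have c1: "continuous_on UNIV (\<lambda>X. - k *\<^sub>R u f 2 X)" and c2: "continuous_on UNIV (\<lambda>X. - k *\<^sub>R u f 2 X + k *\<^sub>R v f X)"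
    by (intro continuous_on_add continuous_on_scaleR continuous_on_const cu)+
  have 1: "(Lp_norm 2 M (radial_derivative A E N f))\<^sup>2 = exp_density * (k\<^sup>2 * ?U)"
  proof -
    have "norm (- k *\<^sub>R a) powr 2 = k\<^sup>2 * norm a powr 2" for a :: 'b
      by (simp add: sq power_mult_distrib)
    then show ?thesis using Lp2[of "radial_derivative A E N f"] c1 by (simp only: RE integral_mult_right_zero)
  qed
  have 2: "(Lp_norm 2 M (\<lambda>x. f x /\<^sub>R N x))\<^sup>2 = exp_density * ?V"
    by (rule Lp2[OF cu(2)])
  have 3: "(Lp_norm 2 M (\<lambda>x. radial_derivative A E N f x + k *\<^sub>R (f x /\<^sub>R N x)))\<^sup>2 = exp_density * (k\<^sup>2 * (?U - ?V))"
  proof -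
    have "norm (- k *\<^sub>R a + k *\<^sub>R b) powr 2 = k\<^sup>2 * (norm a powr 2 - norm b powr 2 - 2 * (J 2 b \<bullet> (a - b)))" for a b :: 'b
    proof -
      have "- k *\<^sub>R a + k *\<^sub>R b = k *\<^sub>R (b - a)" by (simp add: scaleR_diff_right)
      then have "norm (- k *\<^sub>R a + k *\<^sub>R b) powr 2 = k\<^sup>2 * (norm (b - a))\<^sup>2"
        by (simp add: sq power_mult_distrib)
      also have "(norm (b - a))\<^sup>2 = (norm a)\<^sup>2 - (norm b)\<^sup>2 - 2 * (b \<bullet> (a - b))"
        by (simp add: power2_norm_eq_inner inner_diff_left inner_diff_right inner_commute)
      finally show ?thesis by (simp add: sq J2)
    qed
    then have "(Lp_norm 2 M (\<lambda>x. radial_derivative A E N f x + k *\<^sub>R (f x /\<^sub>R N x)))\<^sup>2 =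
        exp_density * (k\<^sup>2 * (LINT X|lborel. norm (u f 2 X) powr 2 - norm (v f X) powr 2 - 2 * (J 2 (v f X) \<bullet> (u f 2 X - v f X))))"
      using Lp2[of "\<lambda>x. radial_derivative A E N f x + k *\<^sub>R (f x /\<^sub>R N x)"] c2 by (simp only: RE integral_mult_right_zero)
    then show ?thesis using core.integral_deficit[OF hyps] unfolding core.deficit_def[OF hyps] by (simp only:)
  qed
  show ?thesis unfolding k_def[symmetric] 1 2 3 by (simp add: algebra_simps)
qed

end

theorem theorem3p1:
  fixes atlas :: "('g::{topological_group_add, t2_space, second_countable_topology},
                   'e::euclidean_space) chart set"
    and \<kappa> :: "('g, 'e) chart"
    and A :: "'e \<Rightarrow> 'e"
    and E :: "'e \<Rightarrow> 'g"
    and M :: "'g measure"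
    and N :: "'g \<Rightarrow> real"
    and p Q :: real
  assumes "homogeneous_group atlas \<kappa> A"
    and "exponential_map \<kappa> E" and "global_diffeomorphism atlas E"
    and "haar_measure M"
    and "homogeneous_quasi_norm A E N"
    and "Q = homogeneous_dimension A"
    and "1 < p" and "p < Q"
  shows
    "(\<forall>f :: 'g \<Rightarrow> complex. test_function atlas f \<longrightarrow>
        in_Lp p M (\<lambda>x. f x /\<^sub>R N x) \<and> in_Lp p M (radial_derivative A E N f) \<and>
        Lp_norm p M (\<lambda>x. f x /\<^sub>R N x) \<le> p / (Q - p) * Lp_norm p M (radial_derivative A E N f) \<and>
        (Lp_norm p M (\<lambda>x. f x /\<^sub>R N x) = p / (Q - p) * Lp_norm p M (radial_derivative A E N f)
           \<longleftrightarrow> f = (\<lambda>x. 0)))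
     \<and>
     (\<forall>C :: real.
        (\<forall>f :: 'g \<Rightarrow> complex. test_function atlas f \<longrightarrow>
           Lp_norm p M (\<lambda>x. f x /\<^sub>R N x) \<le> C * Lp_norm p M (radial_derivative A E N f))
        \<longrightarrow> p / (Q - p) \<le> C)
     \<and>
     (\<forall>(f :: 'g \<Rightarrow> real) u v. test_function atlas f \<longrightarrow>
        u = (\<lambda>x. - (p / (Q - p)) * radial_derivative A E N f x) \<longrightarrow>
        v = (\<lambda>x. f x / N x) \<longrightarrow>
        in_Lp p M u \<and> in_Lp p M v \<and>
        integrable M (\<lambda>x. remainder_weight p (v x) (u x) * \<bar>v x - u x\<bar>\<^sup>2) \<and>
        Lp_norm p M u powr p - Lp_norm p M v powr p =
          p * (LINT x|M. remainder_weight p (v x) (u x) * \<bar>v x - u x\<bar>\<^sup>2))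
     \<and>
     (Q \<ge> 3 \<longrightarrow> (\<forall>f :: 'g \<Rightarrow> complex. test_function atlas f \<longrightarrow>
        in_Lp 2 M (radial_derivative A E N f) \<and> in_Lp 2 M (\<lambda>x. f x /\<^sub>R N x) \<and>
        (Lp_norm 2 M (radial_derivative A E N f))\<^sup>2 =
          ((Q - 2) / 2)\<^sup>2 * (Lp_norm 2 M (\<lambda>x. f x /\<^sub>R N x))\<^sup>2 +
          (Lp_norm 2 M (\<lambda>x. radial_derivative A E N f x + ((Q - 2) / 2) *\<^sub>R (f x /\<^sub>R N x)))\<^sup>2))"
proof -
  interpret H: haar_homogeneous_group atlas \<kappa> A E M N
    by (intro haar_homogeneous_group.intro haar_homogeneous_group_axioms.intro assms)
  have p: "1 < p" "p < homogeneous_dimension A" using assms by auto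
  show ?thesis
    unfolding assms(6)
    apply (intro conjI allI impI)
    subgoal by (rule H.f_Lp[OF _ p])
    subgoal by (rule H.radial_Lp[OF _ p])
    subgoal by (rule H.radial_hardy(1)[OF _ p])
    subgoal by (rule H.radial_hardy(2)[OF _ p])
    subgoal by (rule H.radial_hardy_sharp[OF p]) blast
    subgoal by (rule H.real_remainder(1)[OF p])
    subgoal by (rule H.real_remainder(2)[OF p])
    subgoal by (rule H.real_remainder(3)[OF p])
    subgoal by (rule H.real_remainder(4)[OF p])
    subgoal by (rule H.radial_Lp) auto
    subgoal by (rule H.f_Lp) auto
    subgoal by (rule H.L2_identity)
    done
qed

end
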